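(* Let $A=gl_n^{rsym}$ over a field $\mathcal K$ of characteristic $0$. Let $M$ be a finite-dimensional $A$-module such that the $A^{lie}$-module $M$ is a tensor module. Then the cup product $M\times\mathcal K\to M$, $m\cup\lambda=\lambda m$, induces an isomorphism $$H^{k+1}_{rsym}(A,M)\cong Z^1_{rsym}(A,M)\otimes H^k_{lie}(A,\mathcal K),\qquad k>0.$$
   Context: $gl_n^{rsym}$ is the associative algebra of $n\times n$ matrices over $\mathcal K$ with the usual product $\circ$, regarded as a right-symmetric algebra ($(a,b,c)=(a,c,b)$ with $(a,b,c)=a\circ(b\circ c)-(a\circ b)\circ c$); $A^{lie}=gl_n$ with $[a,b]=a\circ b-b\circ a$. A module over a right-symmetric algebra $A$ is a vector space $M$ with bilinear actions $m\circ a$, $a\circ m$ such that $m\circ[a,b]=(m\circ a)\circ b-(m\circ b)\circ a$ and $(a\circ m)\circ b-a\circ(m\circ b)-(a\circ b)\circ m+a\circ(b\circ m)=0$. It is an $A^{lie}$-module via $[a,m]=a\circ m-m\circ a$. A tensor module over $gl_n$ is a finite-dimensional module isomorphic to a submodule of a finite direct sum of tensor products $V\otimes\cdots\otimes V\otimes V'\otimes\cdots\otimes V'$ of copies of the standard module $V$ and its dual $V'$. $C^0_{rsym}(A,M)=\{m:m\circ(a\circ b)=(m\circ a)\circ b\ \forall a,b\}$, $C^{k+1}_{rsym}(A,M)=\mathrm{Hom}(A\otimes\wedge^kA,M)$, $k\ge0$, with $d_{rsym}m(a)=a\circ m-m\circ a$ and, for $\psi\in C^k_{rsym}$, $k\ge1$,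 $$d_{rsym}\psi(a_0,\ldots,a_k)=\sum_{i=1}^k(-1)^{i+1}\{a_0\circ\psi(a_i,a_1,..,\widehat{a_i},..,a_k)-\psi(a_0\circ a_i,a_1,..,\widehat{a_i},..,a_k)+\psi(a_0,a_1,..,\widehat{a_i},..,a_k)\circ a_i\}$$ $$+\sum_{1\le i<j\le k}(-1)^{i+1}\psi(a_0,a_1,..,\widehat{a_i},..,a_{j-1},[a_i,a_j],..,a_k);$$ $Z^k_{rsym},H^k_{rsym}$ are cocycles and cohomology; $H^k_{lie}(A,\mathcal K)$ is Chevalley–Eilenberg cohomology of $A^{lie}$ with trivial coefficients. The induced map sends $\psi\otimes[\phi]$, $\psi\in Z^1_{rsym}(A,M)$, to the class of $(\psi\cup\phi)(a_0,a_1,\ldots,a_k)=\phi(a_1,\ldots,a_k)\psi(a_0)$. *)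

theory Defs
  imports
    "HOL-Analysis.Finite_Cartesian_Product"
    "HOL-Library.Function_Algebras"
    "HOL-Library.Set_Algebras"
begin

section \<open>Linear algebra: function spaces, quotients, tensor products\<close>

text \<open>All spaces below are subspaces of function spaces with pointwise operations, or quotients
  of such subspaces.\<close>

definition pw_scale :: "('k \<Rightarrow> 'v \<Rightarrow> 'v) \<Rightarrow> 'k \<Rightarrow> ('i \<Rightarrow> 'v) \<Rightarrow> 'i \<Rightarrow> 'v" where
  "pw_scale s c f = (\<lambda>i. s c (f i))"

lemma vector_space_pw_scale:
  assumes "vector_space s"
  shows "vector_space (pw_scale s)"
proof -
  interpret vector_space s by fact
  show ?thesis
    by standard (auto simp: pw_scale_def fun_eq_iff scale_right_distrib scale_left_distrib)
qed

lemma vector_space_times: "vector_space ((*) :: 'k::field \<Rightarrow> 'k \<Rightarrow> 'k)"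
  by standard (auto simp: algebra_simps)

text \<open>\<open>S / T\<close> is the set of cosets \<open>x +o T\<close>. The sum of two cosets of a subspace \<open>T\<close> is their
  elementwise sum, i.e. the \<open>+\<close> of \<open>Set_Algebras\<close>. The elementwise multiple \<open>s c ` C\<close> of a
  coset is a coset only for \<open>c \<noteq> 0\<close>; adding \<open>T\<close> repairs \<open>c = 0\<close> and changes nothing
  otherwise.\<close>

definition quotient_space :: "'v::ab_group_add set \<Rightarrow> 'v set \<Rightarrow> 'v set set" where
  "quotient_space S T = (\<lambda>x. x +o T) ` S"

definition quotient_scale ::
    "('k \<Rightarrow> 'v \<Rightarrow> 'v) \<Rightarrow> 'v::ab_group_add set \<Rightarrow> 'k \<Rightarrow> 'v set \<Rightarrow> 'v set" where
  "quotient_scale s T c C = s c ` C + T"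

lemma quotient_space_add:
  assumes "vector_space s" "module.subspace s T"
  shows "(x +o T) + (y +o T) = (x + y) +o T"
proof -
  interpret vector_space s by fact
  have "T + T = T"
    using assms(2) subspace_0[OF assms(2)]
    by (force simp: set_plus_def subspace_def)
  then show ?thesis by (simp add: set_plus_rearrange)
qed

lemma quotient_space_scale:
  assumes "vector_space s" "module.subspace s T"
  shows "quotient_scale s T c (x +o T) = s c x +o T"
proof -
  interpret vector_space s by fact
  show ?thesis
  proof (intro set_eqI iffI)
    fix z assume "z \<in> quotient_scale s T c (x +o T)"
    then obtain t u where "t \<in> T" "u \<in> T" "z = s c (x + t) + u"
      by (auto simp: quotient_scale_def set_plus_def elt_set_plus_def)
    then show "z \<in> s c x +o T"
      using assms(2) by (auto simp: elt_set_plus_def scale_right_distrib add.assoc subspace_def)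
  next
    fix z assume "z \<in> s c x +o T"
    then obtain u where "u \<in> T" "z = s c (x + 0) + u"
      by (auto simp: elt_set_plus_def)
    then show "z \<in> quotient_scale s T c (x +o T)"
      using subspace_0[OF assms(2)]
      unfolding quotient_scale_def set_plus_def elt_set_plus_def by blast
  qed
qed

definition linear_iso_on ::
    "('k \<Rightarrow> 'u \<Rightarrow> 'u) \<Rightarrow> 'u::plus set \<Rightarrow> ('k \<Rightarrow> 'w \<Rightarrow> 'w) \<Rightarrow> 'w::plus set \<Rightarrow> ('u \<Rightarrow> 'w) \<Rightarrow> bool" where
  "linear_iso_on s1 U s2 W f \<longleftrightarrow>
     bij_betw f U W \<and>
     (\<forall>x\<in>U. \<forall>y\<in>U. f (x + y) = f x + f y) \<and>
     (\<forall>c. \<forall>x\<in>U. f (s1 c x) = s2 c (f x))"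

text \<open>The tensor product of \<open>(U, +, s1)\<close> and \<open>(W, +, s2)\<close>: the free vector space on \<open>U \<times> W\<close>
  modulo the bilinearity relations. The carriers are only required to have a \<open>+\<close> so that \<open>U\<close> or
  \<open>W\<close> may be a quotient space.\<close>

definition free_gen :: "'x \<Rightarrow> 'x \<Rightarrow> 'k::field" where
  "free_gen x = (\<lambda>y. if y = x then 1 else 0)"

definition free_space :: "'x set \<Rightarrow> ('x \<Rightarrow> 'k::field) set" where
  "free_space X = {f. finite {x. f x \<noteq> 0} \<and> {x. f x \<noteq> 0} \<subseteq> X}"

definition tensor_relations ::
    "('k::field \<Rightarrow> 'u::plus \<Rightarrow> 'u) \<Rightarrow> 'u set \<Rightarrow> ('k \<Rightarrow> 'w::plus \<Rightarrow> 'w) \<Rightarrow> 'w set \<Rightarrow> ('u \<times> 'w \<Rightarrow> 'k) set"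
  where
  "tensor_relations s1 U s2 W = module.span (pw_scale (*))
     ({free_gen (u + u', w) - free_gen (u, w) - free_gen (u', w) |u u' w. u \<in> U \<and> u' \<in> U \<and> w \<in> W} \<union>
      {free_gen (u, w + w') - free_gen (u, w) - free_gen (u, w') |u w w'. u \<in> U \<and> w \<in> W \<and> w' \<in> W} \<union>
      {free_gen (s1 c u, w) - pw_scale (*) c (free_gen (u, w)) |c u w. u \<in> U \<and> w \<in> W} \<union>
      {free_gen (u, s2 c w) - pw_scale (*) c (free_gen (u, w)) |c u w. u \<in> U \<and> w \<in> W})"

definition tensor_product ::
    "('k::field \<Rightarrow> 'u::plus \<Rightarrow> 'u) \<Rightarrow> 'u set \<Rightarrow> ('k \<Rightarrow> 'w::plus \<Rightarrow> 'w) \<Rightarrow> 'w set \<Rightarrow>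
     ('u \<times> 'w \<Rightarrow> 'k) set set" where
  "tensor_product s1 U s2 W = quotient_space (free_space (U \<times> W)) (tensor_relations s1 U s2 W)"

definition tensor_scale ::
    "('k::field \<Rightarrow> 'u::plus \<Rightarrow> 'u) \<Rightarrow> 'u set \<Rightarrow> ('k \<Rightarrow> 'w::plus \<Rightarrow> 'w) \<Rightarrow> 'w set \<Rightarrow>
     'k \<Rightarrow> ('u \<times> 'w \<Rightarrow> 'k) set \<Rightarrow> ('u \<times> 'w \<Rightarrow> 'k) set" where
  "tensor_scale s1 U s2 W = quotient_scale (pw_scale (*)) (tensor_relations s1 U s2 W)"

definition pure_tensor ::
    "('k::field \<Rightarrow> 'u::plus \<Rightarrow> 'u) \<Rightarrow> 'u set \<Rightarrow> ('k \<Rightarrow> 'w::plus \<Rightarrow> 'w) \<Rightarrow> 'w set \<Rightarrow>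
     'u \<Rightarrow> 'w \<Rightarrow> ('u \<times> 'w \<Rightarrow> 'k) set" where
  "pure_tensor s1 U s2 W u w = free_gen (u, w) +o tensor_relations s1 U s2 W"


section \<open>Right-symmetric algebras and their modules\<close>

definition bilinear_map ::
    "('k::field \<Rightarrow> 'a::ab_group_add \<Rightarrow> 'a) \<Rightarrow> ('k \<Rightarrow> 'b::ab_group_add \<Rightarrow> 'b) \<Rightarrow>
     ('k \<Rightarrow> 'c::ab_group_add \<Rightarrow> 'c) \<Rightarrow> ('a \<Rightarrow> 'b \<Rightarrow> 'c) \<Rightarrow> bool" where
  "bilinear_map sA sB sC f \<longleftrightarrow>
     (\<forall>a. Vector_Spaces.linear sB sC (f a)) \<and> (\<forall>b. Vector_Spaces.linear sA sC (\<lambda>a. f a b))"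

definition associator :: "('a \<Rightarrow> 'a \<Rightarrow> 'a) \<Rightarrow> 'a \<Rightarrow> 'a \<Rightarrow> 'a \<Rightarrow> 'a::ab_group_add" where
  "associator mul a b c = mul a (mul b c) - mul (mul a b) c"

definition commutator :: "('a \<Rightarrow> 'a \<Rightarrow> 'a) \<Rightarrow> 'a \<Rightarrow> 'a \<Rightarrow> 'a::ab_group_add" where
  "commutator mul a b = mul a b - mul b a"

definition right_symmetric_algebra ::
    "('k::field \<Rightarrow> 'a::ab_group_add \<Rightarrow> 'a) \<Rightarrow> ('a \<Rightarrow> 'a \<Rightarrow> 'a) \<Rightarrow> bool" where
  "right_symmetric_algebra sA mul \<longleftrightarrow>
     vector_space sA \<and> bilinear_map sA sA sA mul \<and>
     (\<forall>a b c. associator mul a b c = associator mul a c b)"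

text \<open>Modules: \<open>l a m\<close> is \<open>a \<circ> m\<close> and \<open>r m a\<close> is \<open>m \<circ> a\<close>.\<close>

definition rsym_module ::
    "('k::field \<Rightarrow> 'a::ab_group_add \<Rightarrow> 'a) \<Rightarrow> ('a \<Rightarrow> 'a \<Rightarrow> 'a) \<Rightarrow>
     ('k \<Rightarrow> 'm::ab_group_add \<Rightarrow> 'm) \<Rightarrow> ('a \<Rightarrow> 'm \<Rightarrow> 'm) \<Rightarrow> ('m \<Rightarrow> 'a \<Rightarrow> 'm) \<Rightarrow> bool" where
  "rsym_module sA mul sM l r \<longleftrightarrow>
     right_symmetric_algebra sA mul \<and> vector_space sM \<and>
     bilinear_map sA sM sM l \<and> bilinear_map sM sA sM r \<and>
     (\<forall>m a b. r m (commutator mul a b) = r (r m a) b - r (r m b) a) \<and>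
     (\<forall>m a b. r (l a m) b - l a (r m b) - l (mul a b) m + l a (l b m) = 0)"

definition lie_action :: "('a \<Rightarrow> 'm \<Rightarrow> 'm) \<Rightarrow> ('m \<Rightarrow> 'a \<Rightarrow> 'm) \<Rightarrow> 'a \<Rightarrow> 'm \<Rightarrow> 'm::ab_group_add" where
  "lie_action l r a m = l a m - r m a"


section \<open>Cochain complexes\<close>

text \<open>A \<open>k\<close>-cochain is a function on lists of arguments that vanishes on lists of length other
  than \<open>k\<close>. The number \<open>p\<close> is the position from which on the arguments are alternating, so
  \<open>p = 0\<close> gives \<open>Hom(\<Lambda>\<^sup>k A, M)\<close> and \<open>p = 1\<close> gives \<open>Hom(A \<otimes> \<Lambda>\<^sup>k\<^sup>-\<^sup>1 A, M)\<close>.\<close>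

definition multilinear_alternating_from ::
    "nat \<Rightarrow> ('k::field \<Rightarrow> 'a::ab_group_add \<Rightarrow> 'a) \<Rightarrow> ('k \<Rightarrow> 'm::ab_group_add \<Rightarrow> 'm) \<Rightarrow> nat \<Rightarrow>
     ('a list \<Rightarrow> 'm) set" where
  "multilinear_alternating_from p sA sM k = {f.
     (\<forall>xs. length xs \<noteq> k \<longrightarrow> f xs = 0) \<and>
     (\<forall>xs i. length xs = k \<longrightarrow> i < k \<longrightarrow> Vector_Spaces.linear sA sM (\<lambda>x. f (xs[i := x]))) \<and>
     (\<forall>xs i j. length xs = k \<longrightarrow> p \<le> i \<longrightarrow> i < j \<longrightarrow> j < k \<longrightarrow> xs ! i = xs ! j \<longrightarrow> f xs = 0)}"

definition omit :: "nat \<Rightarrow> 'a list \<Rightarrow> 'a list" where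
  "omit i xs = take i xs @ drop (Suc i) xs"

subsection \<open>Chevalley--Eilenberg complex of \<open>A\<^sup>l\<^sup>i\<^sup>e\<close> with trivial coefficients\<close>

definition lie_C ::
    "('k::field \<Rightarrow> 'a::ab_group_add \<Rightarrow> 'a) \<Rightarrow> nat \<Rightarrow> ('a list \<Rightarrow> 'k) set" where
  "lie_C sA k = multilinear_alternating_from 0 sA (*) k"

definition lie_d ::
    "('a::ab_group_add \<Rightarrow> 'a \<Rightarrow> 'a) \<Rightarrow> nat \<Rightarrow> ('a list \<Rightarrow> 'k::field) \<Rightarrow> 'a list \<Rightarrow> 'k" where
  "lie_d mul k \<phi> xs =
     (if length xs = Suc k then
        \<Sum>j\<le>k. \<Sum>i<j. (-1) ^ (i + j) * \<phi> (commutator mul (xs ! i) (xs ! j) # omit i (omit j xs))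
      else 0)"

definition lie_Z where
  "lie_Z sA mul k = {\<phi> \<in> lie_C sA k. lie_d mul k \<phi> = 0}"

definition lie_B where
  "lie_B sA mul k = (case k of 0 \<Rightarrow> {0} | Suc k' \<Rightarrow> lie_d mul k' ` lie_C sA k')"

definition lie_H ::
    "('k::field \<Rightarrow> 'a::ab_group_add \<Rightarrow> 'a) \<Rightarrow> ('a \<Rightarrow> 'a \<Rightarrow> 'a) \<Rightarrow> nat \<Rightarrow> ('a list \<Rightarrow> 'k) set set" where
  "lie_H sA mul k = quotient_space (lie_Z sA mul k) (lie_B sA mul k)"

definition lie_H_scale ::
    "('k::field \<Rightarrow> 'a::ab_group_add \<Rightarrow> 'a) \<Rightarrow> ('a \<Rightarrow> 'a \<Rightarrow> 'a) \<Rightarrow> nat \<Rightarrow>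
     'k \<Rightarrow> ('a list \<Rightarrow> 'k) set \<Rightarrow> ('a list \<Rightarrow> 'k) set" where
  "lie_H_scale sA mul k = quotient_scale (pw_scale (*)) (lie_B sA mul k)"

definition lie_class ::
    "('k::field \<Rightarrow> 'a::ab_group_add \<Rightarrow> 'a) \<Rightarrow> ('a \<Rightarrow> 'a \<Rightarrow> 'a) \<Rightarrow> nat \<Rightarrow>
     ('a list \<Rightarrow> 'k) \<Rightarrow> ('a list \<Rightarrow> 'k) set" where
  "lie_class sA mul k \<phi> = \<phi> +o lie_B sA mul k"

subsection \<open>Right-symmetric complex\<close>

text \<open>An element \<open>m\<close> of degree \<open>0\<close> is represented by the cochain with value \<open>m\<close> at \<open>[]\<close>.\<close>

definition rsym_C ::
    "('k::field \<Rightarrow> 'a::ab_group_add \<Rightarrow> 'a) \<Rightarrow> ('a \<Rightarrow> 'a \<Rightarrow> 'a) \<Rightarrow>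
     ('k \<Rightarrow> 'm::ab_group_add \<Rightarrow> 'm) \<Rightarrow> ('m \<Rightarrow> 'a \<Rightarrow> 'm) \<Rightarrow> nat \<Rightarrow> ('a list \<Rightarrow> 'm) set" where
  "rsym_C sA mul sM r k =
     (case k of
        0 \<Rightarrow> {f. (\<forall>xs. xs \<noteq> [] \<longrightarrow> f xs = 0) \<and> (\<forall>a b. r (f []) (mul a b) = r (r (f []) a) b)}
      | Suc _ \<Rightarrow> multilinear_alternating_from 1 sA sM k)"

text \<open>In the argument list \<open>xs = [a\<^sub>0, \<dots>, a\<^sub>k]\<close> the entry \<open>a\<^sub>0\<close> plays a special role;
  \<open>tl (omit i xs)\<close> is \<open>a\<^sub>1, \<dots>, a\<^sub>k\<close> without \<open>a\<^sub>i\<close>.\<close>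

definition rsym_d ::
    "('a::ab_group_add \<Rightarrow> 'a \<Rightarrow> 'a) \<Rightarrow> ('k::field \<Rightarrow> 'm::ab_group_add \<Rightarrow> 'm) \<Rightarrow>
     ('a \<Rightarrow> 'm \<Rightarrow> 'm) \<Rightarrow> ('m \<Rightarrow> 'a \<Rightarrow> 'm) \<Rightarrow> nat \<Rightarrow> ('a list \<Rightarrow> 'm) \<Rightarrow> 'a list \<Rightarrow> 'm" where
  "rsym_d mul sM l r k \<psi> xs =
     (if length xs \<noteq> Suc k then 0
      else if k = 0 then l (xs ! 0) (\<psi> []) - r (\<psi> []) (xs ! 0)
      else
        (\<Sum>i=1..k. sM ((-1) ^ (i + 1))
           (l (xs ! 0) (\<psi> (xs ! i # tl (omit i xs)))
            - \<psi> (mul (xs ! 0) (xs ! i) # tl (omit i xs))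
            + r (\<psi> (omit i xs)) (xs ! i)))
        + (\<Sum>j=1..k. \<Sum>i=1..<j. sM ((-1) ^ (i + 1))
             (\<psi> (omit i (xs[j := commutator mul (xs ! i) (xs ! j)])))))"

definition rsym_Z where
  "rsym_Z sA mul sM l r k = {\<psi> \<in> rsym_C sA mul sM r k. rsym_d mul sM l r k \<psi> = 0}"

definition rsym_B where
  "rsym_B sA mul sM l r k =
     (case k of 0 \<Rightarrow> {0} | Suc k' \<Rightarrow> rsym_d mul sM l r k' ` rsym_C sA mul sM r k')"

definition rsym_H ::
    "('k::field \<Rightarrow> 'a::ab_group_add \<Rightarrow> 'a) \<Rightarrow> ('a \<Rightarrow> 'a \<Rightarrow> 'a) \<Rightarrow>
     ('k \<Rightarrow> 'm::ab_group_add \<Rightarrow> 'm) \<Rightarrow> ('a \<Rightarrow> 'm \<Rightarrow> 'm) \<Rightarrow> ('m \<Rightarrow> 'a \<Rightarrow> 'm) \<Rightarrow> nat \<Rightarrow>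
     ('a list \<Rightarrow> 'm) set set" where
  "rsym_H sA mul sM l r k = quotient_space (rsym_Z sA mul sM l r k) (rsym_B sA mul sM l r k)"

definition rsym_H_scale ::
    "('k::field \<Rightarrow> 'a::ab_group_add \<Rightarrow> 'a) \<Rightarrow> ('a \<Rightarrow> 'a \<Rightarrow> 'a) \<Rightarrow>
     ('k \<Rightarrow> 'm::ab_group_add \<Rightarrow> 'm) \<Rightarrow> ('a \<Rightarrow> 'm \<Rightarrow> 'm) \<Rightarrow> ('m \<Rightarrow> 'a \<Rightarrow> 'm) \<Rightarrow> nat \<Rightarrow>
     'k \<Rightarrow> ('a list \<Rightarrow> 'm) set \<Rightarrow> ('a list \<Rightarrow> 'm) set" where
  "rsym_H_scale sA mul sM l r k = quotient_scale (pw_scale sM) (rsym_B sA mul sM l r k)"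

definition rsym_class ::
    "('k::field \<Rightarrow> 'a::ab_group_add \<Rightarrow> 'a) \<Rightarrow> ('a \<Rightarrow> 'a \<Rightarrow> 'a) \<Rightarrow>
     ('k \<Rightarrow> 'm::ab_group_add \<Rightarrow> 'm) \<Rightarrow> ('a \<Rightarrow> 'm \<Rightarrow> 'm) \<Rightarrow> ('m \<Rightarrow> 'a \<Rightarrow> 'm) \<Rightarrow> nat \<Rightarrow>
     ('a list \<Rightarrow> 'm) \<Rightarrow> ('a list \<Rightarrow> 'm) set" where
  "rsym_class sA mul sM l r k \<psi> = \<psi> +o rsym_B sA mul sM l r k"

text \<open>The cup product of a right-symmetric \<open>1\<close>-cochain with a Lie cochain, built on the pairing
  \<open>M \<times> K \<rightarrow> M\<close>, \<open>m \<union> \<lambda> = \<lambda> m\<close>.\<close>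

definition cup ::
    "('k::field \<Rightarrow> 'm::ab_group_add \<Rightarrow> 'm) \<Rightarrow> ('a list \<Rightarrow> 'm) \<Rightarrow> ('a list \<Rightarrow> 'k) \<Rightarrow> 'a list \<Rightarrow> 'm" where
  "cup sM \<psi> \<phi> xs = (case xs of [] \<Rightarrow> 0 | a # as \<Rightarrow> sM (\<phi> as) (\<psi> [a]))"


section \<open>The algebra of matrices\<close>

definition mat_scale :: "'k::field \<Rightarrow> 'k^'n^'n \<Rightarrow> 'k^'n^'n" where
  "mat_scale c A = (\<chi> i j. c * A $ i $ j)"

lemma vector_space_mat_scale: "vector_space (mat_scale :: 'k::field \<Rightarrow> 'k^'n^'n \<Rightarrow> 'k^'n^'n)"
  by standard (auto simp: mat_scale_def vec_eq_iff algebra_simps)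

lemma right_symmetric_algebra_matrix:
  "right_symmetric_algebra mat_scale ((**) :: 'k::field^'n^'n \<Rightarrow> 'k^'n^'n \<Rightarrow> 'k^'n^'n)"
proof -
  have lin: "Vector_Spaces.linear mat_scale mat_scale f"
    if "\<And>x y. f (x + y) = f x + f y" "\<And>c x. f (mat_scale c x) = mat_scale c (f x)"
    for f :: "'k^'n^'n \<Rightarrow> 'k^'n^'n"
    using that vector_space_mat_scale
    by (simp add: Vector_Spaces.linear_def module_hom_def module_hom_axioms_def
        vector_space_def module_def)
  have "bilinear_map mat_scale mat_scale mat_scale ((**) :: 'k^'n^'n \<Rightarrow> 'k^'n^'n \<Rightarrow> 'k^'n^'n)"
    unfolding bilinear_map_def
    by (intro conjI allI lin)
      (simp_all add: mat_scale_def vec_eq_iff matrix_matrix_mult_def sum_distrib_left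
        sum.distrib algebra_simps)
  moreover have "associator (**) a b c = 0" for a b c :: "'k^'n^'n"
    by (simp add: associator_def matrix_mul_assoc)
  ultimately show ?thesis
    unfolding right_symmetric_algebra_def by (simp add: vector_space_mat_scale)
qed


section \<open>Tensor modules over \<open>gl\<^sub>n\<close>\<close>

text \<open>\<open>V\<^sup>\<otimes>\<^sup>p \<otimes> V'\<^sup>\<otimes>\<^sup>q\<close> for the standard module \<open>V = K\<^sup>n\<close> (with \<open>a \<cdot> v = a *v v\<close>) and its dual
  \<open>V'\<close> (row vectors, with \<open>a \<cdot> w = - (w v* a)\<close>) is realised as the space of coordinate arrays
  \<open>t (I, J)\<close>, indexed by a word \<open>I\<close> of length \<open>p\<close> and a word \<open>J\<close> of length \<open>q\<close> in the index type.
  The action is the derivation action; see \<open>mixed_action_pure\<close>.\<close>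

type_synonym ('k, 'n) tensor_array = "'n list \<times> 'n list \<Rightarrow> 'k"

definition mixed_tensors :: "nat \<Rightarrow> nat \<Rightarrow> ('k::field, 'n::finite) tensor_array set" where
  "mixed_tensors p q = {t. \<forall>I J. \<not> (length I = p \<and> length J = q) \<longrightarrow> t (I, J) = 0}"

definition mixed_action ::
    "'k::field^'n^'n \<Rightarrow> ('k, 'n) tensor_array \<Rightarrow> ('k, 'n) tensor_array" where
  "mixed_action a t = (\<lambda>(I, J).
     (\<Sum>s<length I. \<Sum>h\<in>UNIV. a $ (I ! s) $ h * t (I[s := h], J))
     - (\<Sum>s<length J. \<Sum>h\<in>UNIV. t (I, J[s := h]) * a $ h $ (J ! s)))"

text \<open>The array of \<open>v\<^sub>1 \<otimes> \<dots> \<otimes> v\<^sub>p \<otimes> w\<^sub>1 \<otimes> \<dots> \<otimes> w\<^sub>q\<close>:\<close>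

definition mixed_pure :: "('k::field^'n) list \<Rightarrow> ('k^'n) list \<Rightarrow> ('k, 'n::finite) tensor_array" where
  "mixed_pure vs ws = (\<lambda>(I, J).
     if length I = length vs \<and> length J = length ws
     then (\<Prod>s<length vs. vs ! s $ (I ! s)) * (\<Prod>s<length ws. ws ! s $ (J ! s)) else 0)"

lemma mixed_pure_axis:
  "mixed_pure (map (\<lambda>i. axis i 1) I) (map (\<lambda>i. axis i 1) J) =
     (free_gen (I, J) :: ('k::field, 'n::finite) tensor_array)"
proof (rule ext, clarify)
  fix I' J' :: "'n list"
  have *: "(\<Prod>s<length I. axis (I ! s) 1 $ (I' ! s)) = (if I' = I then 1 else 0 :: 'k)"
    if len: "length I' = length I" for I I' :: "'n list"
  proof (cases "I' = I")
    case False
    then obtain s where "s < length I" "I ! s \<noteq> I' ! s"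
      using len by (metis list_eq_iff_nth_eq)
    then have "(\<Prod>s<length I. axis (I ! s) 1 $ (I' ! s)) = (0 :: 'k)"
      by (intro prod_zero) (auto simp: axis_def intro!: bexI[of _ s])
    with False show ?thesis by simp
  qed (simp add: axis_def)
  show "mixed_pure (map (\<lambda>i. axis i 1) I) (map (\<lambda>i. axis i 1) J) (I', J') =
      (free_gen (I, J) (I', J') :: 'k)"
  proof (cases "length I' = length I \<and> length J' = length J")
    case True
    then have "mixed_pure (map (\<lambda>i. axis i 1) I) (map (\<lambda>i. axis i 1) J) (I', J') =
        (\<Prod>s<length I. axis (I ! s) 1 $ (I' ! s)) * (\<Prod>s<length J. axis (J ! s) 1 $ (J' ! s) :: 'k)"
      by (simp add: mixed_pure_def)
    with True show ?thesis by (simp add: * free_gen_def)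
  qed (auto simp: mixed_pure_def free_gen_def)
qed

lemma prod_upd:
  fixes vs :: "('k::field^'n) list"
  assumes "s < length vs" "length I = length vs"
  shows "(\<Prod>t<length vs. vs ! t $ (I[s := h] ! t)) =
           vs ! s $ h * (\<Prod>t\<in>{..<length vs} - {s}. vs ! t $ (I ! t))"
    and "(\<Prod>t<length vs. vs[s := v] ! t $ (I ! t)) =
           v $ (I ! s) * (\<Prod>t\<in>{..<length vs} - {s}. vs ! t $ (I ! t))"
  using assms by (auto simp: prod.remove[of "{..<length vs}" s] intro!: prod.cong)

lemma mixed_action_pure:
  fixes a :: "'k::field^'n^'n"
  shows "mixed_action a (mixed_pure vs ws) =
     (\<Sum>s<length vs. mixed_pure (vs[s := a *v (vs ! s)]) ws)
     + (\<Sum>s<length ws. mixed_pure vs (ws[s := - ((ws ! s) v* a)]))"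
proof (rule ext, clarify)
  fix I J :: "'n list"
  have sum_app: "(\<Sum>x\<in>S. f x) z = (\<Sum>x\<in>S. f x z)"
    for f :: "nat \<Rightarrow> ('k, 'n) tensor_array" and S z
    by (induction S rule: infinite_finite_induct) auto
  show "mixed_action a (mixed_pure vs ws) (I, J) =
     ((\<Sum>s<length vs. mixed_pure (vs[s := a *v (vs ! s)]) ws)
      + (\<Sum>s<length ws. mixed_pure vs (ws[s := - ((ws ! s) v* a)]))) (I, J)"
    by (cases "length I = length vs \<and> length J = length ws")
      (auto simp: mixed_action_def mixed_pure_def sum_app prod_upd matrix_vector_mult_def
        vector_matrix_mult_def sum_distrib_left sum_distrib_right sum_negf mult_ac)
qed

text \<open>The finite direct sum of the \<open>mixed_tensors p q\<close> with \<open>(p, q)\<close> running through a list.\<close>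

definition mixed_tensor_sum ::
    "(nat \<times> nat) list \<Rightarrow> (nat \<Rightarrow> ('k::field, 'n::finite) tensor_array) set" where
  "mixed_tensor_sum pqs = {T.
     (\<forall>i<length pqs. T i \<in> mixed_tensors (fst (pqs ! i)) (snd (pqs ! i))) \<and>
     (\<forall>i\<ge>length pqs. T i = 0)}"

definition mixed_sum_action ::
    "'k::field^'n^'n \<Rightarrow> (nat \<Rightarrow> ('k, 'n) tensor_array) \<Rightarrow> nat \<Rightarrow> ('k, 'n) tensor_array" where
  "mixed_sum_action a T = (\<lambda>i. mixed_action a (T i))"

definition tensor_module ::
    "('k::field \<Rightarrow> 'm::ab_group_add \<Rightarrow> 'm) \<Rightarrow> ('k^'n^'n \<Rightarrow> 'm \<Rightarrow> 'm) \<Rightarrow> bool" where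
  "tensor_module sM act \<longleftrightarrow>
     (\<exists>Basis. finite_dimensional_vector_space sM Basis) \<and>
     (\<exists>pqs W f.
        W \<subseteq> mixed_tensor_sum pqs \<and>
        module.subspace (pw_scale (pw_scale (*))) W \<and>
        (\<forall>a. \<forall>T\<in>W. mixed_sum_action a T \<in> W) \<and>
        linear_iso_on sM UNIV (pw_scale (pw_scale (*))) W f \<and>
        (\<forall>a m. f (act a m) = mixed_sum_action a (f m)))"

end

theory Submission
  imports Defs "HOL-Computational_Algebra.Polynomial"
begin

text \<open>Currying the first argument turns \<open>C\<^sup>k\<^sup>+\<^sup>1\<^sub>r\<^sub>s\<^sub>y\<^sub>m(A, M)\<close> into the Chevalley--Eilenberg cochains of \<open>gl\<^sub>n\<close>
  of degree \<open>k\<close> with values in \<open>V = Hom(A, M)\<close>, on which \<open>gl\<^sub>n\<close> acts from the right by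
  \<open>(f \<cdot> b)(a) = a \<circ> f(b) - f(a \<circ> b) + f(a) \<circ> b\<close>; the invariants of \<open>V\<close> are \<open>Z\<^sup>1\<^sub>r\<^sub>s\<^sub>y\<^sub>m(A, M)\<close>.
  On cocycles the identity matrix and the quadratic Casimir element \<open>\<Omega> = \<Sum> E\<^sub>i\<^sub>j E\<^sub>j\<^sub>i\<close> act by
  coboundaries, so it suffices to write \<open>id = \<pi> + 1 \<cdot> \<alpha> + \<Omega> \<cdot> \<beta>\<close> with equivariant \<open>\<pi>, \<alpha>, \<beta>\<close> and \<open>\<pi>\<close> a
  projection onto the invariants. By Fitting's lemma this needs two facts. First, the identity
  matrix acts on \<open>V\<close> without nilpotent part; this is where the tensor module hypothesis enters,
  through the diagonalisability of the identity matrix on \<open>M\<close>. Secondly, \<open>gl\<^sub>n\<close> acts by zero on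
  the space where \<open>1\<close> and \<open>\<Omega>\<^sup>2\<close> vanish: a highest weight vector of weight \<open>\<lambda>\<close> there satisfies
  \<open>\<Sum> \<lambda>\<^sub>i\<^sup>2 + \<Sum>\<^sub>i\<^sub><\<^sub>j (\<lambda>\<^sub>i - \<lambda>\<^sub>j) = 0\<close> with all \<open>\<lambda>\<^sub>i - \<lambda>\<^sub>j \<ge> 0\<close> for \<open>i < j\<close>, whence \<open>\<lambda> = 0\<close>.\<close>

text \<open>Complete reducibility of V cannot be taken for granted: gl_n has a centre, and the right
  action enters V on its own, whereas the hypothesis only concerns a o m - m o a. Polynomials in the
  two commuting operators 1 and \<Omega> take its place. Since these operators commute with gl_n, so
  do \<alpha> and \<beta>; equivariance is what makes \<alpha> o F and \<beta> o F cocycles again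
  whenever F is one, and the homotopies are applied to those. The field is not assumed algebraically
  closed, so eigenvectors have to be produced. For the differences E_ii - E_jj they exist because
  each lies in an sl_2, whose theory makes their eigenvalues integers; integers also supply the
  order on which the positivity argument rests. A single E_ii is under control only where 1
  vanishes, since there n E_ii is the sum of the E_ii - E_jj. \<Omega> appears squared because
  Fitting's lemma asks that \<Omega>^2 v = 0 imply \<Omega> v = 0 on the kernel of 1.\<close>

lemma linearI_vs:
  assumes "vector_space s" "vector_space t" "\<And>x y. f (x + y) = f x + f y" "\<And>c x. f (s c x) = t c (f x)"
  shows "Vector_Spaces.linear s t f"
  using assms
  by (simp add: Vector_Spaces.linear_def module_hom_def module_hom_axioms_def
        vector_space_def module_def)

lemma linearD:
  assumes "Vector_Spaces.linear s t f"
  shows "f (x + y) = f x + f y" "f (s c x) = t c (f x)" "f 0 = 0" "f (- x) = - f x"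
    "f (x - y) = f x - f y" "f (sum g A) = (\<Sum>i\<in>A. f (g i))"
proof -
  interpret module_hom s t f
    using assms by (simp add: Vector_Spaces.linear_def)
  show "f (x + y) = f x + f y" "f (s c x) = t c (f x)" "f 0 = 0" "f (- x) = - f x"
    "f (x - y) = f x - f y" "f (sum g A) = (\<Sum>i\<in>A. f (g i))"
    by (simp_all add: add scale zero neg diff sum)
qed

lemma sum_fun_app: "(\<Sum>i\<in>A. f i) x = (\<Sum>i\<in>A. f i x)"
  for f :: "'i \<Rightarrow> 'x \<Rightarrow> 'y::comm_monoid_add"
  by (induct A rule: infinite_finite_induct) auto

section \<open>Polynomials in an operator\<close>

text \<open>Horner form of p(T) v, so that \<open>pe_pCons\<close> is the recursion behind the
  inductions on p.\<close>

definition op_poly :: "('k::field \<Rightarrow> 'v \<Rightarrow> 'v::ab_group_add) \<Rightarrow> ('v \<Rightarrow> 'v) \<Rightarrow> 'k poly \<Rightarrow> 'v \<Rightarrow> 'v" where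
  "op_poly s T p v = fold_coeffs (\<lambda>a w. s a v + T w) p 0"

locale operator = vector_space s for s :: "'k::field \<Rightarrow> 'v::ab_group_add \<Rightarrow> 'v" +
  fixes T :: "'v \<Rightarrow> 'v"
  assumes lin: "Vector_Spaces.linear s s T"
begin

lemmas T_simps = linearD[OF lin]

abbreviation pe where "pe \<equiv> op_poly s T"

lemma pe_0 [simp]: "pe 0 v = 0"
  by (simp add: op_poly_def)

lemma pe_pCons [simp]: "pe (pCons a p) v = s a v + T (pe p v)"
  by (cases "a = 0 \<and> p = 0") (auto simp: op_poly_def T_simps)

lemma pe_add: "pe (p + q) v = pe p v + pe q v"
proof (induct p q rule: poly_induct2)
  case (pCons a p b q)
  then show ?case by (simp add: T_simps scale_left_distrib)
qed simp

lemma pe_smult: "pe (smult c p) v = s c (pe p v)"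
  by (induct p) (simp_all add: T_simps scale_right_distrib)

lemma pe_sum: "pe (\<Sum>i\<in>A. p i) v = (\<Sum>i\<in>A. pe (p i) v)"
  by (induct A rule: infinite_finite_induct) (simp_all add: pe_add)

lemma pe_monom: "pe (monom c i) v = s c ((T ^^ i) v)"
  by (induct i) (simp_all add: monom_0 monom_Suc T_simps)

lemma pe_linear: "Vector_Spaces.linear s s (pe p)"
proof (rule linearI_vs)
  show "pe p (x + y) = pe p x + pe p y" for x y
    by (induct p) (simp_all add: T_simps scale_right_distrib algebra_simps)
  show "pe p (s c x) = s c (pe p x)" for c x
    by (induct p) (simp_all add: T_simps scale_right_distrib mult.commute)
qed (rule vector_space_axioms)+

lemma pe_commute:
  assumes "Vector_Spaces.linear s s Y" "\<And>v. T (Y v) = Y (T v)"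
  shows "pe p (Y v) = Y (pe p v)"
  by (induct p) (simp_all add: linearD[OF assms(1)] assms(2))

lemma pe_T: "pe p (T v) = T (pe p v)"
  by (rule pe_commute) (auto intro: lin)

lemma pe_mult: "pe (p * q) v = pe p (pe q v)"
  by (induct p) (simp_all add: pe_add pe_smult)

lemma pe_eigen:
  assumes "T v = s c v"
  shows "pe p v = s (poly p c) v"
  by (induct p) (simp_all add: T_simps assms scale_left_distrib mult.commute)

lemma pe_closed:
  assumes "subspace S" "\<And>v. v \<in> S \<Longrightarrow> T v \<in> S" "v \<in> S"
  shows "pe p v \<in> S"
  by (induct p) (use assms in \<open>auto simp: subspace_0 intro!: subspace_add subspace_scale\<close>)

end

locale fd_operator = finite_dimensional_vector_space s Basis + operator s T
  for s :: "'k::field \<Rightarrow> 'v::ab_group_add \<Rightarrow> 'v" and Basis T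
begin

lemma annihilator_at: "\<exists>p. p \<noteq> 0 \<and> pe p v = 0"
proof (cases "inj_on (\<lambda>i. (T ^^ i) v) {..dimension}")
  \<comment> \<open>Dependence of the set of iterates only helps if it has dimension + 1 elements.
    If two iterates coincide, the difference of the two powers of x is the annihilator.\<close>
  case False
  then obtain i j where "i \<noteq> j" "(T ^^ i) v = (T ^^ j) v"
    by (auto simp: inj_on_def)
  then have "pe (monom 1 i + monom (-1) j) v = 0" "monom 1 i + monom (-1) j \<noteq> (0 :: 'k poly)"
    by (simp_all add: pe_add pe_monom)
      (metis add.inverse_inverse add_eq_0_iff coeff_monom minus_monom one_neq_zero)
  then show ?thesis by blast
next
  case True
  let ?A = "(\<lambda>i. (T ^^ i) v) ` {..dimension}"
  have "card ?A = Suc dimension" using True by (simp add: card_image)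
  moreover have "dim ?A \<le> dimension" by (rule dim_subset_UNIV)
  ultimately have "dependent ?A"
    using independent_bound_general[of ?A] by linarith
  then obtain u where u: "\<exists>w\<in>?A. u w \<noteq> 0" "(\<Sum>w\<in>?A. s (u w) w) = 0"
    by (auto simp: dependent_finite)
  let ?p = "\<Sum>i\<le>dimension. monom (u ((T ^^ i) v)) i"
  have "pe ?p v = 0"
    using u(2) by (simp add: pe_sum pe_monom sum.reindex[OF True])
  moreover from u(1) obtain i where i: "i \<le> dimension" "u ((T ^^ i) v) \<noteq> 0" by auto
  then have "coeff ?p i \<noteq> 0" by (simp add: coeff_sum)
  ultimately show ?thesis by (metis coeff_0)
qed

lemma annihilator: "\<exists>p. p \<noteq> 0 \<and> (\<forall>v. pe p v = 0)"
proof -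
  obtain q where q: "\<And>v. q v \<noteq> 0" "\<And>v. pe (q v) v = 0"
    using annihilator_at by metis
  let ?p = "\<Prod>b\<in>Basis. q b"
  have "pe ?p b = 0" if "b \<in> Basis" for b
  proof -
    have "?p = (\<Prod>b\<in>Basis - {b}. q b) * q b"
      using that finite_Basis by (simp add: prod.remove mult.commute)
    then show ?thesis by (simp add: pe_mult q linearD[OF pe_linear])
  qed
  then have "pe ?p v = 0" if "v \<in> span Basis" for v
    using module_hom.eq_0_on_span[of s s "pe ?p" Basis v] that pe_linear
    by (simp add: Vector_Spaces.linear_def)
  then have "pe ?p v = 0" for v by (simp add: span_Basis)
  moreover have "?p \<noteq> 0" using finite_Basis q by simp
  ultimately show ?thesis by blast
qed

lemma finite_eigenvalues: "finite {c. \<exists>v. v \<noteq> 0 \<and> T v = s c v}"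
proof -
  obtain p where p: "p \<noteq> 0" "\<And>v. pe p v = 0" using annihilator by blast
  have "{c. \<exists>v. v \<noteq> 0 \<and> T v = s c v} \<subseteq> {c. poly p c = 0}"
    using pe_eigen[of _ _ p] p(2) by (auto simp: scale_eq_0_iff)
  then show ?thesis using poly_roots_finite[OF p(1)] finite_subset by blast
qed

text \<open>Write an annihilating polynomial as x^n q with q(0) \<noteq> 0. Then q(T) v is killed by
  T^n, hence by T, and q = a + x g with a \<noteq> 0 exhibits q(T) v as a multiple of v minus an
  element T(...). The correction is a polynomial in T, so whatever commutes with T commutes with
  it.\<close>

lemma fitting:
  assumes S: "subspace S" "\<And>v. v \<in> S \<Longrightarrow> T v \<in> S" and ker: "\<And>v. v \<in> S \<Longrightarrow> T (T v) = 0 \<Longrightarrow> T v = 0"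
  obtains g where "\<And>v. v \<in> S \<Longrightarrow> T (v - T (pe g v)) = 0"
proof -
  obtain p where p: "p \<noteq> 0" "\<And>v. pe p v = 0" using annihilator by blast
  obtain n q where q: "p = [:0, 1:] ^ n * q" "poly q 0 \<noteq> 0"
    using order_decomp[OF p(1), of 0] by (metis diff_zero dvd_def poly_eq_0_iff_dvd minus_zero)
  have pow: "pe ([:0, 1:] ^ n) v = (T ^^ n) v" for v n
    by (induct n) (simp_all add: one_pCons pe_mult T_simps)
  have T0: "T w = 0" if "(T ^^ n) w = 0" "w \<in> S" for w n
    using that
  proof (induct n arbitrary: w)
    case 0
    then show ?case by (simp add: T_simps)
  next
    case (Suc n)
    then have "T (T w) = 0" using S(2) by (metis funpow_Suc_right o_apply)
    then show ?case using ker Suc by blast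
  qed
  obtain a g where ag: "q = pCons a g" by (cases q)
  with q(2) have a: "a \<noteq> 0" by simp
  have "T (v - T (pe (smult (- 1 / a) g) v)) = 0" if v: "v \<in> S" for v
  proof -
    have "T (pe q v) = 0"
      using p(2)[of v] pe_closed[OF S v] by (intro T0[of n]) (auto simp: q(1) pe_mult pow)
    moreover have "pe q v = s a (v - T (pe (smult (- 1 / a) g) v))"
      using a unfolding pe_smult by (simp add: ag T_simps scale_right_distrib)
    ultimately show ?thesis using a by (simp add: T_simps scale_eq_0_iff)
  qed
  then show ?thesis using that by blast
qed

end

section \<open>Finite-dimensional modules over \<open>sl\<^sub>2\<close> and \<open>gl\<^sub>n\<close>\<close>

locale sl2_triple = finite_dimensional_vector_space s Basis
  for s :: "'k::field_char_0 \<Rightarrow> 'v::ab_group_add \<Rightarrow> 'v" and Basis +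
  fixes E F H :: "'v \<Rightarrow> 'v"
  assumes linE: "Vector_Spaces.linear s s E" and linF: "Vector_Spaces.linear s s F"
    and linH: "Vector_Spaces.linear s s H"
    and HE: "H (E v) = E (H v) + s 2 (E v)"
    and HF: "H (F v) = F (H v) - s 2 (F v)"
    and EF: "E (F v) = F (E v) + H v"
begin

lemmas E_simps = linearD[OF linE]
lemmas F_simps = linearD[OF linF]
lemmas H_simps = linearD[OF linH]

sublocale opE: fd_operator s Basis E by unfold_locales (simp_all add: E_simps)
sublocale opH: fd_operator s Basis H by unfold_locales (simp_all add: H_simps)

text \<open>The Weyl reflection of the triple; it transfers nilpotency from \<open>E\<close> to
  \<open>F\<close>.\<close>

lemma flip: "sl2_triple s Basis F E (\<lambda>v. - H v)"
  by unfold_locales (simp_all add: E_simps F_simps H_simps HE HF EF)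

text \<open>\<open>ad H\<close> acts on polynomials in \<open>E\<close> as \<open>2 x d/dx\<close>, so a polynomial of least degree
  annihilating \<open>E\<close> is a monomial.\<close>

lemma HE_poly: "H (opE.pe p v) = opE.pe p (H v) + s 2 (E (opE.pe (pderiv p) v))"
  by (induct p)
    (simp_all add: H_simps E_simps HE pderiv_pCons opE.pe_add scale_right_distrib algebra_simps)

lemma E_nilpotent: "\<exists>n. \<forall>v. (E ^^ n) v = 0"
proof -
  let ?P = "\<lambda>p. p \<noteq> 0 \<and> (\<forall>v. opE.pe p v = 0)"
  obtain p where p: "?P p" "\<And>q. ?P q \<Longrightarrow> degree p \<le> degree q"
    using opE.annihilator ex_has_least_nat[of ?P _ degree] by metis
  \<comment> \<open>This is x p' - (deg p) p: the coefficient of x^i is multiplied by i - deg p, so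
    the leading term disappears and minimality forces \<open>?q\<close> = 0.\<close>
  let ?q = "pCons 0 (pderiv p) - smult (of_nat (degree p)) p"
  have "opE.pe ?q v = 0" for v
  proof -
    have "s 2 (E (opE.pe (pderiv p) v)) = 0"
      using HE_poly[of p v] p(1) by (simp add: H_simps)
    then show ?thesis
      using p(1) by (simp add: diff_conv_add_uminus opE.pe_add opE.pe_smult
          flip: smult_minus_left)
  qed
  moreover have "coeff ?q i = (of_nat i - of_nat (degree p)) * coeff p i" for i
    by (cases i) (simp_all add: coeff_pderiv algebra_simps)
  note cf = this
  have "degree ?q < degree p" if "?q \<noteq> 0"
  proof -
    have "coeff ?q i = 0" if "i \<ge> degree p" for i
      using that cf[of i] coeff_eq_0[of p i] by (cases "i = degree p") auto
    then show ?thesis using that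
      by (metis leading_coeff_0_iff not_le)
  qed
  ultimately have "?q = 0" using p(2)[of ?q] by (metis not_le)
  then have "coeff p i = 0" if "i \<noteq> degree p" for i
    using cf[of i] that by simp
  then have "p = monom (lead_coeff p) (degree p)"
    by (intro poly_eqI) (simp add: coeff_monom)
  moreover have "lead_coeff p \<noteq> 0" using p(1) by simp
  ultimately have "(E ^^ degree p) v = 0" for v
    using p(1) opE.pe_monom[of "lead_coeff p" "degree p" v] by auto
  then show ?thesis by blast
qed

text \<open>For an eigenvector of \<open>H\<close> this is the textbook formula. Leaving
  \<open>H v\<close> unevaluated makes it apply to all of ker E, where \<open>H\<close> is not yet
  known to have eigenvectors.\<close>

lemma EF_power:
  assumes "E v = 0"
  shows "E ((F ^^ Suc n) v) = s (of_nat (Suc n)) ((F ^^ n) (H v - s (of_nat n) v))"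
proof -
  have linFn: "Vector_Spaces.linear s s (F ^^ n)" for n
    by (induct n) (auto intro!: linearI_vs vector_space_axioms simp: F_simps linearD)
  have HFn: "H ((F ^^ n) v) = (F ^^ n) (H v) - s (2 * of_nat n) ((F ^^ n) v)" for n
  proof (induct n)
    case (Suc n)
    show ?case
      by (simp add: HF Suc F_simps scale_left_distrib distrib_left)
  qed simp
  show ?thesis
  proof (induct n)
    case 0
    then show ?case using assms by (simp add: EF F_simps)
  next
    case (Suc n)
    have 2: "s 2 x = x + x" for x
      using scale_left_distrib[of 1 1 x] by simp
    have "E ((F ^^ Suc (Suc n)) v) = F (E ((F ^^ Suc n) v)) + H ((F ^^ Suc n) v)"
      by (simp add: EF)
    then show ?case unfolding Suc HFn
      by (simp add: F_simps linearD[OF linFn] 2 algebra_simps scale_left_distrib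
        scale_right_diff_distrib scale_left_diff_distrib)
  qed
qed

lemma ker_E_H: "E v = 0 \<Longrightarrow> E (H v) = 0"
  using HE[of v] by (simp add: H_simps)

text \<open>Let F^m v be the last nonzero term of the F-string. Applying \<open>E\<close> to F^(m+1)
  v = 0 leaves (m + 1) (c - m) F^m v = 0, so c = m.\<close>

lemma highest_weight_nat:
  assumes "E v = 0" "H v = s c v" "v \<noteq> 0"
  shows "c \<in> \<nat>"
proof -
  interpret flip: sl2_triple s Basis F E "\<lambda>v. - H v" by (rule flip)
  let ?P = "\<lambda>n. (F ^^ n) v = 0"
  have ex: "\<exists>n. ?P n" using flip.E_nilpotent by blast
  let ?n = "LEAST n. ?P n"
  have n: "?P ?n" using ex by (rule LeastI_ex)
  with assms obtain m where m: "?n = Suc m" by (cases ?n) auto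
  have "(F ^^ m) v \<noteq> 0" using m not_less_Least[of m ?P] by simp
  moreover have "s (of_nat (Suc m)) ((F ^^ m) (s (c - of_nat m) v)) = 0"
    using EF_power[OF assms(1), of m] n assms(2) unfolding m
    by (simp add: E_simps scale_left_diff_distrib)
  moreover have "(F ^^ m) (s x v) = s x ((F ^^ m) v)" for x m
    by (induct m) (simp_all add: F_simps)
  ultimately have "c - of_nat m = 0"
    by (simp del: of_nat_Suc)
  then show ?thesis by simp
qed

text \<open>Repetitions in the list are allowed. That such a product kills every given vector
  replaces algebraic closure: the eigenvalues of \<open>H\<close> are integers over any field of
  characteristic 0.\<close>

definition int_poly :: "int list \<Rightarrow> 'k poly" where
  "int_poly ks = prod_list (map (\<lambda>k. [:- of_int k, 1:]) ks)"

text \<open>By \<open>EF_power\<close>, if F^(n+1) v = 0 then (H - n) v is again in ker E and is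
  killed by F^n, so each factor x - n shortens the F-string by one.\<close>

lemma ker_E_int_poly:
  assumes "E v = 0"
  shows "\<exists>ks. opH.pe (int_poly ks) v = 0"
proof -
  interpret flip: sl2_triple s Basis F E "\<lambda>v. - H v" by (rule flip)
  obtain n where "\<And>v. (F ^^ n) v = 0" using flip.E_nilpotent by blast
  then have "(F ^^ n) v = 0" by blast
  then show ?thesis using assms
  proof (induct n arbitrary: v)
    case 0
    then show ?case by (auto simp: opH.pe_mult intro: exI[of _ "[]"] simp: linearD[OF opH.pe_linear])
  next
    case (Suc n)
    let ?w = "H v - s (of_nat n) v"
    have "(F ^^ n) ?w = 0"
      using EF_power[OF Suc(3), of n] Suc(2) by (simp add: E_simps del: of_nat_Suc)
    moreover have "E ?w = 0" using Suc(3) ker_E_H by (simp add: E_simps)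
    ultimately obtain ks where ks: "opH.pe (int_poly ks) ?w = 0" using Suc(1) by blast
    have "?w = opH.pe [:- of_int (int n), 1:] v" by (simp add: H_simps)
    then have "opH.pe (int_poly (ks @ [int n])) v = 0"
      using ks by (simp only: int_poly_def map_append prod_list.append opH.pe_mult) simp
    then show ?case by blast
  qed
qed

text \<open>\<open>H E = E (H + 2)\<close> lets a polynomial in \<open>H\<close> pass
  \<open>E\<close> at the price of lowering its roots by 2.\<close>

lemma pe_int_poly_E:
  "opH.pe (int_poly ks) (E v) = E (opH.pe (int_poly (map (\<lambda>k. k - 2) ks)) v)"
proof (induct ks arbitrary: v)
  case Nil
  then show ?case by (simp add: int_poly_def one_pCons H_simps E_simps)
next
  case (Cons k ks)
  have "opH.pe [:- of_int k, 1:] (E v) = E (opH.pe [:- of_int (k - 2), 1:] v)" for v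
    by (simp add: HE H_simps E_simps scale_left_diff_distrib algebra_simps)
  with Cons show ?case
    by (simp only: int_poly_def list.map prod_list.Cons opH.pe_mult)
qed

text \<open>Induction on the power of \<open>E\<close> that kills v: the polynomial found for E v,
  with shifted roots, takes v into ker E, where \<open>ker_E_int_poly\<close> applies.\<close>

lemma int_poly_annihilates: "\<exists>ks. opH.pe (int_poly ks) v = 0"
proof -
  obtain n where "\<And>v. (E ^^ n) v = 0" using E_nilpotent by blast
  then have "(E ^^ n) v = 0" by blast
  then show ?thesis
  proof (induct n arbitrary: v)
    case 0
    then show ?case by (auto intro: exI[of _ "[]"] simp: linearD[OF opH.pe_linear])
  next
    case (Suc n)
    then have "(E ^^ n) (E v) = 0" by (metis funpow_Suc_right o_apply)
    then obtain ks where ks: "opH.pe (int_poly ks) (E v) = 0" using Suc(1) by blast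
    let ?w = "opH.pe (int_poly (map (\<lambda>k. k - 2) ks)) v"
    have "E ?w = 0" using ks by (simp add: pe_int_poly_E)
    then obtain ks' where "opH.pe (int_poly ks') ?w = 0" using ker_E_int_poly by blast
    then have "opH.pe (int_poly (ks' @ map (\<lambda>k. k - 2) ks)) v = 0"
      by (simp only: int_poly_def map_append prod_list.append opH.pe_mult)
    then show ?case by blast
  qed
qed

text \<open>Apply the factors of an annihilating product one at a time; the last nonzero vector is
  an eigenvector. The stable subspace S is a parameter so that joint eigenspaces can be cut out one
  operator after another.\<close>

lemma int_eigenvector:
  assumes "v \<noteq> 0" "v \<in> S" "subspace S" "\<And>v. v \<in> S \<Longrightarrow> H v \<in> S"
  shows "\<exists>w k. w \<in> S \<and> w \<noteq> 0 \<and> H w = s (of_int k) w"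
proof -
  obtain ks where "opH.pe (int_poly ks) v = 0" using int_poly_annihilates by blast
  then show ?thesis using assms(1,2)
  proof (induct ks arbitrary: v rule: rev_induct)
    case Nil
    then show ?case by (simp add: int_poly_def one_pCons H_simps)
  next
    case (snoc k ks)
    let ?w = "opH.pe [:- of_int k, 1:] v"
    show ?case
    proof (cases "?w = 0")
      case True
      then have "H v = s (of_int k) v" by (simp add: H_simps)
      with snoc show ?thesis by blast
    next
      case False
      moreover have "?w \<in> S" by (intro opH.pe_closed assms snoc)
      moreover have "opH.pe (int_poly ks) ?w = 0"
        using snoc(2) by (simp only: int_poly_def map_append prod_list.append opH.pe_mult) simp
      ultimately show ?thesis using snoc(1) by blast
    qed
  qed
qed

text \<open>If \<open>0\<close> is the only eigenvalue of \<open>H\<close> on \<open>S\<close>, then \<open>ker H\<^sup>2 = ker H\<close> because \<open>E\<close> and \<open>F\<close> map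
  \<open>ker H\<^sup>2\<close> into the generalised eigenspaces for \<open>\<plusminus>2\<close>.\<close>

lemma trivial_if_zero_weights:
  assumes S: "subspace S" "\<And>v. v \<in> S \<Longrightarrow> E v \<in> S" "\<And>v. v \<in> S \<Longrightarrow> F v \<in> S" "\<And>v. v \<in> S \<Longrightarrow> H v \<in> S"
    and zero: "\<And>v k. v \<in> S \<Longrightarrow> v \<noteq> 0 \<Longrightarrow> H v = s (of_int k) v \<Longrightarrow> k = 0"
    and v: "v \<in> S"
  shows "E v = 0" "H v = 0"
proof -
  have inj: "w = 0" if "w \<in> S" "H w = s (of_int k) w" "k \<noteq> 0" for w k
    using zero that by blast
  have ker2: "E w = 0 \<and> F w = 0" if w: "w \<in> S" "H (H w) = 0" for w
  proof -
    have 2: "s 2 x = x + x" for x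
      using scale_left_distrib[of 1 1 x] by simp
    let ?u = "H (E w) - s 2 (E w)"
    have "H ?u = s (of_int 2) ?u"
      using w by (simp add: HE H_simps E_simps 2)
    then have "?u = 0"
      using w S by (intro inj[of _ 2] subspace_diff subspace_scale) auto
    then have "H (E w) = s (of_int 2) (E w)" by simp
    then have "E w = 0" using w S by (intro inj[of _ 2]) auto
    let ?u = "H (F w) + s 2 (F w)"
    have "H ?u = s (of_int (- 2)) ?u"
      using w by (simp add: HF H_simps F_simps 2)
    then have "?u = 0"
      using w S by (intro inj[of _ "- 2"] subspace_add subspace_scale) auto
    then have "H (F w) = s (of_int (- 2)) (F w)" by (simp add: eq_neg_iff_add_eq_0)
    then have "F w = 0" using w S by (intro inj[of _ "- 2"]) auto
    with \<open>E w = 0\<close> show ?thesis by blast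
  qed
  have ker: "H w = 0" if "w \<in> S" "H (H w) = 0" for w
    using ker2[OF that] EF[of w] by (simp add: E_simps F_simps)
  obtain ks where "opH.pe (int_poly ks) v = 0" using int_poly_annihilates by blast
  then have "H v = 0" using v
  proof (induct ks arbitrary: v)
    case Nil
    then show ?case by (simp add: int_poly_def one_pCons H_simps)
  next
    case (Cons k ks)
    let ?w = "opH.pe (int_poly ks) v"
    have w: "?w \<in> S" by (intro opH.pe_closed S Cons)
    have "opH.pe [:- of_int k, 1:] ?w = 0"
      using Cons(2) by (simp only: int_poly_def list.map prod_list.Cons opH.pe_mult)
    then have Hw: "H ?w = s (of_int k) ?w" by (simp add: H_simps)
    \<comment> \<open>For k \<noteq> 0 the vector \<open>?w\<close> would be an eigenvector of a
      forbidden weight, so it vanishes and the shorter list already kills v. For k = 0 the shorter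
      list kills \<open>H v\<close>, and ker H^2 = ker H finishes.\<close>
    show ?case
    proof (cases "k = 0")
      case False
      then show ?thesis using inj[OF w Hw] Cons(1,3) by blast
    next
      case True
      then have "opH.pe (int_poly ks) (H v) = 0" using Hw by (simp add: opH.pe_T)
      then have "H (H v) = 0" using Cons(1,3) S by blast
      then show ?thesis using ker Cons(3) by blast
    qed
  qed
  then show "H v = 0" .
  then show "E v = 0" using ker2[OF v] by (simp add: H_simps)
qed

end

section \<open>Weights and the Casimir operator of gl_n\<close>

locale gl_ops = finite_dimensional_vector_space s Basis
  for s :: "'k::field_char_0 \<Rightarrow> 'v::ab_group_add \<Rightarrow> 'v" and Basis +
  fixes X :: "'n::finite \<Rightarrow> 'n \<Rightarrow> 'v \<Rightarrow> 'v"
  assumes linX: "Vector_Spaces.linear s s (X i j)"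
    and comm: "X i j (X k l v) =
      X k l (X i j v) + (if j = k then X i l v else 0) - (if l = i then X k j v else 0)"
begin

lemmas X_simps = linearD[OF linX]

definition H :: "'n \<Rightarrow> 'n \<Rightarrow> 'v \<Rightarrow> 'v" where
  "H i j v = X i i v - X j j v"

definition central :: "'v \<Rightarrow> 'v" where
  "central v = (\<Sum>i\<in>UNIV. X i i v)"

definition casimir :: "'v \<Rightarrow> 'v" where
  "casimir v = (\<Sum>i\<in>UNIV. \<Sum>j\<in>UNIV. X i j (X j i v))"

lemma lin_H: "Vector_Spaces.linear s s (H i j)"
  by (intro linearI_vs vector_space_axioms)
    (simp_all add: H_def X_simps scale_right_diff_distrib)

lemma lin_central: "Vector_Spaces.linear s s central"
  by (intro linearI_vs vector_space_axioms)
    (simp_all add: central_def X_simps sum.distrib scale_sum_right)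

lemma lin_casimir: "Vector_Spaces.linear s s casimir"
  by (intro linearI_vs vector_space_axioms)
    (simp_all add: casimir_def X_simps sum.distrib scale_sum_right)

lemmas H_simps = linearD[OF lin_H]

lemma double_sum_nonneg_eq_0:
  fixes c :: "'n \<Rightarrow> 'n \<Rightarrow> int"
  assumes "\<And>i j. 0 \<le> c i j" "(\<Sum>i\<in>UNIV. \<Sum>j\<in>UNIV. c i j) = 0"
  shows "c i j = 0"
proof -
  have "\<forall>i\<in>UNIV. (\<Sum>j\<in>UNIV. c i j) = 0"
    using assms by (subst (asm) sum_nonneg_eq_0_iff) (auto simp: sum_nonneg)
  then show ?thesis
    using assms(1) by (simp add: sum_nonneg_eq_0_iff)
qed

lemma sum_if: "(\<Sum>j\<in>UNIV. if P then f j else 0) = (if P then \<Sum>j\<in>UNIV. f j else (0 :: 'v))"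
  for P and f :: "'n \<Rightarrow> 'v"
  by simp

lemma central_X: "central (X k l v) = X k l (central v)"
proof -
  have "central (X k l v) = (\<Sum>i\<in>UNIV. X k l (X i i v)
      + (if i = k then X i l v else 0) - (if l = i then X k i v else 0))"
    unfolding central_def by (subst comm) simp
  then show ?thesis
    by (simp add: central_def X_simps sum.distrib sum_subtractf)
qed

lemma casimir_X: "casimir (X k l v) = X k l (casimir v)"
proof -
  have "X i j (X j i (X k l v)) = X k l (X i j (X j i v))
      + ((if j = k then X i l (X j i v) else 0) - (if l = i then X k j (X j i v) else 0)
      + (if i = k then X i j (X j l v) else 0) - (if l = j then X i j (X k i v) else 0))" for i j
    by (subst (2) comm, simp only: X_simps, subst (1) comm) (simp add: X_simps)
  then have "casimir (X k l v) = X k l (casimir v) + ((\<Sum>i\<in>UNIV. X i l (X k i v))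
      - (\<Sum>j\<in>UNIV. X k j (X j l v)) + (\<Sum>j\<in>UNIV. X k j (X j l v)) - (\<Sum>i\<in>UNIV. X i l (X k i v)))"
    unfolding casimir_def
    by (simp add: X_simps sum.distrib sum_subtractf sum_if)
  then show ?thesis by simp
qed

lemma HX: "H i j (X a b v) = X a b (H i j v) +
    s (of_int ((if i = a then 1 else 0) - (if i = b then 1 else 0)
      - (if j = a then 1 else 0) + (if j = b then 1 else 0))) (X a b v)"
  unfolding H_def comm[of i i a b] comm[of j j a b]
  by (auto simp: X_simps scale_left_distrib scale_left_diff_distrib)

lemma sl2: "i \<noteq> j \<Longrightarrow> sl2_triple s Basis (X i j) (X j i) (H i j)"
proof (intro sl2_triple.intro sl2_triple_axioms.intro finite_dimensional_vector_space_axioms linX lin_H)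
  assume "i \<noteq> j"
  then show "H i j (X i j v) = X i j (H i j v) + s 2 (X i j v)"
    "H i j (X j i v) = X j i (H i j v) - s 2 (X j i v)" for v
    by (simp_all add: HX)
  show "X i j (X j i v) = X j i (X i j v) + H i j v" for v
    by (subst comm) (simp add: H_def)
qed

lemma H_comm: "H i j (H k l v) = H k l (H i j v)"
  by (simp add: H_def[of k l] H_simps HX X_simps)

text \<open>Only the differences \<open>H i j\<close> are recorded: they belong to sl_2-triples,
  which makes their eigenvalues integers. Nothing of the kind holds for a single
  \<open>X i i\<close>.\<close>

definition weight_vector :: "('n \<Rightarrow> 'n \<Rightarrow> int) \<Rightarrow> 'v \<Rightarrow> bool" where
  "weight_vector lam v \<longleftrightarrow> v \<noteq> 0 \<and> (\<forall>i j. H i j v = s (of_int (lam i j)) v)"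

text \<open>The \<open>H i j\<close> commute, so the joint eigenspace for finitely many pairs is
  stable under the next one, and \<open>int_eigenvector\<close> can be applied inside it.\<close>

lemma weight_vector_exists:
  assumes S: "subspace S" "\<And>v i j. v \<in> S \<Longrightarrow> H i j v \<in> S" and v: "v \<in> S" "v \<noteq> 0"
  obtains w lam where "w \<in> S" "weight_vector lam w"
proof -
  have "\<exists>w\<in>S. w \<noteq> 0 \<and> (\<exists>lam. \<forall>(i, j)\<in>A. H i j w = s (of_int (lam i j)) w)"
    if "finite A" for A :: "('n \<times> 'n) set"
    using that
  proof induct
    case empty
    then show ?case using v by auto
  next
    case (insert ij A)
    obtain i j where ij: "ij = (i, j)" by fastforce
    obtain w lam where w: "w \<in> S" "w \<noteq> 0" and lam: "\<forall>(i, j)\<in>A. H i j w = s (of_int (lam i j)) w"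
      using insert by blast
    let ?S = "{v \<in> S. \<forall>i j. (i, j) \<in> A \<longrightarrow> H i j v = s (of_int (lam i j)) v}"
    obtain u k where u: "u \<in> ?S" "u \<noteq> 0" "H i j u = s (of_int k) u"
    proof (cases "i = j")
      case True
      then have "H i j w = s (of_int 0) w" by (simp add: H_def)
      with w lam that show ?thesis by blast
    next
      case False
      interpret sl2_triple s Basis "X i j" "X j i" "H i j" using False by (rule sl2)
      have "subspace ?S"
        using S(1) by (auto simp: subspace_def linearD[OF lin_H] scale_right_distrib scale_left_commute)
      moreover have "H i j v \<in> ?S" if "v \<in> ?S" for v
        using that S(2) by (auto simp: H_comm[of _ _ i j] linearD[OF lin_H])
      ultimately show ?thesis using int_eigenvector[of w ?S] w lam that by blast
    qed
    let ?lam = "\<lambda>i' j'. if (i', j') \<in> A then lam i' j' else k"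
    have "\<forall>(i, j)\<in>insert ij A. H i j u = s (of_int (?lam i j)) u"
      using u ij insert(2) by auto
    then show ?case using u by (intro bexI[of _ u] conjI exI[of _ ?lam]) auto
  qed
  from this[of UNIV] obtain w lam where "w \<in> S" "w \<noteq> 0" "\<forall>i j. H i j w = s (of_int (lam i j)) w"
    by auto
  then show ?thesis using that unfolding weight_vector_def by blast
qed

definition W :: "'v set" where
  "W = {v. central v = 0 \<and> casimir (casimir v) = 0}"

lemma subspace_W: "subspace W"
  by (simp add: W_def subspace_def linearD[OF lin_central] linearD[OF lin_casimir])

lemma W_X: "v \<in> W \<Longrightarrow> X i j v \<in> W"
  by (simp add: W_def central_X casimir_X X_simps)

lemma W_H: "v \<in> W \<Longrightarrow> H i j v \<in> W"
  by (simp add: H_def subspace_diff subspace_W W_X)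

text \<open>The right side is n \<open>X i i v\<close> minus \<open>central v\<close>, and the
  latter vanishes on \<open>W\<close>. Keeping the factor n avoids denominators in the integral
  weights.\<close>

lemma W_diag: "v \<in> W \<Longrightarrow> s (of_nat CARD('n)) (X i i v) = (\<Sum>j\<in>UNIV. H i j v)"
  by (simp add: W_def H_def central_def sum_subtractf sum_constant_scale)

text \<open>For injective \<open>ix\<close>, the element \<open>grading ix\<close> of the Cartan subalgebra induces the order
  \<open>ix a < ix b\<close>: up to a central term it is \<open>- n \<Sum> ix i E\<^sub>i\<^sub>i\<close>, so \<open>E\<^sub>a\<^sub>b\<close> raises its eigenvalues
  if \<open>ix a < ix b\<close>. An eigenvector for the largest eigenvalue thus yields a highest weight vector.\<close>

definition grading :: "('n \<Rightarrow> int) \<Rightarrow> 'v \<Rightarrow> 'v" where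
  "grading ix v = (\<Sum>i\<in>UNIV. \<Sum>j\<in>UNIV. s (of_int (ix i)) (H j i v))"

lemma lin_grading: "Vector_Spaces.linear s s (grading ix)"
  by (intro linearI_vs vector_space_axioms)
    (simp_all add: grading_def H_simps sum.distrib scale_sum_right scale_right_distrib
      mult.commute)

lemma grading_X:
  "grading ix (X a b v) =
     X a b (grading ix v) + s (of_int (int CARD('n) * (ix b - ix a))) (X a b v)"
proof -
  let ?d = "\<lambda>i j. (if j = a then 1 else 0) - (if j = b then 1 else 0)
      - (if i = a then 1 else 0) + (if i = b then 1 else 0) :: int"
  have "grading ix (X a b v) = X a b (grading ix v) +
      (\<Sum>i\<in>UNIV. \<Sum>j\<in>UNIV. s (of_int (ix i) * of_int (?d i j)) (X a b v))"
    unfolding grading_def HX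
    by (simp add: scale_right_distrib X_simps sum.distrib del: of_int_add of_int_diff)
  also have "(\<Sum>i\<in>UNIV. \<Sum>j\<in>UNIV. s (of_int (ix i) * of_int (?d i j)) (X a b v)) =
      s (of_int (\<Sum>i\<in>UNIV. \<Sum>j\<in>UNIV. ix i * ?d i j)) (X a b v)"
    by (simp only: scale_sum_left of_int_sum of_int_mult)
  also have "(\<Sum>i\<in>UNIV. \<Sum>j\<in>UNIV. ix i * ?d i j) = int CARD('n) * (ix b - ix a)"
  proof -
    have 1: "(\<Sum>j\<in>UNIV. ix i * ?d i j) =
        int CARD('n) * (if i = b then ix i else 0) - int CARD('n) * (if i = a then ix i else 0)" for i
      unfolding sum_distrib_left[symmetric] by (simp add: sum.distrib sum_subtractf)
    show ?thesis unfolding 1 by (simp add: sum_subtractf algebra_simps flip: sum_distrib_left)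
  qed
  finally show ?thesis .
qed

lemma grading_H: "grading ix (H i j v) = H i j (grading ix v)"
  by (simp add: grading_def H_simps H_comm)

text \<open>Let p be the largest integral eigenvalue of the grading on \<open>W\<close> and w a
  weight vector for it. If ix a < ix b, then \<open>X a b\<close> would raise p, so it kills w and
  \<open>lam a b\<close> is a natural number. Now n^2 \<open>casimir\<close> acts on w by a sum
  \<open>?C\<close> of nonnegative integers, and casimir^2 w = 0 forces every term, hence p, to
  vanish.\<close>

lemma grading_eigenvalue_le_0:
  assumes ix: "inj ix" and v: "v \<in> W" "v \<noteq> 0" "grading ix v = s (of_int k) v"
  shows "k \<le> 0"
proof -
  interpret fd_operator s Basis "grading ix"
    by (intro fd_operator.intro operator.intro operator_axioms.intro lin_grading
      finite_dimensional_vector_space_axioms vector_space_axioms)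
  let ?K = "{k. \<exists>v\<in>W. v \<noteq> 0 \<and> grading ix v = s (of_int k) v}"
  have "of_int ` ?K \<subseteq> {c. \<exists>v. v \<noteq> 0 \<and> grading ix v = s c v}" by auto
  then have fin: "finite ?K"
    using finite_eigenvalues finite_subset finite_imageD[of of_int ?K]
    by (metis (no_types, lifting) injI of_int_eq_iff inj_on_subset subset_UNIV)
  define p where "p = Max ?K"
  have "k \<in> ?K" using v by blast
  then have "k \<le> p" and p: "p \<in> ?K" using fin Max_in[OF fin] by (auto simp: p_def)
  let ?S = "{v \<in> W. grading ix v = s (of_int p) v}"
  have "subspace ?S" using subspace_W
    by (auto simp: subspace_def linearD[OF lin_grading] scale_right_distrib scale_left_commute)
  moreover have "H i j v \<in> ?S" if "v \<in> ?S" for v i j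
    using that W_H by (simp add: grading_H H_simps)
  ultimately obtain w lam where w: "w \<in> ?S" and lam: "weight_vector lam w"
    using p weight_vector_exists[of ?S] by blast
  have w0: "w \<noteq> 0" and Hw: "H i j w = s (of_int (lam i j)) w" for i j
    using lam by (auto simp: weight_vector_def)
  have raise: "X a b w = 0" if "ix a < ix b" for a b
  proof (rule ccontr)
    assume "X a b w \<noteq> 0"
    moreover have "grading ix (X a b w) = s (of_int (p + int CARD('n) * (ix b - ix a))) (X a b w)"
      using w by (simp add: grading_X X_simps scale_left_distrib)
    ultimately have "p + int CARD('n) * (ix b - ix a) \<in> ?K" using w W_X by blast
    then have "p + int CARD('n) * (ix b - ix a) \<le> p" unfolding p_def by (rule Max_ge[OF fin])
    with that show False by (simp add: mult_le_0_iff)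
  qed
  have lam_ge: "lam a b \<ge> 0" if "ix a < ix b" for a b
  proof -
    interpret sl2_triple s Basis "X a b" "X b a" "H a b" using that by (intro sl2) auto
    have "(of_int (lam a b) :: 'k) \<in> \<nat>"
      using highest_weight_nat[OF raise[OF that] Hw w0] .
    then obtain m where "(of_int (lam a b) :: 'k) = of_nat m" by (auto elim: Nats_cases)
    then have "lam a b = int m" by (metis of_int_eq_iff of_int_of_nat_eq)
    then show ?thesis by simp
  qed
  let ?n = "of_nat CARD('n)"
  have Xii: "s ?n (X i i w) = s (of_int (\<Sum>j\<in>UNIV. lam i j)) w" for i
    using w by (simp add: W_diag Hw scale_sum_left)
  \<comment> \<open>The entries of n^2 \<open>casimir\<close> on w. For ix i < ix j, commuting
    leaves X_ij X_ji w = H_ij w because X_ij w = 0; in the opposite order already X_ji w = 0. The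
    factor n^2 makes the diagonal terms integral, by \<open>Xii\<close>.\<close>
  let ?c = "\<lambda>i j. if i = j then (\<Sum>j\<in>UNIV. lam i j)\<^sup>2
      else if ix i < ix j then (int CARD('n))\<^sup>2 * lam i j else 0"
  have "s (?n ^ 2) (X i j (X j i w)) = s (of_int (?c i j)) w" for i j
  proof (rule case_split[of "i = j"])
    assume 1: "i = j"
    have "s (?n ^ 2) (X i i (X i i w)) = s ?n (X i i (s ?n (X i i w)))"
      by (simp add: X_simps power2_eq_square)
    also have "\<dots> = s (of_int (\<Sum>j\<in>UNIV. lam i j)) (s ?n (X i i w))"
      by (subst Xii) (simp add: X_simps mult.commute)
    also have "\<dots> = s (of_int ((\<Sum>j\<in>UNIV. lam i j)\<^sup>2)) w"
      unfolding Xii by (simp add: power2_eq_square)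
    finally show ?thesis using 1 by simp
  next
    assume 2: "i \<noteq> j"
    then have "ix i \<noteq> ix j" using ix by (auto dest: injD)
    then consider "ix i < ix j" | "ix j < ix i" by linarith
    then show ?thesis
    proof cases
      case 1
      have "X i j (X j i w) = X j i (X i j w) + H i j w"
        by (subst comm) (simp add: H_def)
      then show ?thesis using 1 2 by (simp add: raise Hw X_simps)
    next
      case 2
      then show ?thesis using \<open>i \<noteq> j\<close> by (simp add: raise X_simps)
    qed
  qed
  then have "s (?n ^ 2) (casimir w) = (\<Sum>i\<in>UNIV. \<Sum>j\<in>UNIV. s (of_int (?c i j)) w)"
    by (simp add: casimir_def scale_sum_right)
  also have "\<dots> = s (of_int (\<Sum>i\<in>UNIV. \<Sum>j\<in>UNIV. ?c i j)) w"
    by (simp only: scale_sum_left of_int_sum)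
  finally have cas: "s (?n ^ 2) (casimir w) = s (of_int (\<Sum>i\<in>UNIV. \<Sum>j\<in>UNIV. ?c i j)) w"
    (is "_ = s (of_int ?C) w") .
  have "s (?n ^ 2) (s (?n ^ 2) (casimir (casimir w))) = s (?n ^ 2) (casimir (s (?n ^ 2) (casimir w)))"
    by (simp add: linearD[OF lin_casimir])
  also have "\<dots> = s (?n ^ 2) (casimir (s (of_int ?C) w))" unfolding cas ..
  also have "\<dots> = s (of_int ?C) (s (?n ^ 2) (casimir w))"
    by (simp only: linearD(2)[OF lin_casimir] scale_scale mult.commute)
  also have "\<dots> = s (of_int (?C * ?C)) w" unfolding cas by (simp only: scale_scale of_int_mult)
  finally have "s (of_int (?C * ?C)) w = 0" using w by (simp add: W_def)
  then have "?C = 0" using w0 unfolding scale_eq_0_iff of_int_eq_0_iff mult_eq_0_iff by blast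
  moreover have c_ge: "0 \<le> ?c i j" for i j using lam_ge by simp
  ultimately have "?c i j = 0" for i j
    using double_sum_nonneg_eq_0[of ?c] by blast
  then have lam0: "lam i j = 0" if "ix i < ix j" for i j
    using that by (metis less_irrefl mult_eq_0_iff of_nat_eq_0_iff power_eq_0_iff zero_less_card_finite)
  have "H i j w = 0" for i j
  proof (cases "i = j")
    case False
    then have "ix i < ix j \<or> ix j < ix i" using ix by (meson injD linorder_neqE)
    moreover have "H i j w = - H j i w" by (simp add: H_def)
    ultimately show ?thesis using Hw lam0 by auto
  qed (simp add: H_def)
  then have "grading ix w = 0" by (simp add: grading_def)
  then have "p = 0" using w w0 by simp
  with \<open>k \<le> p\<close> show ?thesis by simp
qed

text \<open>Reversing the numbering keeps it injective and negates the grading, which turns the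
  upper bound into a lower one.\<close>

lemma grading_eigenvalue_0:
  assumes ix: "inj ix" and v: "v \<in> W" "v \<noteq> 0" "grading ix v = s (of_int k) v"
  shows "k = 0"
proof -
  have "inj (\<lambda>i. - ix i)" using ix by (simp add: inj_def)
  moreover have "grading (\<lambda>i. - ix i) v = - grading ix v"
    by (simp add: grading_def sum_negf)
  then have "grading (\<lambda>i. - ix i) v = s (of_int (- k)) v"
    using v(3) by simp
  ultimately have "- k \<le> 0" using v by (intro grading_eigenvalue_le_0)
  moreover have "k \<le> 0" using assms by (rule grading_eigenvalue_le_0)
  ultimately show ?thesis by simp
qed

text \<open>On a weight vector the grading has an integral eigenvalue, hence 0. For a \<noteq> b,
  \<open>X a b\<close> would move it to n (ix b - ix a) \<noteq> 0, so it kills the vector, and so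
  does the commutator \<open>H a b\<close>. All weights on \<open>W\<close> being 0, each sl_2 acts
  by zero, and \<open>W_diag\<close> settles the diagonal.\<close>

theorem W_trivial:
  assumes "v \<in> W"
  shows "X i j v = 0"
proof -
  obtain f :: "'n \<Rightarrow> nat" where f: "inj f" using finite_imp_inj_to_nat_seg[of "UNIV :: 'n set"] by auto
  define ix where "ix i = int (f i)" for i
  have ix: "inj ix" using f by (simp add: ix_def inj_def)
  have wt0: "H a b w = 0" if w: "w \<in> W" and lam: "weight_vector lam w" for w lam a b
  proof (cases "a = b")
    case False
    have "grading ix w = s (of_int (\<Sum>i\<in>UNIV. \<Sum>j\<in>UNIV. ix i * lam j i)) w"
      using lam by (simp add: grading_def weight_vector_def scale_sum_left)
    moreover from this have "(\<Sum>i\<in>UNIV. \<Sum>j\<in>UNIV. ix i * lam j i) = 0"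
      using grading_eigenvalue_0[OF ix w] lam by (auto simp only: weight_vector_def)
    ultimately have gr: "grading ix w = 0" by (simp only: of_int_0 scale_zero_left)
    have "X a b w = 0" if "a \<noteq> b" for a b
    proof (rule ccontr)
      assume "X a b w \<noteq> 0"
      moreover have "grading ix (X a b w) = s (of_int (int CARD('n) * (ix b - ix a))) (X a b w)"
        by (simp only: grading_X gr X_simps) simp
      ultimately have "int CARD('n) * (ix b - ix a) = 0"
        using grading_eigenvalue_0[OF ix W_X[OF w]] by blast
      with that ix show False by (auto dest: injD)
    qed
    then show ?thesis using False comm[of a b b a w] by (simp add: X_simps H_def)
  qed (simp add: H_def)
  have off: "X i j v = 0 \<and> H i j v = 0" if "i \<noteq> j" for i j
  proof -
    interpret sl2_triple s Basis "X i j" "X j i" "H i j" using that by (rule sl2)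
    have "k = 0" if u: "u \<in> W" "u \<noteq> 0" "H i j u = s (of_int k) u" for u k
    proof -
      let ?S = "{v \<in> W. H i j v = s (of_int k) v}"
      have "subspace ?S" using subspace_W
        by (auto simp: subspace_def H_simps scale_right_distrib scale_left_commute)
      moreover have "H a b v \<in> ?S" if "v \<in> ?S" for v a b
        using that W_H by (simp add: H_comm[of i j] linearD[OF lin_H])
      ultimately obtain w lam where "w \<in> ?S" "weight_vector lam w"
        using u weight_vector_exists[of ?S] by blast
      then show ?thesis using wt0[of w lam i j] by (auto simp: weight_vector_def)
    qed
    then show ?thesis
      using trivial_if_zero_weights[OF subspace_W] assms W_X W_H by blast
  qed
  show ?thesis
  proof (cases "i = j")
    case True
    have "H i j v = 0" for j using off[of i j] by (cases "i = j") (simp_all add: H_def)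
    then show ?thesis using W_diag[OF assms, of i] True by simp
  qed (use off in blast)
qed

text \<open>\<open>p\<close> removes the image of \<open>central\<close>, then \<beta> removes that
  of \<open>casimir\<close> inside ker central; the remainder \<open>\<pi> v\<close> lies in
  \<open>W\<close>, where \<open>W_trivial\<close> applies. Equivariance of \<pi> gives
  \<open>\<pi> (X i j v) = X i j (\<pi> v) = 0\<close>. An invariant is killed by both operators, so
  nothing is removed from it.\<close>

theorem invariant_projection:
  assumes "\<And>v. central (central v) = 0 \<Longrightarrow> central v = 0"
  obtains \<pi> \<alpha> \<beta> where
    "Vector_Spaces.linear s s \<pi>" "Vector_Spaces.linear s s \<alpha>" "Vector_Spaces.linear s s \<beta>"
    "\<And>i j v. \<pi> (X i j v) = 0" "\<And>i j v. X i j (\<pi> v) = 0"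
    "\<And>i j v. \<alpha> (X i j v) = X i j (\<alpha> v)" "\<And>i j v. \<beta> (X i j v) = X i j (\<beta> v)"
    "\<And>v. v = \<pi> v + central (\<alpha> v) + casimir (\<beta> v)"
    "\<And>v. (\<And>i j. X i j v = 0) \<Longrightarrow> \<pi> v = v"
proof -
  interpret c: fd_operator s Basis central
    by (intro fd_operator.intro operator.intro operator_axioms.intro lin_central
      finite_dimensional_vector_space_axioms vector_space_axioms)
  interpret o: fd_operator s Basis casimir
    by (intro fd_operator.intro operator.intro operator_axioms.intro lin_casimir
      finite_dimensional_vector_space_axioms vector_space_axioms)
  obtain g where g: "\<And>v. central (v - central (c.pe g v)) = 0"
    using c.fitting[of UNIV] assms by auto
  let ?S = "{v. central v = 0}"
  have comm_co: "central (casimir v) = casimir (central v)" for v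
    by (simp add: casimir_def c.T_simps central_X)
  have S1: "subspace ?S" by (auto simp: subspace_def c.T_simps)
  have S2: "casimir v \<in> ?S" if "v \<in> ?S" for v
    using that by (simp add: comm_co o.T_simps)
  have S3: "casimir v = 0" if "v \<in> ?S" "casimir (casimir v) = 0" for v
  proof -
    have "v \<in> W" using that by (simp add: W_def)
    then show ?thesis by (simp add: casimir_def W_trivial X_simps)
  qed
  obtain h where "\<And>v. v \<in> ?S \<Longrightarrow> casimir (v - casimir (o.pe h v)) = 0"
    using o.fitting[OF S1 S2 S3] by blast
  then have h: "casimir (v - casimir (o.pe h v)) = 0" if "central v = 0" for v
    using that by blast
  define p where "p v = v - central (c.pe g v)" for v
  define \<beta> where "\<beta> v = o.pe h (p v)" for v
  define \<pi> where "\<pi> v = p v - casimir (\<beta> v)" for v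
  have cX: "c.pe g (X i j v) = X i j (c.pe g v)" and oX: "o.pe h (X i j v) = X i j (o.pe h v)" for i j v
    by (rule c.pe_commute o.pe_commute; simp add: linX central_X casimir_X)+
  have lin_p: "Vector_Spaces.linear s s p"
    by (intro linearI_vs vector_space_axioms)
      (simp_all add: p_def linearD[OF c.pe_linear] c.T_simps scale_right_diff_distrib)
  have lin_\<beta>: "Vector_Spaces.linear s s \<beta>"
    by (intro linearI_vs vector_space_axioms)
      (simp_all add: \<beta>_def linearD[OF lin_p] linearD[OF o.pe_linear])
  have lin_\<pi>: "Vector_Spaces.linear s s \<pi>"
    by (intro linearI_vs vector_space_axioms)
      (simp_all add: \<pi>_def linearD[OF lin_p] linearD[OF lin_\<beta>] o.T_simps scale_right_diff_distrib)
  have pX: "p (X i j v) = X i j (p v)" for i j v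
    by (simp add: p_def cX central_X X_simps)
  have \<beta>X: "\<beta> (X i j v) = X i j (\<beta> v)" for i j v
    by (simp add: \<beta>_def pX oX)
  have \<pi>X: "\<pi> (X i j v) = X i j (\<pi> v)" for i j v
    by (simp add: \<pi>_def pX \<beta>X casimir_X X_simps)
  have "\<pi> v \<in> W" for v
  proof -
    have p0: "central (p v) = 0" unfolding p_def by (rule g)
    have "central (\<beta> v) = o.pe h (central (p v))"
      unfolding \<beta>_def by (rule o.pe_commute[symmetric]) (simp_all add: lin_central comm_co)
    then have "central (\<pi> v) = 0"
      using p0 by (simp add: \<pi>_def c.T_simps comm_co o.T_simps linearD[OF o.pe_linear])
    moreover have "casimir (\<pi> v) = 0" unfolding \<pi>_def \<beta>_def by (rule h[OF p0])
    ultimately show ?thesis by (simp add: W_def o.T_simps)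
  qed
  then have X\<pi>: "X i j (\<pi> v) = 0" for i j v by (rule W_trivial)
  show ?thesis
  proof (rule that[of \<pi> "c.pe g" \<beta>])
    show "\<pi> v = v" if inv: "\<And>i j. X i j v = 0" for v
    proof -
      have 0: "central v = 0" "casimir v = 0"
        by (simp_all add: central_def casimir_def inv X_simps)
      then have p: "p v = v" by (simp add: p_def linearD[OF c.pe_linear] flip: c.pe_T)
      show ?thesis by (simp add: \<pi>_def \<beta>_def p 0 linearD[OF o.pe_linear] flip: o.pe_T)
    qed
    show "v = \<pi> v + central (c.pe g v) + casimir (\<beta> v)" for v
      by (simp add: \<pi>_def p_def)
  qed (simp_all only: lin_\<pi> lin_\<beta> \<beta>X cX c.pe_linear X\<pi> \<pi>X)
qed

end

text \<open>Lagrange interpolation one node at a time: with q the product over C, q(T) v is an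
  eigenvector for c, and subtracting q(T) v / q(c) from v leaves a vector killed by q(T).\<close>

lemma (in operator) eigen_span_if_annihilated:
  assumes "finite C" "pe (\<Prod>c\<in>C. [:- c, 1:]) v = 0"
  shows "v \<in> span {u. \<exists>c. T u = s c u}"
  using assms
proof (induct C arbitrary: v)
  case empty
  then show ?case by (simp add: one_pCons T_simps span_zero)
next
  case (insert c C)
  let ?q = "\<Prod>c\<in>C. [:- c, 1:]"
  let ?w = "pe ?q v" and ?a = "poly ?q c"
  have a: "?a \<noteq> 0" using insert(1,2) by (auto simp: poly_prod)
  have "pe [:- c, 1:] ?w = 0"
    using insert(4) unfolding prod.insert[OF insert(1,2)] pe_mult .
  then have w: "T ?w = s c ?w" by (simp add: T_simps)
  let ?v = "v - s (1 / ?a) ?w"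
  have "pe ?q ?v = 0"
    using a by (simp add: linearD[OF pe_linear] pe_eigen[OF w])
  then have "?v \<in> span {u. \<exists>c. T u = s c u}" by (rule insert(3))
  moreover have "s (1 / ?a) ?w \<in> span {u. \<exists>c. T u = s c u}"
    using w by (intro span_scale span_base) blast
  ultimately have "?v + s (1 / ?a) ?w \<in> span {u. \<exists>c. T u = s c u}" by (rule span_add)
  then show ?case by simp
qed

text \<open>A sum of eigenvectors satisfies T p(T) v = 0 for some p with p(0) \<noteq> 0: multiply
  together the factors x - c with c \<noteq> 0. If also T^2 v = 0, then T p(T) v reduces to p(0) T
  v.\<close>

lemma (in operator) ker_square_if_eigen_span:
  assumes "v \<in> span {u. \<exists>c. T u = s c u}" "T (T v) = 0"
  shows "T v = 0"
proof -
  have "\<exists>p. poly p 0 \<noteq> 0 \<and> T (pe p v) = 0"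
    using assms(1)
  proof (induct rule: span_induct_alt)
    case base
    then show ?case by (intro exI[of _ 1]) (simp add: linearD[OF pe_linear] T_simps)
  next
    case (step c u w)
    then obtain p x where p: "poly p 0 \<noteq> 0" "T (pe p w) = 0" and x: "T u = s x u" by blast
    obtain q where q: "poly q 0 \<noteq> 0" "T (pe q u) = 0"
    proof (cases "x = 0")
      case True
      with x that[of 1] show ?thesis by (simp add: one_pCons T_simps)
    next
      case False
      with x that[of "[:- x, 1:]"] show ?thesis by (simp add: pe_eigen[OF x] T_simps)
    qed
    have "pe (p * q) w = pe q (pe p w)" unfolding mult.commute[of p q] by (rule pe_mult)
    then have "T (pe (p * q) (s c u + w)) = s c (pe p (T (pe q u))) + pe q (T (pe p w))"
      by (simp add: linearD[OF pe_linear] T_simps pe_mult pe_T)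
    then have "T (pe (p * q) (s c u + w)) = 0"
      using p q by (simp add: linearD[OF pe_linear])
    then show ?case using p q by (intro exI[of _ "p * q"]) simp
  qed
  then obtain p where p: "poly p 0 \<noteq> 0" "T (pe p v) = 0" by blast
  obtain a g where ag: "p = pCons a g" by (cases p)
  have "T (T (pe g v)) = pe g (T (T v))" by (simp add: pe_T)
  then have "s a (T v) = 0" using p assms(2) by (simp add: ag T_simps linearD[OF pe_linear])
  with p ag show ?thesis by simp
qed

lemma finite_dimensional_pw_scale:
  fixes s :: "'k::field \<Rightarrow> 'v::ab_group_add \<Rightarrow> 'v"
  assumes "finite_dimensional_vector_space s B"
  shows "\<exists>B'. finite_dimensional_vector_space (pw_scale s :: 'k \<Rightarrow> ('i::finite \<Rightarrow> 'v) \<Rightarrow> _) B'"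
proof -
  interpret finite_dimensional_vector_space s B by fact
  interpret P: vector_space "pw_scale s :: 'k \<Rightarrow> ('i \<Rightarrow> 'v) \<Rightarrow> _"
    by (rule vector_space_pw_scale[OF vector_space_axioms])
  let ?u = "\<lambda>(i::'i) b j. if j = i then b else 0"
  let ?S = "(\<lambda>(i, b). ?u i b) ` (UNIV \<times> B)"
  have u: "?u i b \<in> P.span ?S" for i b
  proof -
    have "b \<in> span B" by (simp add: span_Basis)
    then show ?thesis
    proof (induct rule: span_induct_alt)
      case base
      show ?case using P.span_zero[of ?S] by (simp add: zero_fun_def)
    next
      case (step c x y)
      have eq: "?u i (s c x + y) = pw_scale s c (?u i x) + ?u i y"
        by (auto simp: pw_scale_def)
      have "?u i x \<in> P.span ?S" using step by (intro P.span_base) auto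
      then show ?case unfolding eq using step by (intro P.span_add P.span_scale)
    qed
  qed
  have "f \<in> P.span ?S" for f
  proof -
    have "f = (\<Sum>i\<in>UNIV. ?u i (f i))"
    proof
      fix j
      show "f j = (\<Sum>i\<in>UNIV. ?u i (f i)) j" by (simp add: sum_fun_app)
    qed
    moreover have "(\<Sum>i\<in>UNIV. ?u i (f i)) \<in> P.span ?S" using u by (intro P.span_sum)
    ultimately show ?thesis by simp
  qed
  then have span: "P.span ?S = UNIV" by blast
  obtain B' where B': "B' \<subseteq> ?S" "P.independent B'" "?S \<subseteq> P.span B'"
    by (rule P.maximal_independent_subset[of ?S])
  have "finite ?S" using finite_Basis by simp
  then have "finite B'" using B'(1) by (rule rev_finite_subset)
  moreover have "P.span ?S \<subseteq> P.span B'"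
    using P.span_mono[OF B'(3)] by (simp only: P.span_span)
  then have "P.span B' = UNIV" unfolding span by blast
  moreover note B'(2)
  ultimately have "finite_dimensional_vector_space (pw_scale s :: 'k \<Rightarrow> ('i \<Rightarrow> 'v) \<Rightarrow> _) B'"
    by unfold_locales
  then show ?thesis ..
qed

section \<open>The identity matrix acts semisimply\<close>

text \<open>Each factor V contributes +1 and each factor V' contributes -1.\<close>

lemma mixed_action_one:
  assumes "t \<in> mixed_tensors p q"
  shows "mixed_action (mat 1 :: 'k::field^'n^'n) t = pw_scale (*) (of_nat p - of_nat q) t"
proof -
  have "mixed_action (mat 1 :: 'k^'n^'n) t (I, J) = (of_nat p - of_nat q) * t (I, J)" for I J
  proof -
    have 1: "(\<Sum>h\<in>UNIV. (mat 1 :: 'k^'n^'n) $ (I ! s) $ h * t (I[s := h], J)) = t (I, J)" for s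
    proof -
      have "(mat 1 :: 'k^'n^'n) $ (I ! s) $ h * t (I[s := h], J) = (if h = I ! s then t (I, J) else 0)" for h
        by (auto simp: mat_def)
      then show ?thesis by simp
    qed
    have 2: "(\<Sum>h\<in>UNIV. t (I, J[s := h]) * (mat 1 :: 'k^'n^'n) $ h $ (J ! s)) = t (I, J)" for s
    proof -
      have "t (I, J[s := h]) * (mat 1 :: 'k^'n^'n) $ h $ (J ! s) = (if h = J ! s then t (I, J) else 0)" for h
        by (auto simp: mat_def)
      then show ?thesis by simp
    qed
    have "mixed_action (mat 1 :: 'k^'n^'n) t (I, J) = (of_nat (length I) - of_nat (length J)) * t (I, J)"
      by (simp add: mixed_action_def 1 2 left_diff_distrib)
    then show ?thesis using assms by (auto simp: mixed_tensors_def)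
  qed
  then show ?thesis by (auto simp: pw_scale_def)
qed

text \<open>The embedding f is injective and makes the identity a scalar on each direct summand.
  Linearity and an annihilating product of distinct linear factors are therefore checked after
  applying f, summand by summand.\<close>

lemma tensor_module_eigen_span:
  fixes sM :: "'k::field \<Rightarrow> 'm::ab_group_add \<Rightarrow> 'm" and act :: "'k^'n^'n \<Rightarrow> 'm \<Rightarrow> 'm"
  assumes vs: "vector_space sM" and tm: "tensor_module sM act"
  shows "m \<in> module.span sM {u. \<exists>c. act (mat 1) u = sM c u}"
proof -
  interpret vector_space sM by fact
  obtain pqs W f where W: "W \<subseteq> mixed_tensor_sum pqs"
    and iso: "linear_iso_on sM UNIV (pw_scale (pw_scale (*))) W f"
    and f: "\<And>a m. f (act a m) = mixed_sum_action a (f m)"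
    using tm unfolding tensor_module_def by blast
  have add: "f (x + y) = f x + f y" and scale: "f (sM c x) = pw_scale (pw_scale (*)) c (f x)"
    and inj: "inj f" and fW: "f x \<in> W" for x y c
    using iso by (auto simp: linear_iso_on_def bij_betw_def)
  let ?c = "\<lambda>i. of_nat (fst (pqs ! i)) - of_nat (snd (pqs ! i)) :: 'k"
  have fm: "f m \<in> mixed_tensor_sum pqs" for m using W fW by blast
  have f1: "f (act (mat 1) m) i = pw_scale (*) (?c i) (f m i)" for m i
  proof (cases "i < length pqs")
    case True
    then show ?thesis using fm[of m]
      by (auto simp: f mixed_sum_action_def mixed_tensor_sum_def mixed_action_one)
  next
    case False
    then have "f m i = 0" "f (act (mat 1) m) i = 0"
      using fm by (auto simp: mixed_tensor_sum_def)
    then show ?thesis by (auto simp: pw_scale_def)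
  qed
  interpret operator sM "act (mat 1)"
  proof (unfold_locales)
    show "act (mat 1) (x + y) = act (mat 1) x + act (mat 1) y" for x y
    proof (rule injD[OF inj], rule ext)
      show "f (act (mat 1) (x + y)) i = f (act (mat 1) x + act (mat 1) y) i" for i
        by (simp add: add f1) (simp add: pw_scale_def fun_eq_iff algebra_simps)
    qed
    show "act (mat 1) (sM c x) = sM c (act (mat 1) x)" for c x
    proof (rule injD[OF inj], rule ext)
      show "f (act (mat 1) (sM c x)) i = f (sM c (act (mat 1) x)) i" for i
        by (simp add: scale f1 pw_scale_def[of "pw_scale (*)"]) (simp add: pw_scale_def fun_eq_iff algebra_simps)
    qed
  qed
  have f0: "f 0 = 0" using add[of 0 0] by simp
  have fp: "f (pe p m) i = pw_scale (*) (poly p (?c i)) (f m i)" for p i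
  proof (induct p)
    case 0
    then show ?case by (simp add: f0 pw_scale_def zero_fun_def)
  next
    case (pCons a p)
    then show ?case
      by (simp add: add scale f1) (simp add: pw_scale_def fun_eq_iff algebra_simps)
  qed
  \<comment> \<open>A set rather than a list: repeated scalars give one factor, so the product has
    simple roots.\<close>
  let ?C = "?c ` {..<length pqs}"
  have "pe (\<Prod>c\<in>?C. [:- c, 1:]) m = 0"
  proof (rule injD[OF inj], unfold f0, rule ext)
    fix i
    show "f (pe (\<Prod>c\<in>?C. [:- c, 1:]) m) i = 0 i"
    proof (cases "i < length pqs")
      case True
      then have "poly (\<Prod>c\<in>?C. [:- c, 1:]) (?c i) = 0"
        by (auto simp: poly_prod intro!: prod_zero)
      then show ?thesis by (simp add: fp pw_scale_def zero_fun_def)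
    next
      case False
      then show ?thesis using fm by (auto simp: mixed_tensor_sum_def)
    qed
  qed
  then show ?thesis by (intro eigen_span_if_annihilated) auto
qed

section \<open>Matrix units and the gl_n-module V = Hom(A, M)\<close>

definition unit_mat :: "'n \<Rightarrow> 'n \<Rightarrow> 'k::field^'n^'n" where
  "unit_mat i j = (\<chi> a b. if a = i \<and> b = j then 1 else 0)"

lemma unit_mat_mult:
  "unit_mat i j ** unit_mat k l = (if j = k then unit_mat i l else (0 :: 'k::field^'n^'n))"
proof -
  have "(\<Sum>h\<in>UNIV. unit_mat i j $ a $ h * unit_mat k l $ h $ b :: 'k) =
      (if j = k then unit_mat i l $ a $ b else 0)" for a b
  proof -
    have "(unit_mat i j $ a $ h * unit_mat k l $ h $ b :: 'k) =
        (if h = j then if a = i \<and> j = k \<and> b = l then 1 else 0 else 0)" for h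
      by (auto simp: unit_mat_def)
    then show ?thesis by (simp add: unit_mat_def)
  qed
  then show ?thesis by (auto simp: vec_eq_iff matrix_matrix_mult_def)
qed

lemma sum_unit_mat: "(\<Sum>i\<in>UNIV. \<Sum>j\<in>UNIV. mat_scale (a $ i $ j) (unit_mat i j)) = (a :: 'k::field^'n^'n)"
proof -
  have "(\<Sum>i\<in>UNIV. \<Sum>j\<in>UNIV. a $ i $ j * (if x = i \<and> y = j then 1 else 0)) = a $ x $ y" for x y
  proof -
    have "a $ i $ j * (if x = i \<and> y = j then 1 else 0) = (if y = j then if x = i then a $ x $ y else 0 else 0)" for i j
      by auto
    then show ?thesis by simp
  qed
  then show ?thesis by (simp add: vec_eq_iff mat_scale_def unit_mat_def)
qed

lemma mat_1_unit_mat: "(\<Sum>i\<in>UNIV. unit_mat i i) = (mat 1 :: 'k::field^'n^'n)"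
proof -
  have "(\<Sum>x\<in>UNIV. if i = x \<and> j = x then 1 else 0 :: 'k) = (if i = j then 1 else 0)" for i j :: 'n
  proof -
    have "(if i = x \<and> j = x then 1 else 0 :: 'k) = (if x = i then if i = j then 1 else 0 else 0)" for x
      by auto
    then show ?thesis by simp
  qed
  then show ?thesis by (simp add: vec_eq_iff unit_mat_def mat_def)
qed

locale gl_bimodule = finite_dimensional_vector_space sM B
  for sM :: "'k::field_char_0 \<Rightarrow> 'm::ab_group_add \<Rightarrow> 'm" and B +
  fixes l :: "'k^'n^'n \<Rightarrow> 'm \<Rightarrow> 'm" and r :: "'m \<Rightarrow> 'k^'n^'n \<Rightarrow> 'm"
  assumes rsym: "rsym_module mat_scale (**) sM l r"
begin

lemma l_linear: "Vector_Spaces.linear sM sM (l a)"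
  and l_linear_left: "Vector_Spaces.linear mat_scale sM (\<lambda>a. l a m)"
  and r_linear: "Vector_Spaces.linear mat_scale sM (r m)"
  and r_linear_left: "Vector_Spaces.linear sM sM (\<lambda>m. r m a)"
  using rsym by (auto simp: rsym_module_def bilinear_map_def)

lemmas l_simps = linearD[OF l_linear] linearD[OF l_linear_left]
lemmas r_simps = linearD[OF r_linear] linearD[OF r_linear_left]

lemma r_bracket: "r m (a ** b - b ** a) = r (r m a) b - r (r m b) a"
  using rsym by (simp add: rsym_module_def commutator_def)

lemma r_l: "r (l a m) b = l a (r m b) + l (a ** b) m - l a (l b m)"
proof -
  have "r (l a m) b - l a (r m b) - l (a ** b) m + l a (l b m) = 0"
    using rsym by (simp add: rsym_module_def)
  then show ?thesis by (simp add: algebra_simps eq_neg_iff_add_eq_0)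
qed

text \<open>Arrays indexed by the matrix units make V a whole type, as
  \<open>finite_dimensional_vector_space\<close> requires; the linear maps from A to M would only
  form a subset of a type.\<close>

abbreviation sV :: "'k \<Rightarrow> ('n \<Rightarrow> 'n \<Rightarrow> 'm) \<Rightarrow> 'n \<Rightarrow> 'n \<Rightarrow> 'm" where
  "sV \<equiv> pw_scale (pw_scale sM)"

definition basisV :: "('n \<Rightarrow> 'n \<Rightarrow> 'm) set" where
  "basisV = (SOME B. finite_dimensional_vector_space sV B)"

lemma fd_V: "finite_dimensional_vector_space sV basisV"
proof -
  obtain B1 where "finite_dimensional_vector_space (pw_scale sM :: 'k \<Rightarrow> ('n \<Rightarrow> 'm) \<Rightarrow> _) B1"
    using finite_dimensional_pw_scale[OF finite_dimensional_vector_space_axioms] by blast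
  from finite_dimensional_pw_scale[OF this]
  obtain B2 where "finite_dimensional_vector_space sV B2" by blast
  then show ?thesis unfolding basisV_def by (rule someI)
qed

sublocale V: finite_dimensional_vector_space sV basisV by (rule fd_V)

text \<open>A linear map \<open>A \<rightarrow> M\<close> is encoded by the array of its values at the matrix units;
  \<open>ev v\<close> is the linear map with array \<open>v\<close>.\<close>

definition ev :: "('n \<Rightarrow> 'n \<Rightarrow> 'm) \<Rightarrow> 'k^'n^'n \<Rightarrow> 'm" where
  "ev v a = (\<Sum>i\<in>UNIV. \<Sum>j\<in>UNIV. sM (a $ i $ j) (v i j))"

lemma ev_linear: "Vector_Spaces.linear mat_scale sM (ev v)"
  by (intro linearI_vs vector_space_mat_scale vector_space_axioms)
    (simp_all add: ev_def mat_scale_def scale_left_distrib sum.distrib scale_sum_right)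

lemma ev_linear_left: "Vector_Spaces.linear sV sM (\<lambda>v. ev v a)"
  by (intro linearI_vs V.vector_space_axioms vector_space_axioms)
    (simp_all add: ev_def pw_scale_def scale_right_distrib sum.distrib scale_sum_right mult.commute)

lemmas ev_simps = linearD[OF ev_linear] linearD[OF ev_linear_left]

lemma ev_unit_mat [simp]: "ev v (unit_mat i j) = v i j"
proof -
  have "sM (unit_mat i j $ k $ h) (v k h) = (if h = j then if k = i then v i j else 0 else 0)" for k h
    by (auto simp: unit_mat_def)
  then show ?thesis by (simp add: ev_def)
qed

lemma ev_unique:
  assumes "Vector_Spaces.linear mat_scale sM f"
  shows "ev (\<lambda>i j. f (unit_mat i j)) a = f a"
proof -
  have "f a = f (\<Sum>i\<in>UNIV. \<Sum>j\<in>UNIV. mat_scale (a $ i $ j) (unit_mat i j))"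
    by (simp only: sum_unit_mat)
  then show ?thesis by (simp add: ev_def linearD[OF assms])
qed

definition hom_act :: "('k^'n^'n \<Rightarrow> 'm) \<Rightarrow> 'k^'n^'n \<Rightarrow> 'k^'n^'n \<Rightarrow> 'm" where
  "hom_act f b a = l a (f b) - f (a ** b) + r (f a) b"

definition act :: "('n \<Rightarrow> 'n \<Rightarrow> 'm) \<Rightarrow> 'k^'n^'n \<Rightarrow> 'n \<Rightarrow> 'n \<Rightarrow> 'm" where
  "act v b = (\<lambda>i j. hom_act (ev v) b (unit_mat i j))"

lemma mat_mult_linear:
  "(a + b) ** c = a ** c + b ** c" "c ** (a + b) = c ** a + c ** b"
  "(a - b) ** c = a ** c - b ** c" "c ** (a - b) = c ** a - c ** b"
  "mat_scale x a ** c = mat_scale x (a ** c)" "c ** mat_scale x a = mat_scale x (c ** a)"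
  for a b c :: "'k^'n^'n"
proof -
  have la: "Vector_Spaces.linear mat_scale mat_scale ((**) c :: 'k^'n^'n \<Rightarrow> _)"
    and lb: "Vector_Spaces.linear mat_scale mat_scale (\<lambda>a :: 'k^'n^'n. a ** c)"
    using right_symmetric_algebra_matrix[where ?'k = 'k and ?'n = 'n]
    by (auto simp: right_symmetric_algebra_def bilinear_map_def)
  show "(a + b) ** c = a ** c + b ** c" "c ** (a + b) = c ** a + c ** b"
    "(a - b) ** c = a ** c - b ** c" "c ** (a - b) = c ** a - c ** b"
    "mat_scale x a ** c = mat_scale x (a ** c)" "c ** mat_scale x a = mat_scale x (c ** a)"
    using linearD[OF la] linearD[OF lb] by simp_all
qed

lemma hom_act_linear:
  assumes "Vector_Spaces.linear mat_scale sM f"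
  shows "Vector_Spaces.linear mat_scale sM (hom_act f b)"
  by (intro linearI_vs vector_space_mat_scale vector_space_axioms)
    (simp_all add: hom_act_def l_simps r_simps linearD[OF assms] mat_mult_linear
      scale_right_distrib scale_right_diff_distrib)

lemma ev_act: "ev (act v b) a = hom_act (ev v) b a"
  unfolding act_def by (rule ev_unique) (rule hom_act_linear[OF ev_linear])

lemma act_linear: "Vector_Spaces.linear mat_scale sV (act v)"
  by (intro linearI_vs vector_space_mat_scale V.vector_space_axioms ext)
    (simp_all add: act_def hom_act_def pw_scale_def l_simps r_simps ev_simps mat_mult_linear
      scale_right_distrib scale_right_diff_distrib)

lemma act_linear_left: "Vector_Spaces.linear sV sV (\<lambda>v. act v b)"
  by (intro linearI_vs V.vector_space_axioms ext)
    (simp_all add: act_def hom_act_def l_simps r_simps ev_simps scale_right_distrib scale_right_diff_distrib,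
     simp add: pw_scale_def r_simps scale_right_distrib scale_right_diff_distrib)

lemmas act_simps = linearD[OF act_linear] linearD[OF act_linear_left]

lemma act_bracket: "act v (b ** c - c ** b) = act (act v b) c - act (act v c) b"
proof (intro ext)
  fix i j
  let ?a = "unit_mat i j :: 'k^'n^'n" and ?f = "ev v"
  \<comment> \<open>The axiom \<open>r_l\<close> cancels the terms with two left actions. The terms
    with one left and one right action, and those of the shape r (f (a c)) b, are symmetric in b and
    c, so they drop out of the commutator.\<close>
  have "act (act v b) c i j =
      - l ?a (?f (c ** b)) + l ?a (r (?f c) b) + l ?a (r (?f b) c) + ?f (?a ** c ** b)
      - r (?f (?a ** c)) b - r (?f (?a ** b)) c + r (r (?f ?a) b) c" for b c
    by (simp add: act_def[of "act v b"] hom_act_def[of "ev (act v b)"] ev_act hom_act_def[of "ev v"]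
      l_simps r_simps r_l matrix_mul_assoc del: ev_unit_mat)
  then show "act v (b ** c - c ** b) i j = (act (act v b) c - act (act v c) b) i j"
    by (simp add: act_def[of v] hom_act_def l_simps ev_simps mat_mult_linear matrix_mul_assoc
      r_bracket del: ev_unit_mat)
qed

text \<open>The minus sign turns the right action into a left one, as the relations of
  \<open>gl_ops\<close> demand.\<close>

definition op :: "'n \<Rightarrow> 'n \<Rightarrow> ('n \<Rightarrow> 'n \<Rightarrow> 'm) \<Rightarrow> 'n \<Rightarrow> 'n \<Rightarrow> 'm" where
  "op i j v = - act v (unit_mat i j)"

sublocale gl_ops sV basisV op
proof unfold_locales
  show "op i j (x + y) = op i j x + op i j y" for i j x y by (simp add: op_def act_simps)
  show "op i j (sV c x) = sV c (op i j x)" for i j c x by (simp add: op_def act_simps)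
  fix i j k h v
  have "op i j (op k h v) - op k h (op i j v) = act v (unit_mat k h ** unit_mat i j - unit_mat i j ** unit_mat k h)"
    unfolding act_bracket by (simp add: op_def act_simps)
  also have "\<dots> = (if j = k then op i h v else 0) - (if h = i then op k j v else 0)"
    by (simp add: unit_mat_mult op_def act_simps)
  finally show "op i j (op k h v) = op k h (op i j v) + (if j = k then op i h v else 0)
      - (if h = i then op k j v else 0)"
    by (simp add: algebra_simps)
qed

lemma central_act: "central v = - act v (mat 1)"
  by (simp add: central_def op_def sum_negf act_simps flip: mat_1_unit_mat)

lemma central_eq: "central v i j = v i j - r (v i j) (mat 1) - l (unit_mat i j) (\<Sum>h\<in>UNIV. v h h)"
proof -
  have "ev v (mat 1) = (\<Sum>h\<in>UNIV. v h h)"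
    by (simp add: ev_simps flip: mat_1_unit_mat)
  then show ?thesis by (simp add: central_act act_def hom_act_def matrix_mul_rid)
qed

abbreviation "L \<equiv> l (mat 1)"

text \<open>\<open>T\<close> is the Lie action of the identity on M, where diagonalisability is
  given. By \<open>central_eq\<close>, \<open>S\<close> is what \<open>central\<close> does
  entrywise to maps vanishing at the identity.\<close>

definition T :: "'m \<Rightarrow> 'm" where "T m = L m - r m (mat 1)"
definition S :: "'m \<Rightarrow> 'm" where "S m = m - r m (mat 1)"

lemma T_linear: "Vector_Spaces.linear sM sM T" and S_linear: "Vector_Spaces.linear sM sM S"
  by (intro linearI_vs vector_space_axioms;
    simp add: T_def S_def l_simps r_simps scale_right_diff_distrib)+

lemmas TS_simps = linearD[OF T_linear] linearD[OF S_linear]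

text \<open>Left multiplication intertwines \<open>T\<close> with \<open>S\<close>. If T u = t u,
  then L u has eigenvalue t under \<open>S\<close>, and u - L u has eigenvalue 1 + t by
  \<open>S_id_minus_L\<close>; their sum is u, so \<open>S\<close> inherits diagonalisability from
  \<open>T\<close>.\<close>

lemma S_l: "S (l a u) = l a (T u)"
  by (simp add: S_def T_def r_l matrix_mul_rid l_simps)

lemma S_id_minus_L: "S (u - L u) = (u + T u) - L (u + T u)"
proof -
  have "S u = u + T u - L u" by (simp add: S_def T_def)
  then show ?thesis by (simp only: TS_simps S_l l_simps) simp
qed

text \<open>Eigenvectors of the identity matrix spanning \<open>V\<close>: let \<open>c0\<close> be linear with \<open>c0(1) = 1\<close>. For \<open>u\<close>
  an eigenvector of \<open>T\<close> take \<open>f1 u = (a \<mapsto> a \<circ> L u)\<close> and \<open>f2 u = (a \<mapsto> c0(a) (u - L u) - a \<circ> (u - L u))\<close>,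
  with values \<open>L\<^sup>2 u\<close> and \<open>(1 - L)\<^sup>2 u\<close> at \<open>1\<close>; the maps vanishing at \<open>1\<close> are spanned by \<open>e0\<close> of
  eigenvectors of \<open>S\<close>.\<close>

theorem center_semisimple:
  assumes T: "\<And>m. m \<in> span {u. \<exists>c. T u = sM c u}"
    and v: "central (central v) = 0"
  shows "central v = 0"
proof -
  interpret c: operator sV central
    by (intro operator.intro operator_axioms.intro lin_central V.vector_space_axioms)
  let ?E = "{u. \<exists>c. central u = sV c u}"
  have cE: "w \<in> V.span ?E" if "\<And>i j. central w i j = sM c (w i j)" for w c
    using that by (intro V.span_base) (auto simp: pw_scale_def fun_eq_iff)
  \<comment> \<open>\<open>undefined\<close> is an arbitrary fixed index; \<open>c0\<close> reads
    off one diagonal entry, whence c0(1) = 1.\<close>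
  define c0 :: "'n \<Rightarrow> 'n \<Rightarrow> 'k" where "c0 i j = (if i = undefined \<and> j = undefined then 1 else 0)" for i j
  have c0: "(\<Sum>i\<in>UNIV. c0 i i) = 1" by (simp add: c0_def)
  have Tspan: "P u" if "P 0" "\<And>c x y t. T x = sM t x \<Longrightarrow> P y \<Longrightarrow> P (sM c x + y)" for P and u :: 'm
    using T[of u] by (induct rule: span_induct_alt) (use that in auto)
  have Sspan: "w \<in> span {u. \<exists>c. S u = sM c u}" for w
  proof -
    let ?ES = "{u. \<exists>c. S u = sM c u}"
    have "L w \<in> span ?ES \<and> w - L w \<in> span ?ES"
    proof (rule Tspan[of _ w])
      show "L 0 \<in> span ?ES \<and> 0 - L 0 \<in> span ?ES" by (simp add: l_simps span_zero)
      fix c x y t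
      assume x: "T x = sM t x" and y: "L y \<in> span ?ES \<and> y - L y \<in> span ?ES"
      have "S (L x) = sM t (L x)" by (simp add: S_l x l_simps)
      moreover have "S (x - L x) = sM (1 + t) (x - L x)"
        by (simp add: S_id_minus_L x l_simps scale_left_distrib scale_right_diff_distrib)
      ultimately have "L x \<in> span ?ES" "x - L x \<in> span ?ES" by (blast intro: span_base)+
      moreover have "L (sM c x + y) = sM c (L x) + L y"
        "(sM c x + y) - L (sM c x + y) = sM c (x - L x) + (y - L y)"
        by (simp_all add: l_simps scale_right_diff_distrib)
      ultimately show "L (sM c x + y) \<in> span ?ES \<and> (sM c x + y) - L (sM c x + y) \<in> span ?ES"
        using y by (simp only:) (intro conjI span_add span_scale; blast)
    qed
    then show ?thesis using span_add[of "L w" ?ES "w - L w"] by simp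
  qed
  \<comment> \<open>The map dual to E_ij with value w; for i = j a multiple of \<open>c0\<close> is
    subtracted to make its value at the identity 0.\<close>
  define e0 where "e0 i j w = (\<lambda>k h. sM ((if k = i \<and> h = j then 1 else 0) - (if i = j then c0 k h else 0)) w)"
    for i j w
  have e0: "e0 i j w \<in> V.span ?E" for i j w
    using Sspan[of w]
  proof (induct rule: span_induct_alt)
    case base
    have "e0 i j 0 = 0" by (simp add: e0_def zero_fun_def)
    then show ?case by (simp only: V.span_zero)
  next
    case (step c x y)
    then obtain t where x: "S x = sM t x" by blast
    have "(\<Sum>h\<in>UNIV. e0 i j x h h) = 0"
    proof -
      have "(\<Sum>h\<in>UNIV. if h = i \<and> h = j then 1 else 0 :: 'k) = (\<Sum>h\<in>UNIV. if h = i then if i = j then 1 else 0 else 0)"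
        by (intro sum.cong) auto
      then show ?thesis
        by (simp add: e0_def flip: scale_sum_left) (simp add: sum_subtractf c0)
    qed
    moreover have "y - r y (mat 1) = sM t y" if "y = sM d x" for y d
      using x that by (simp add: S_def r_simps mult.commute flip: scale_right_diff_distrib)
    ultimately have "e0 i j x \<in> V.span ?E"
      by (intro cE[of _ t]) (simp add: central_eq l_simps e0_def)
    moreover have eq: "e0 i j (sM c x + y) = sV c (e0 i j x) + e0 i j y"
      by (simp add: fun_eq_iff e0_def pw_scale_def scale_right_distrib mult.commute)
    ultimately show ?case unfolding eq using step by (blast intro: V.span_add V.span_scale)
  qed
  define f1 where "f1 u = (\<lambda>i j. l (unit_mat i j) (L u))" for u
  define f2 where "f2 u = (\<lambda>i j. sM (c0 i j) (u - L u) - l (unit_mat i j) (u - L u))" for u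
  have sum_l: "(\<Sum>h\<in>UNIV. l (unit_mat h h) x) = L x" for x
    by (simp add: l_simps flip: mat_1_unit_mat)
  have f1: "(\<Sum>h\<in>UNIV. f1 u h h) = L (L u)" and f2: "(\<Sum>h\<in>UNIV. f2 u h h) = (u - L u) - L (u - L u)" for u
    by (simp_all add: f1_def f2_def sum_l sum_subtractf c0 flip: scale_sum_left)
  \<comment> \<open>\<open>S_l\<close> at the identity reads S (L u) = L (T u), and T = S - 1 +
    L.\<close>
  have TL: "T (L u) = L (T u) - L u + L (L u)" for u
    using S_l[of "mat 1" u] by (simp add: S_def T_def algebra_simps l_simps)
  have f12: "f1 u \<in> V.span ?E \<and> f2 u \<in> V.span ?E" for u
  proof (rule Tspan[of _ u])
    have "f1 0 = 0" "f2 0 = 0" by (simp_all add: fun_eq_iff f1_def f2_def l_simps)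
    then show "f1 0 \<in> V.span ?E \<and> f2 0 \<in> V.span ?E" by (simp only: V.span_zero simp_thms)
    fix c x y t
    assume x: "T x = sM t x" and y: "f1 y \<in> V.span ?E \<and> f2 y \<in> V.span ?E"
    have "f1 x \<in> V.span ?E"
    proof (rule cE[of _ "t - 1"])
      fix i j
      have "central (f1 x) i j = S (l (unit_mat i j) (L x)) - l (unit_mat i j) (L (L x))"
        by (simp add: central_eq f1 S_def) (simp add: f1_def)
      then show "central (f1 x) i j = sM (t - 1) (f1 x i j)"
        by (simp add: S_l TL x l_simps f1_def scale_left_diff_distrib)
    qed
    moreover have "f2 x \<in> V.span ?E"
    proof (rule cE[of _ "1 + t"])
      fix i j
      let ?l = "l (unit_mat i j)"
      have "central (f2 x) i j = sM (c0 i j) (S (x - L x)) - S (?l (x - L x)) - ?l ((x - L x) - L (x - L x))"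
        by (simp add: central_eq f2 S_def) (simp add: f2_def l_simps r_simps scale_right_diff_distrib)
      also have "S (x - L x) = sM (1 + t) (x - L x)"
        by (simp add: S_id_minus_L x l_simps scale_left_distrib scale_right_diff_distrib)
      also have "S (?l (x - L x)) = ?l (sM t (x - L x) + L (x - L x))"
        by (simp only: S_l TS_simps TL x l_simps scale_right_diff_distrib) simp
      finally have "central (f2 x) i j = sM (c0 i j) (sM (1 + t) (x - L x))
          - ?l (sM t (x - L x) + L (x - L x)) - ?l ((x - L x) - L (x - L x))" .
      also have "\<dots> = sM (c0 i j) (sM (1 + t) (x - L x)) - ?l (sM (1 + t) (x - L x))"
        by (simp add: l_simps scale_left_distrib)
      finally show "central (f2 x) i j = sM (1 + t) (f2 x i j)"
        by (simp only: f2_def l_simps scale_right_diff_distrib scale_scale mult.commute)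
    qed
    moreover have eq: "f1 (sM c x + y) = sV c (f1 x) + f1 y" "f2 (sM c x + y) = sV c (f2 x) + f2 y"
      by (simp_all add: fun_eq_iff f1_def f2_def pw_scale_def l_simps scale_right_distrib scale_right_diff_distrib
        algebra_simps)
    ultimately show "f1 (sM c x + y) \<in> V.span ?E \<and> f2 (sM c x + y) \<in> V.span ?E"
      unfolding eq using y by (blast intro: V.span_add V.span_scale)
  qed
  let ?m = "\<Sum>h\<in>UNIV. v h h"
  text \<open>The two weights come from \<open>(1 - x)\<^sup>2 (1 + 2 x) + x\<^sup>2 (3 - 2 x) = 1\<close>.\<close>
  define w where "w = v - f2 (?m + sM 2 (L ?m)) - f1 (sM 3 ?m - sM 2 (L ?m))"
  have s23: "sM 2 x = x + x" "sM 3 x = x + x + x" for x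
    using scale_left_distrib[of 1 1 x] scale_left_distrib[of 2 1 x] by simp_all
  have w0: "(\<Sum>h\<in>UNIV. w h h) = 0"
    by (simp add: w_def sum_subtractf f1 f2) (simp add: l_simps s23)
  have "w = (\<Sum>i\<in>UNIV. \<Sum>j\<in>UNIV. e0 i j (w i j))"
  proof (intro ext)
    fix k h
    have "e0 i j (w i j) k h = (if j = h then if i = k then w i j else 0 else 0)
        - (if j = i then sM (c0 k h) (w i i) else 0)" for i j
      by (auto simp: e0_def scale_left_diff_distrib)
    then have "(\<Sum>i\<in>UNIV. \<Sum>j\<in>UNIV. e0 i j (w i j)) k h = w k h - sM (c0 k h) (\<Sum>i\<in>UNIV. w i i)"
      by (simp add: sum_fun_app sum_subtractf scale_sum_right)
    then show "w k h = (\<Sum>i\<in>UNIV. \<Sum>j\<in>UNIV. e0 i j (w i j)) k h" by (simp add: w0)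
  qed
  then have "w \<in> V.span ?E" using e0 by (metis (no_types, lifting) V.span_sum)
  then have "w + f2 (?m + sM 2 (L ?m)) + f1 (sM 3 ?m - sM 2 (L ?m)) \<in> V.span ?E"
    using f12 by (intro V.span_add) auto
  then have "v \<in> V.span ?E" by (simp add: w_def)
  then show ?thesis using v by (rule c.ker_square_if_eigen_span)
qed

end

section \<open>Alternating cochains\<close>

abbreviation "MA \<equiv> multilinear_alternating_from"

lemma MA_iff:
  assumes "vector_space sA" "vector_space sM"
  shows "F \<in> MA p sA sM k \<longleftrightarrow>
     (\<forall>xs. length xs \<noteq> k \<longrightarrow> F xs = 0) \<and>
     (\<forall>xs i x y. length xs = k \<longrightarrow> i < k \<longrightarrow> F (xs[i := x + y]) = F (xs[i := x]) + F (xs[i := y])) \<and>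
     (\<forall>xs i c x. length xs = k \<longrightarrow> i < k \<longrightarrow> F (xs[i := sA c x]) = sM c (F (xs[i := x]))) \<and>
     (\<forall>xs i j. length xs = k \<longrightarrow> p \<le> i \<longrightarrow> i < j \<longrightarrow> j < k \<longrightarrow> xs ! i = xs ! j \<longrightarrow> F xs = 0)"
proof -
  have "Vector_Spaces.linear sA sM f \<longleftrightarrow> (\<forall>x y. f (x + y) = f x + f y) \<and> (\<forall>c x. f (sA c x) = sM c (f x))" for f
    using linearI_vs[OF assms] linearD(1,2) by metis
  then show ?thesis unfolding multilinear_alternating_from_def by auto
qed

locale cochains = A: vector_space sA + M: vector_space sM
  for sA :: "'k::field \<Rightarrow> 'a::ab_group_add \<Rightarrow> 'a" and sM :: "'k \<Rightarrow> 'm::ab_group_add \<Rightarrow> 'm"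
begin

lemmas MA_iff = MA_iff[OF A.vector_space_axioms M.vector_space_axioms]

lemma MA_I:
  assumes "\<And>xs. length xs \<noteq> k \<Longrightarrow> F xs = 0"
    and "\<And>xs i x y. length xs = k \<Longrightarrow> i < k \<Longrightarrow> F (xs[i := x + y]) = F (xs[i := x]) + F (xs[i := y])"
    and "\<And>xs i c x. length xs = k \<Longrightarrow> i < k \<Longrightarrow> F (xs[i := sA c x]) = sM c (F (xs[i := x]))"
    and "\<And>xs i j. length xs = k \<Longrightarrow> p \<le> i \<Longrightarrow> i < j \<Longrightarrow> j < k \<Longrightarrow> xs ! i = xs ! j \<Longrightarrow> F xs = 0"
  shows "F \<in> MA p sA sM k"
  using assms unfolding MA_iff by blast

lemma MA_D:
  assumes "F \<in> MA p sA sM k"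
  shows "length xs \<noteq> k \<Longrightarrow> F xs = 0"
    and "length xs = k \<Longrightarrow> i < k \<Longrightarrow> F (xs[i := x + y]) = F (xs[i := x]) + F (xs[i := y])"
    and "length xs = k \<Longrightarrow> i < k \<Longrightarrow> F (xs[i := sA c x]) = sM c (F (xs[i := x]))"
    and "length xs = k \<Longrightarrow> p \<le> i \<Longrightarrow> i < j \<Longrightarrow> j < k \<Longrightarrow> xs ! i = xs ! j \<Longrightarrow> F xs = 0"
  using assms unfolding MA_iff by blast+

lemma MA_linear:
  assumes "F \<in> MA p sA sM k" "length xs = k" "i < k"
  shows "Vector_Spaces.linear sA sM (\<lambda>x. F (xs[i := x]))"
  using assms by (simp add: multilinear_alternating_from_def)

lemma subspace_MA: "module.subspace (pw_scale sM) (MA p sA sM k)"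
proof -
  interpret P: vector_space "pw_scale sM :: 'k \<Rightarrow> ('a list \<Rightarrow> 'm) \<Rightarrow> _"
    by (rule vector_space_pw_scale[OF M.vector_space_axioms])
  show ?thesis unfolding P.subspace_def
  proof (intro conjI ballI allI)
    show "0 \<in> MA p sA sM k" by (rule MA_I) simp_all
    fix F G c assume F: "F \<in> MA p sA sM k"
    show "pw_scale sM c F \<in> MA p sA sM k"
      by (rule MA_I)
        (simp_all add: pw_scale_def MA_D(1-3)[OF F] M.scale_right_distrib M.scale_left_commute MA_D(4)[OF F])
    assume G: "G \<in> MA p sA sM k"
    show "F + G \<in> MA p sA sM k"
      by (rule MA_I)
        (simp_all add: MA_D(1-3)[OF F] MA_D(1-3)[OF G] M.scale_right_distrib MA_D(4)[OF F] MA_D(4)[OF G])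
  qed
qed

lemma MA_contract:
  assumes "F \<in> MA p sA sM (Suc k)"
  shows "(\<lambda>ys. F (x # ys)) \<in> MA (p - 1) sA sM k"
proof (rule MA_I)
  show "F (x # xs) = 0" if "length xs \<noteq> k" for xs using that MA_D(1)[OF assms, of "x # xs"] by simp
  show "F (x # xs[i := u + v]) = F (x # xs[i := u]) + F (x # xs[i := v])" if "length xs = k" "i < k" for xs i u v
    using that MA_D(2)[OF assms, of "x # xs" "Suc i"] by simp
  show "F (x # xs[i := sA c u]) = sM c (F (x # xs[i := u]))" if "length xs = k" "i < k" for xs i c u
    using that MA_D(3)[OF assms, of "x # xs" "Suc i"] by simp
  show "F (x # xs) = 0" if "length xs = k" "p - 1 \<le> i" "i < j" "j < k" "xs ! i = xs ! j" for xs i j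
    using that MA_D(4)[OF assms, of "x # xs" "Suc i" "Suc j"] by simp
qed

lemma MA_swap:
  assumes "F \<in> MA 0 sA sM k" "length zs + 2 = k"
  shows "F (x # y # zs) = - F (y # x # zs)"
proof -
  have 1: "F ((u + v) # w # zs) = F (u # w # zs) + F (v # w # zs)" for u v w
    using MA_D(2)[OF assms(1), of "u # w # zs" 0 u v] assms(2) by simp
  have 2: "F (w # (u + v) # zs) = F (w # u # zs) + F (w # v # zs)" for u v w
    using MA_D(2)[OF assms(1), of "w # u # zs" 1 u v] assms(2) by simp
  have "F (u # u # zs) = 0" for u
    using MA_D(4)[OF assms(1), of "u # u # zs" 0 1] assms(2) by simp
  from this[of "x + y"] this[of x] this[of y] show ?thesis
    by (simp add: 1 2 eq_neg_iff_add_eq_0 add.commute)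
qed

definition alt :: "nat \<Rightarrow> 'm \<Rightarrow> 'm" where "alt i y = (if even i then y else - y)"

lemma alt_simps [simp]: "alt 0 y = y" "alt (Suc i) y = - alt i y" "alt i (alt i y) = y"
  "alt i (- y) = - alt i y" "alt i 0 = 0"
  by (simp_all add: alt_def)

lemma alt_add: "alt i (x + y) = alt i x + alt i y" "alt i (x - y) = alt i x - alt i y"
  by (simp_all add: alt_def)

text \<open>Contracting with the first argument reduces to a shorter list; one transposition by
  \<open>MA_swap\<close> then brings y to the very front.\<close>

lemma MA_front:
  assumes "F \<in> MA 0 sA sM (length ys)" "p < length ys"
  shows "F (ys[p := y]) = alt p (F (y # omit p ys))"
  using assms
proof (induct p arbitrary: F ys)
  case 0
  then show ?case by (cases ys) (simp_all add: omit_def)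
next
  case (Suc p)
  then obtain x zs where ys: "ys = x # zs" by (cases ys) auto
  have "F (x # zs[p := y]) = alt p (F (x # y # omit p zs))"
    using Suc(1)[of "\<lambda>ys. F (x # ys)" zs] MA_contract[of F 0 "length zs" x] Suc(2,3) ys by simp
  also have "F (x # y # omit p zs) = - F (y # x # omit p zs)"
    using Suc(2,3) ys by (intro MA_swap[of F "length ys"]) (auto simp: omit_def)
  finally show ?case by (simp add: ys omit_def)
qed

end

lemma MA_compose:
  assumes "F \<in> MA p sA sM k" "vector_space sA" "Vector_Spaces.linear sM sN f"
  shows "(\<lambda>xs. f (F xs)) \<in> MA p sA sN k"
proof -
  interpret f: Vector_Spaces.linear sM sN f by fact
  interpret c: cochains sA sM by (intro cochains.intro assms f.vs1.vector_space_axioms)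
  interpret d: cochains sA sN by (intro cochains.intro assms f.vs2.vector_space_axioms)
  show ?thesis
    by (rule d.MA_I) (simp_all add: c.MA_D(1-3)[OF assms(1)] c.MA_D(4)[OF assms(1)] f.add f.scale)
qed

section \<open>The differential\<close>

text \<open>The recursion is Cartan's formula \<open>\<iota>\<^sub>x d + d \<iota>\<^sub>x = \<theta>\<^sub>x\<close>.\<close>

primrec lieD :: "('v \<Rightarrow> 'a \<Rightarrow> 'v) \<Rightarrow> ('a \<Rightarrow> 'a \<Rightarrow> 'a) \<Rightarrow> 'a list \<Rightarrow> ('a list \<Rightarrow> 'v) \<Rightarrow> 'v::ab_group_add" where
  "lieD act br [] F = 0"
| "lieD act br (x # xs) F = act (F xs) x + (\<Sum>j<length xs. F (xs[j := br x (xs ! j)]))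
     - lieD act br xs (\<lambda>ys. F (x # ys))"

lemma omit_simps [simp]: "omit 0 (x # xs) = xs" "omit (Suc i) (x # xs) = x # omit i xs"
  by (simp_all add: omit_def)

text \<open>The bracket stays in slot j instead of being moved to the front, which is the
  arrangement of the right-symmetric differential.\<close>

lemma (in cochains) lieD_explicit:
  "lieD act br xs F = (\<Sum>i<length xs. alt i (act (F (omit i xs)) (xs ! i)))
     + (\<Sum>j<length xs. \<Sum>i<j. alt i (F (omit i (xs[j := br (xs ! i) (xs ! j)]))))"
proof (induct xs arbitrary: F)
  case (Cons x xs)
  show ?case
    by (simp add: Cons sum.lessThan_Suc_shift sum.distrib sum_subtractf sum_negf del: sum.lessThan_Suc)
qed simp

text \<open>Naturality in the coefficients. It is applied to \<open>ev\<close>, to multiplication of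
  scalars with an invariant, and to the maps \<kappa>, \<alpha>, \<beta>.\<close>

lemma lieD_commute:
  assumes "\<And>x y. f (x + y) = f x + f y" "\<And>v x. f (act v x) = act' (f v) x"
  shows "f (lieD act br xs F) = lieD act' br xs (\<lambda>ys. f (F ys))"
proof -
  have 0: "f 0 = 0" using assms(1)[of 0 0] by simp
  have "f (x - y) = f x - f y" for x y
    using assms(1)[of "x - y" y] by (simp add: algebra_simps)
  moreover have "f (\<Sum>i\<in>A. g i) = (\<Sum>i\<in>A. f (g i))" for A :: "nat set" and g
    by (induct A rule: infinite_finite_induct) (simp_all add: assms(1) 0)
  ultimately show ?thesis
    by (induct xs arbitrary: F) (simp_all add: assms 0)
qed

lemma lieD_linear:
  assumes "\<And>x y a. act (x + y) a = act x a + act y a"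
  shows "lieD act br xs (\<lambda>ys. F ys + G ys) = lieD act br xs F + lieD act br xs G"
    "lieD act br xs (\<lambda>ys. - F ys) = - lieD act br xs F"
    "lieD act br xs (\<lambda>_. 0) = 0"
proof -
  show *: "lieD act br xs (\<lambda>ys. F ys + G ys) = lieD act br xs F + lieD act br xs G" for F G
    by (induct xs arbitrary: F G) (simp_all add: assms sum.distrib)
  have "act 0 a = 0" for a using assms[of 0 0 a] by simp
  then show "lieD act br xs (\<lambda>_. 0) = 0" by (induct xs) simp_all
  then show "lieD act br xs (\<lambda>ys. - F ys) = - lieD act br xs F"
    using *[of F "\<lambda>ys. - F ys"] by (simp add: eq_neg_iff_add_eq_0 add.commute)
qed

text \<open>After the omission of entry i the bracket sits in slot j - 1. Moving it to the front
  costs (-1)^(j - 1), which turns (-1)^i into -(-1)^(i + j); hence the overall minus sign.\<close>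

lemma lie_d_eq_lieD:
  fixes \<phi> :: "'a::ab_group_add list \<Rightarrow> 'k::field"
  assumes "vector_space sA" "\<phi> \<in> lie_C sA k"
  shows "lie_d mul k \<phi> xs = (if length xs = Suc k then - lieD (\<lambda>_ _. 0) (commutator mul) xs \<phi> else 0)"
proof (cases "length xs = Suc k")
  case True
  interpret cochains sA "(*) :: 'k \<Rightarrow> 'k \<Rightarrow> 'k"
    by (intro cochains.intro assms vector_space_times)
  have "(- 1) ^ (i + j) * \<phi> (y # omit i (omit j xs)) = - alt i (\<phi> (omit i (xs[j := y])))"
    if ij: "i < j" "j \<le> k" for i j y
  proof -
    obtain j' where j': "j = Suc j'" using ij by (cases j) auto
    let ?ys = "omit i xs"
    have len: "length ?ys = k" using True ij by (simp add: omit_def)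
    have eq: "omit i (xs[j := y]) = ?ys[j' := y]" "omit j' ?ys = omit i (omit j xs)"
      using ij True unfolding j'
      by (auto simp: omit_def list_eq_iff_nth_eq nth_append nth_list_update)
    have "\<phi> (?ys[j' := y]) = alt j' (\<phi> (y # omit j' ?ys))"
      using assms(2) ij j' len by (intro MA_front) (simp_all add: lie_C_def)
    then show ?thesis unfolding eq by (simp add: alt_def j')
  qed
  then have "lie_d mul k \<phi> xs = (\<Sum>j\<le>k. \<Sum>i<j. - alt i (\<phi> (omit i (xs[j := commutator mul (xs ! i) (xs ! j)]))))"
    using True by (simp add: lie_d_def)
  then show ?thesis
    using True by (simp add: lieD_explicit sum_negf lessThan_Suc_atMost)
qed (simp add: lie_d_def)

text \<open>Dropping a_0 shifts positions by one, so (-1)^(i + 1) becomes (-1)^i, and the terms then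
  match one by one.\<close>

lemma rsym_d_eq_lieD:
  fixes sM :: "'k::field \<Rightarrow> 'm::ab_group_add \<Rightarrow> 'm" and mul :: "'a::ab_group_add \<Rightarrow> 'a \<Rightarrow> 'a"
  assumes "vector_space sM" "length xs = k" "k > 0"
  shows "rsym_d mul sM l r k \<psi> (a # xs) =
    lieD (\<lambda>f b a. l a (f b) - f (mul a b) + r (f a) b) (commutator mul) xs (\<lambda>ys a. \<psi> (a # ys)) a"
proof -
  interpret P: vector_space "pw_scale sM :: 'k \<Rightarrow> ('a \<Rightarrow> 'm) \<Rightarrow> _"
    by (rule vector_space_pw_scale[OF assms(1)])
  interpret M: vector_space sM by fact
  \<comment> \<open>Only \<open>alt\<close> and \<open>lieD_explicit\<close> are wanted, which
    concern the target space; the field stands in for the source.\<close>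
  interpret cochains "(*) :: 'k \<Rightarrow> 'k \<Rightarrow> 'k" "pw_scale sM :: 'k \<Rightarrow> ('a \<Rightarrow> 'm) \<Rightarrow> _"
    by (intro cochains.intro P.vector_space_axioms vector_space_times)
  have alt: "alt i f a = sM ((- 1) ^ i) (f a)" for i f
    by (simp add: alt_def)
  have s1: "(\<Sum>i = 1..<Suc j. f i) = (\<Sum>i<j. f (Suc i))" for j and f :: "nat \<Rightarrow> 'm"
    by (simp add: atLeastLessThanSuc_atLeastAtMost sum.atLeast1_atMost_eq del: sum.op_ivl_Suc)
  have s2: "(\<Sum>i = 1..k. f i) = (\<Sum>i<k. f (Suc i))" for f :: "nat \<Rightarrow> 'm"
    by (simp add: sum.atLeast1_atMost_eq)
  have sign: "(- 1) ^ (i + 1) = - ((- 1 :: 'k) ^ i)" for i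
    by simp
  show ?thesis
    using assms(2,3)
    by (simp add: rsym_d_def lieD_explicit sum_fun_app alt s1 s2 sign
      del: sum.op_ivl_Suc One_nat_def)
qed

context cochains
begin

lemma MA_0: "(\<lambda>_. 0) \<in> MA p sA sM k"
  by (rule MA_I) simp_all

lemma MA_add: "F \<in> MA p sA sM k \<Longrightarrow> G \<in> MA p sA sM k \<Longrightarrow> (\<lambda>xs. F xs + G xs) \<in> MA p sA sM k"
  by (rule MA_I) (simp_all add: MA_D(1-3) M.scale_right_distrib MA_D(4))

lemma MA_minus: "F \<in> MA p sA sM k \<Longrightarrow> (\<lambda>xs. - F xs) \<in> MA p sA sM k"
  by (rule MA_I) (simp_all add: MA_D(1-3) MA_D(4))

lemma MA_sum:
  assumes "\<And>i. i \<in> I \<Longrightarrow> F i \<in> MA p sA sM k"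
  shows "(\<lambda>xs. \<Sum>i\<in>I. F i xs) \<in> MA p sA sM k"
  using assms by (induct I rule: infinite_finite_induct) (simp_all add: MA_0 MA_add)

end

section \<open>The Casimir tensor\<close>

lemma sum_unit_mat_mult:
  "(\<Sum>h\<in>UNIV. mat_scale (x $ j $ h) (unit_mat i h)) = unit_mat i j ** (x :: 'k::field^'n^'n)"
  "(\<Sum>h\<in>UNIV. mat_scale (x $ h $ i) (unit_mat h j)) = (x :: 'k::field^'n^'n) ** unit_mat i j"
proof -
  have "(\<Sum>h\<in>UNIV. x $ j $ h * (if a = i \<and> b = h then 1 else 0)) =
      (\<Sum>h\<in>UNIV. (if a = i \<and> h = j then 1 else 0) * x $ h $ b)" for a b
  proof -
    have "x $ j $ h * (if a = i \<and> b = h then 1 else 0) = (if h = b then if a = i then x $ j $ h else 0 else 0)"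
      "(if a = i \<and> h = j then 1 else 0) * x $ h $ b = (if h = j then if a = i then x $ h $ b else 0 else 0)" for h
      by auto
    then show ?thesis by simp
  qed
  then show "(\<Sum>h\<in>UNIV. mat_scale (x $ j $ h) (unit_mat i h)) = unit_mat i j ** x"
    by (simp add: vec_eq_iff mat_scale_def unit_mat_def matrix_matrix_mult_def)
  have "(\<Sum>h\<in>UNIV. x $ h $ i * (if a = h \<and> b = j then 1 else 0)) =
      (\<Sum>h\<in>UNIV. x $ a $ h * (if h = i \<and> b = j then 1 else 0))" for a b
  proof -
    have "x $ h $ i * (if a = h \<and> b = j then 1 else 0) = (if h = a then if b = j then x $ h $ i else 0 else 0)"
      "x $ a $ h * (if h = i \<and> b = j then 1 else 0) = (if h = i then if b = j then x $ a $ h else 0 else 0)" for h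
      by auto
    then show ?thesis by simp
  qed
  then show "(\<Sum>h\<in>UNIV. mat_scale (x $ h $ i) (unit_mat h j)) = x ** unit_mat i j"
    by (simp add: vec_eq_iff mat_scale_def unit_mat_def matrix_matrix_mult_def)
qed

text \<open>Ad-invariance of \<Sum> E_ij \<otimes> E_ji, tested by a bilinear map: \<Sum> E_ij x
  \<otimes> E_ji = \<Sum> E_ij \<otimes> x E_ji, and likewise with x on the other sides.\<close>

lemma casimir_tensor_invariant:
  fixes x :: "'k::field^'n^'n"
  assumes l1: "\<And>b. Vector_Spaces.linear mat_scale s (\<lambda>a. \<beta> a b)"
    and l2: "\<And>a. Vector_Spaces.linear mat_scale s (\<beta> a)"
  shows "(\<Sum>i\<in>UNIV. \<Sum>j\<in>UNIV. \<beta> (commutator (**) (unit_mat i j) x) (unit_mat j i)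
    + \<beta> (unit_mat i j) (commutator (**) (unit_mat j i) x)) = 0"
proof -
  let ?S = "\<lambda>f. \<Sum>i\<in>UNIV. \<Sum>j\<in>UNIV. f i j"
  have "?S (\<lambda>i j. \<beta> (unit_mat i j ** x) (unit_mat j i)) =
      (\<Sum>i\<in>UNIV. \<Sum>j\<in>UNIV. \<Sum>h\<in>UNIV. s (x $ j $ h) (\<beta> (unit_mat i h) (unit_mat j i)))"
    unfolding sum_unit_mat_mult(1)[symmetric] by (simp add: linearD[OF l1])
  also have "\<dots> = (\<Sum>i\<in>UNIV. \<Sum>h\<in>UNIV. \<Sum>j\<in>UNIV. s (x $ j $ h) (\<beta> (unit_mat i h) (unit_mat j i)))"
    by (intro sum.cong refl sum.swap)
  also have "\<dots> = ?S (\<lambda>i j. \<beta> (unit_mat i j) (x ** unit_mat j i))"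
    unfolding sum_unit_mat_mult(2)[symmetric] by (simp add: linearD[OF l2])
  finally have 1: "?S (\<lambda>i j. \<beta> (unit_mat i j ** x) (unit_mat j i)) = ?S (\<lambda>i j. \<beta> (unit_mat i j) (x ** unit_mat j i))" .
  have "?S (\<lambda>i j. \<beta> (x ** unit_mat i j) (unit_mat j i)) =
      (\<Sum>i\<in>UNIV. \<Sum>j\<in>UNIV. \<Sum>h\<in>UNIV. s (x $ h $ i) (\<beta> (unit_mat h j) (unit_mat j i)))"
    unfolding sum_unit_mat_mult(2)[symmetric] by (simp add: linearD[OF l1])
  also have "\<dots> = (\<Sum>j\<in>UNIV. \<Sum>i\<in>UNIV. \<Sum>h\<in>UNIV. s (x $ h $ i) (\<beta> (unit_mat h j) (unit_mat j i)))"
    by (rule sum.swap)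
  also have "\<dots> = (\<Sum>j\<in>UNIV. \<Sum>h\<in>UNIV. \<Sum>i\<in>UNIV. s (x $ h $ i) (\<beta> (unit_mat h j) (unit_mat j i)))"
    by (intro sum.cong refl sum.swap)
  also have "\<dots> = (\<Sum>h\<in>UNIV. \<Sum>j\<in>UNIV. \<Sum>i\<in>UNIV. s (x $ h $ i) (\<beta> (unit_mat h j) (unit_mat j i)))"
    by (rule sum.swap)
  also have "\<dots> = ?S (\<lambda>i j. \<beta> (unit_mat i j) (unit_mat j i ** x))"
    unfolding sum_unit_mat_mult(1)[symmetric] by (simp add: linearD[OF l2])
  finally have 2: "?S (\<lambda>i j. \<beta> (x ** unit_mat i j) (unit_mat j i)) = ?S (\<lambda>i j. \<beta> (unit_mat i j) (unit_mat j i ** x))" .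
  show ?thesis
    by (simp add: commutator_def linearD(5)[OF l1] linearD(5)[OF l2] sum.distrib sum_subtractf 1 2)
qed

section \<open>Homotopies for the identity matrix and the Casimir element\<close>

context gl_bimodule
begin

sublocale VC: cochains mat_scale sV
  by (intro cochains.intro vector_space_mat_scale V.vector_space_axioms)

sublocale MC: cochains mat_scale sM
  by (intro cochains.intro vector_space_mat_scale vector_space_axioms)

abbreviation "br \<equiv> commutator ((**) :: 'k^'n^'n \<Rightarrow> _)"
abbreviation "D \<equiv> lieD act br"
abbreviation "C \<equiv> MA 0 mat_scale sV"

lemma act_MA: "F \<in> C k \<Longrightarrow> (\<lambda>xs. act (F xs) a) \<in> C k"
  by (rule MA_compose[OF _ vector_space_mat_scale act_linear_left])

lemma cartan: "act (F xs) x + (\<Sum>j<length xs. F (xs[j := br x (xs ! j)])) = D (x # xs) F + D xs (\<lambda>ys. F (x # ys))"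
  by simp

text \<open>Cartan's formula at x = 1: brackets with the identity vanish and F is closed, so the
  action of the identity is D of the contraction. The sign comes from
  \<open>central_act\<close>.\<close>

lemma central_exact:
  assumes "F \<in> C (length xs)" "D (mat 1 # xs) F = 0"
  shows "central (F xs) = D xs (\<lambda>ys. - F (mat 1 # ys))"
proof -
  have "F (xs[j := br (mat 1) (xs ! j)]) = 0" if "j < length xs" for j
    using VC.MA_D(2)[OF assms(1) refl that, of 0 0]
    by (simp add: commutator_def matrix_mul_lid matrix_mul_rid)
  then have "act (F xs) (mat 1) = D xs (\<lambda>ys. F (mat 1 # ys))"
    using cartan[of F xs "mat 1"] assms(2) by simp
  then show ?thesis by (simp add: central_act lieD_linear(2) act_simps)
qed

text \<open>The homotopy for \<Omega>: contract with one leg of the Casimir tensor and act by the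
  other.\<close>

definition casimir_contraction :: "(('k^'n^'n) list \<Rightarrow> 'n \<Rightarrow> 'n \<Rightarrow> 'm) \<Rightarrow> ('k^'n^'n) list \<Rightarrow> 'n \<Rightarrow> 'n \<Rightarrow> 'm" where
  "casimir_contraction F ys = (\<Sum>i\<in>UNIV. \<Sum>j\<in>UNIV. act (F (unit_mat i j # ys)) (unit_mat j i))"

lemma casimir_contraction_MA: "F \<in> C (Suc k) \<Longrightarrow> casimir_contraction F \<in> C k"
  unfolding casimir_contraction_def[abs_def]
  using VC.MA_contract[of F 0 k] by (intro VC.MA_sum act_MA) simp

text \<open>Acting by a fixed y is not equivariant, so \<open>D\<close> passes it only up to the
  brackets [y, x_i], which come from \<open>act_bracket\<close>.\<close>

lemma D_act:
  "D xs (\<lambda>ys. act (G ys) y) = act (D xs G) y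
     + (\<Sum>i<length xs. VC.alt i (act (G (omit i xs)) (br y (xs ! i))))"
proof -
  have "act (act v y) z = act (act v z) y + act v (br y z)" for v z
    by (simp add: commutator_def act_bracket)
  moreover have "act (VC.alt i v) y = VC.alt i (act v y)" for i v
    by (simp add: VC.alt_def act_simps)
  ultimately show ?thesis
    by (simp add: VC.lieD_explicit act_simps VC.alt_add sum.distrib)
qed

lemma D_sum: "D xs (\<lambda>ys. \<Sum>i\<in>I. G i ys) = (\<Sum>i\<in>I. D xs (G i))"
proof (induct I rule: infinite_finite_induct)
  case (insert i I)
  have "D xs (\<lambda>ys. G i ys + (\<Sum>i\<in>I. G i ys)) = D xs (G i) + D xs (\<lambda>ys. \<Sum>i\<in>I. G i ys)"
    by (rule lieD_linear(1)) (rule act_simps(7))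
  then show ?case using insert by (simp only: sum.insert[OF insert(1,2)])
next
  case (infinite I)
  then show ?case by (simp only: sum.infinite[OF infinite] lieD_linear(3)[of act, OF act_simps(7)])
qed (simp only: sum.empty lieD_linear(3)[of act, OF act_simps(7)])

text \<open>Cartan's formula evaluates D of the contraction by E_ij: it gives the double action,
  which sums to \<open>casimir\<close>, and terms with E_ij bracketed with an entry.
  \<open>D_act\<close> adds those with E_ji bracketed. In each slot p both kinds together are the
  adjoint action on the Casimir tensor, which is zero.\<close>

lemma casimir_exact:
  assumes "F \<in> C (length xs)" "\<And>x. D (x # xs) F = 0"
  shows "casimir (F xs) = D xs (casimir_contraction F)"
proof -
  let ?S = "\<lambda>f. \<Sum>i\<in>UNIV. \<Sum>j\<in>UNIV. f i j"
  let ?E = "unit_mat :: 'n \<Rightarrow> 'n \<Rightarrow> 'k^'n^'n"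
  let ?n = "length xs"
  have "D xs (\<lambda>ys. act (F (?E i j # ys)) (?E j i)) = act (act (F xs) (?E i j)) (?E j i)
      + (\<Sum>p<?n. act (F (xs[p := br (?E i j) (xs ! p)])) (?E j i)
          + act (F (xs[p := ?E i j])) (br (?E j i) (xs ! p)))" for i j
  proof -
    have "D xs (\<lambda>ys. F (?E i j # ys)) = act (F xs) (?E i j) + (\<Sum>p<?n. F (xs[p := br (?E i j) (xs ! p)]))"
      using cartan[of F xs "?E i j"] assms(2) by simp
    moreover have "VC.alt p (act (F (?E i j # omit p xs)) z) = act (F (xs[p := ?E i j])) z" if "p < ?n" for p z
      by (simp add: VC.MA_front[OF assms(1) that] VC.alt_def act_simps)
    ultimately show ?thesis
      by (simp add: D_act act_simps sum.distrib)
  qed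
  then have "D xs (casimir_contraction F) = ?S (\<lambda>i j. act (act (F xs) (?E i j)) (?E j i))
      + ?S (\<lambda>i j. \<Sum>p<?n. act (F (xs[p := br (?E i j) (xs ! p)])) (?E j i)
          + act (F (xs[p := ?E i j])) (br (?E j i) (xs ! p)))"
    unfolding casimir_contraction_def[abs_def] by (simp add: D_sum sum.distrib)
  also have "?S (\<lambda>i j. \<Sum>p<?n. act (F (xs[p := br (?E i j) (xs ! p)])) (?E j i)
          + act (F (xs[p := ?E i j])) (br (?E j i) (xs ! p))) =
      (\<Sum>p<?n. ?S (\<lambda>i j. act (F (xs[p := br (?E i j) (xs ! p)])) (?E j i)
          + act (F (xs[p := ?E i j])) (br (?E j i) (xs ! p))))"
    by (subst sum.swap, subst (2) sum.swap) (rule refl)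
  also have "\<dots> = 0"
  proof (rule sum.neutral, rule ballI)
    fix p assume "p \<in> {..<?n}"
    then have F: "Vector_Spaces.linear mat_scale sV (\<lambda>a. F (xs[p := a]))"
      using assms(1) by (intro VC.MA_linear) auto
    show "?S (\<lambda>i j. act (F (xs[p := br (?E i j) (xs ! p)])) (?E j i)
        + act (F (xs[p := ?E i j])) (br (?E j i) (xs ! p))) = 0"
    proof (rule casimir_tensor_invariant[where s = sV])
      show "Vector_Spaces.linear mat_scale sV (\<lambda>a. act (F (xs[p := a])) b)" for b
        by (intro linearI_vs vector_space_mat_scale V.vector_space_axioms)
          (simp_all add: linearD[OF F] act_simps)
      show "Vector_Spaces.linear mat_scale sV (act (F (xs[p := a])))" for a
        by (rule act_linear)
    qed
  qed
  also have "?S (\<lambda>i j. act (act (F xs) (?E i j)) (?E j i)) = casimir (F xs)"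
    unfolding casimir_def by (subst sum.swap) (simp add: op_def act_simps)
  finally show ?thesis by simp
qed

end

section \<open>The right-symmetric complex as the Lie complex with values in V\<close>

lemma lie_Z_iff:
  fixes \<phi> :: "'a::ab_group_add list \<Rightarrow> 'k::field"
  assumes "vector_space sA"
  shows "\<phi> \<in> lie_Z sA mul k \<longleftrightarrow> \<phi> \<in> MA 0 sA (*) k \<and>
    (\<forall>xs. length xs = Suc k \<longrightarrow> lieD (\<lambda>_ _. 0) (commutator mul) xs \<phi> = 0)"
proof -
  have "lie_d mul k \<phi> = 0 \<longleftrightarrow> (\<forall>xs. length xs = Suc k \<longrightarrow> lieD (\<lambda>_ _. 0) (commutator mul) xs \<phi> = 0)"
    if "\<phi> \<in> lie_C sA k"
    by (simp add: fun_eq_iff lie_d_eq_lieD[OF assms that])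
  then show ?thesis by (auto simp: lie_Z_def lie_C_def)
qed

lemma if_fun_eq: "(\<lambda>x. if P x then f x else z) = (\<lambda>_. z) \<longleftrightarrow> (\<forall>x. P x \<longrightarrow> f x = z)"
  by (simp add: fun_eq_iff)

context gl_bimodule
begin

definition of_lie_cochain :: "(('k^'n^'n) list \<Rightarrow> 'n \<Rightarrow> 'n \<Rightarrow> 'm) \<Rightarrow> ('k^'n^'n) list \<Rightarrow> 'm" where
  "of_lie_cochain F xs = (case xs of [] \<Rightarrow> 0 | a # ys \<Rightarrow> ev (F ys) a)"

lemma of_lie_cochain_simps [simp]: "of_lie_cochain F [] = 0" "of_lie_cochain F (a # ys) = ev (F ys) a"
  by (simp_all add: of_lie_cochain_def)

lemma of_lie_cochain_MA:
  assumes "F \<in> C k"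
  shows "of_lie_cochain F \<in> MA 1 mat_scale sM (Suc k)"
proof (rule MC.MA_I)
  note F = VC.MA_D[OF assms]
  show "of_lie_cochain F xs = 0" if "length xs \<noteq> Suc k" for xs
    using that by (cases xs) (simp_all add: F(1) ev_simps)
  show "of_lie_cochain F (xs[i := x + y]) = of_lie_cochain F (xs[i := x]) + of_lie_cochain F (xs[i := y])"
    if "length xs = Suc k" "i < Suc k" for xs i x y
    using that by (cases xs; cases i) (simp_all add: F(2) ev_simps)
  show "of_lie_cochain F (xs[i := mat_scale c x]) = sM c (of_lie_cochain F (xs[i := x]))"
    if "length xs = Suc k" "i < Suc k" for xs i c x
    using that by (cases xs; cases i) (simp_all add: F(3) ev_simps)
  show "of_lie_cochain F xs = 0"
    if "length xs = Suc k" "1 \<le> i" "i < j" "j < Suc k" "xs ! i = xs ! j" for xs i j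
    using that F(4)[of "tl xs" "i - 1" "j - 1"]
    by (cases xs; cases i; cases j) (simp_all add: ev_simps)
qed

lemma of_lie_cochain_surj:
  assumes "\<psi> \<in> MA 1 mat_scale sM (Suc k)"
  obtains F where "F \<in> C k" "\<psi> = of_lie_cochain F"
proof
  note \<psi> = MC.MA_D[OF assms]
  let ?F = "\<lambda>ys i j. \<psi> (unit_mat i j # ys)"
  show "?F \<in> C k"
  proof (rule VC.MA_I)
    show "?F xs = 0" if "length xs \<noteq> k" for xs
      using that by (simp add: \<psi>(1) fun_eq_iff)
    show "?F (xs[i := x + y]) = ?F (xs[i := x]) + ?F (xs[i := y])" if "length xs = k" "i < k" for xs i x y
      using that \<psi>(2)[of "_ # xs" "Suc i"] by (simp add: fun_eq_iff)
    show "?F (xs[i := mat_scale c x]) = sV c (?F (xs[i := x]))" if "length xs = k" "i < k" for xs i c x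
      using that \<psi>(3)[of "_ # xs" "Suc i"] by (simp add: fun_eq_iff pw_scale_def)
    show "?F xs = 0" if "length xs = k" "0 \<le> i" "i < j" "j < k" "xs ! i = xs ! j" for xs i j
      using that \<psi>(4)[of "_ # xs" "Suc i" "Suc j"] by (simp add: fun_eq_iff)
  qed
  show "\<psi> = of_lie_cochain ?F"
  proof
    fix xs
    show "\<psi> xs = of_lie_cochain ?F xs"
    proof (cases xs)
      case Nil
      then show ?thesis by (simp add: \<psi>(1))
    next
      case (Cons a ys)
      have lin: "Vector_Spaces.linear mat_scale sM (\<lambda>a. \<psi> (a # ys))"
      proof (cases "length ys = k")
        case True
        then show ?thesis using MC.MA_linear[OF assms, of "a # ys" 0] by simp
      next
        case False
        then show ?thesis
          by (intro linearI_vs vector_space_mat_scale vector_space_axioms) (simp_all add: \<psi>(1))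
      qed
      show ?thesis unfolding Cons by (simp add: ev_unique[OF lin])
    qed
  qed
qed

lemma ev_eq_iff: "(\<forall>a. ev v a = ev w a) \<longleftrightarrow> v = w"
  by (metis ev_unit_mat ext)

text \<open>\<open>ev\<close> intertwines \<open>act\<close> with \<open>hom_act\<close>, so
  naturality applies. The case distinction on the length is there because \<open>D\<close> is not
  confined to one degree.\<close>

lemma rsym_d_unhat:
  assumes "k > 0"
  shows "rsym_d (**) sM l r k (of_lie_cochain F) = of_lie_cochain (\<lambda>xs. if length xs = k then D xs F else 0)"
proof
  fix xs
  show "rsym_d (**) sM l r k (of_lie_cochain F) xs = of_lie_cochain (\<lambda>xs. if length xs = k then D xs F else 0) xs"
  proof (cases "length xs = Suc k")
    case False
    then show ?thesis by (cases xs) (auto simp: rsym_d_def ev_simps)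
  next
    case True
    then obtain a ys where xs: "xs = a # ys" and ys: "length ys = k" by (cases xs) auto
    have "rsym_d (**) sM l r k (of_lie_cochain F) xs = lieD hom_act br ys (\<lambda>ys. ev (F ys)) a"
      using rsym_d_eq_lieD[OF vector_space_axioms ys assms]
      by (simp add: xs hom_act_def[abs_def])
    also have "lieD hom_act br ys (\<lambda>ys. ev (F ys)) = ev (D ys F)"
      by (rule lieD_commute[of ev act hom_act, symmetric]) (simp_all add: fun_eq_iff ev_simps ev_act)
    finally show ?thesis by (simp add: xs ys)
  qed
qed

lemma of_lie_cochain_eq_iff: "of_lie_cochain F = of_lie_cochain G \<longleftrightarrow> F = G"
proof
  assume eq: "of_lie_cochain F = of_lie_cochain G"
  have "ev (F ys) a = ev (G ys) a" for ys a
    using fun_cong[OF eq, of "a # ys"] by simp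
  then show "F = G" using ev_eq_iff by blast
qed simp

lemma of_lie_cochain_0: "of_lie_cochain (\<lambda>_. 0) = 0"
  by (auto simp: fun_eq_iff of_lie_cochain_def ev_simps split: list.split)

lemma of_lie_cochain_diff: "of_lie_cochain (\<lambda>xs. F xs - G xs) = of_lie_cochain F - of_lie_cochain G"
proof
  show "of_lie_cochain (\<lambda>xs. F xs - G xs) xs = (of_lie_cochain F - of_lie_cochain G) xs" for xs
    by (cases xs) (simp_all only: of_lie_cochain_simps minus_apply ev_simps diff_self)
qed

lemma rsym_C_eq: "rsym_C mat_scale (**) sM r (Suc k) = of_lie_cochain ` C k"
proof
  show "rsym_C mat_scale (**) sM r (Suc k) \<subseteq> of_lie_cochain ` C k"
    unfolding rsym_C_def nat.case by (rule subsetI, erule of_lie_cochain_surj) blast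
  show "of_lie_cochain ` C k \<subseteq> rsym_C mat_scale (**) sM r (Suc k)"
    unfolding rsym_C_def nat.case by (rule image_subsetI) (rule of_lie_cochain_MA)
qed

lemma rsym_Z_iff:
  "\<psi> \<in> rsym_Z mat_scale (**) sM l r (Suc k) \<longleftrightarrow>
    (\<exists>F. \<psi> = of_lie_cochain F \<and> F \<in> C k \<and> (\<forall>xs. length xs = Suc k \<longrightarrow> D xs F = 0))"
proof -
  have "rsym_d (**) sM l r (Suc k) (of_lie_cochain F) = 0 \<longleftrightarrow> (\<forall>xs. length xs = Suc k \<longrightarrow> D xs F = 0)" for F
    unfolding rsym_d_unhat[OF zero_less_Suc] of_lie_cochain_0[symmetric] of_lie_cochain_eq_iff by (rule if_fun_eq)
  then show ?thesis unfolding rsym_Z_def rsym_C_eq by blast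
qed

text \<open>From degree 2 on, the cochains one degree below are all of the V-valued Lie cochains.
  Degree 1 differs, as \<open>rsym_C\<close> in degree 0 is cut out by an equation; this is where k
  > 0 enters.\<close>

lemma rsym_B_iff:
  "\<psi> \<in> rsym_B mat_scale (**) sM l r (Suc (Suc k)) \<longleftrightarrow>
    (\<exists>F\<in>C k. \<psi> = of_lie_cochain (\<lambda>xs. if length xs = Suc k then D xs F else 0))"
proof -
  have "rsym_B mat_scale (**) sM l r (Suc (Suc k)) =
      (\<lambda>F. of_lie_cochain (\<lambda>xs. if length xs = Suc k then D xs F else 0)) ` C k"
    by (simp only: rsym_B_def rsym_C_eq nat.case image_image rsym_d_unhat[OF zero_less_Suc])
  then show ?thesis by blast
qed

definition invariants :: "('n \<Rightarrow> 'n \<Rightarrow> 'm) set" where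
  "invariants = {v. \<forall>x. act v x = 0}"

definition derivation :: "('n \<Rightarrow> 'n \<Rightarrow> 'm) \<Rightarrow> ('k^'n^'n) list \<Rightarrow> 'm" where
  "derivation v = of_lie_cochain (\<lambda>xs. if xs = [] then v else 0)"

lemma rsym_Z1: "rsym_Z mat_scale (**) sM l r 1 = derivation ` invariants"
proof (intro set_eqI iffI)
  have D1: "D [x] F = act (F []) x" for x F by simp
  fix \<psi>
  show "\<psi> \<in> derivation ` invariants" if "\<psi> \<in> rsym_Z mat_scale (**) sM l r 1"
  proof -
    from that obtain F where F: "\<psi> = of_lie_cochain F" "F \<in> C 0" "\<And>xs. length xs = Suc 0 \<Longrightarrow> D xs F = 0"
      unfolding One_nat_def rsym_Z_iff by blast
    have "F [] \<in> invariants" using F(3)[of "[_]"] by (simp only: D1 invariants_def) simp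
    moreover have "F = (\<lambda>xs. if xs = [] then F [] else 0)"
      using VC.MA_D(1)[OF F(2)] by (simp only: fun_eq_iff length_0_conv) (metis)
    then have "\<psi> = derivation (F [])" unfolding F(1) derivation_def by (rule arg_cong)
    ultimately show ?thesis by blast
  qed
  show "\<psi> \<in> rsym_Z mat_scale (**) sM l r 1" if \<psi>: "\<psi> \<in> derivation ` invariants"
  proof -
    from \<psi> obtain v where v: "v \<in> invariants" "\<psi> = derivation v" by blast
    let ?F = "\<lambda>xs. if xs = [] then v else 0"
    have "?F \<in> C 0" by (rule VC.MA_I) auto
    moreover have "D xs ?F = 0" if len: "length xs = Suc 0" for xs
    proof -
      obtain x where xs: "xs = [x]" using len by (auto simp: length_Suc_conv)
      show ?thesis using v(1) by (simp only: xs D1 invariants_def) simp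
    qed
    ultimately show ?thesis unfolding One_nat_def rsym_Z_iff v(2) derivation_def by blast
  qed
qed

lemma cup_derivation: "cup sM (derivation v) \<phi> = of_lie_cochain (\<lambda>ys. sV (\<phi> ys) v)"
  by (auto simp: fun_eq_iff cup_def of_lie_cochain_def derivation_def ev_simps split: list.split)

text \<open>For invariant v the map c \<mapsto> c v from the trivial module is equivariant.\<close>

lemma D_cup:
  assumes "v \<in> invariants"
  shows "D xs (\<lambda>ys. sV (\<phi> ys) v) = sV (lieD (\<lambda>_ _. 0) br xs \<phi>) v"
proof (rule lieD_commute[of "\<lambda>c. sV c v" "\<lambda>_ _. 0" act, symmetric])
  show "sV 0 v = act (sV c v) x" for c x
    using assms by (simp only: act_simps invariants_def mem_Collect_eq V.scale_zero_left V.scale_zero_right)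
qed (rule V.scale_left_distrib)

lemma cup_MA: "\<phi> \<in> MA 0 mat_scale (*) k \<Longrightarrow> (\<lambda>ys. sV (\<phi> ys) v) \<in> C k"
proof (rule MA_compose[where sM = "(*)" and f = "\<lambda>c. sV c v"])
  show "Vector_Spaces.linear (*) sV (\<lambda>c. sV c v)"
  proof (rule linearI_vs)
    show "sV (x + y) v = sV x v + sV y v" for x y by (rule V.scale_left_distrib)
    show "sV (c * x) v = sV c (sV x v)" for c x by (rule V.scale_scale[symmetric])
  qed (rule vector_space_times V.vector_space_axioms)+
qed (assumption, rule vector_space_mat_scale)

lemma cup_in_Z:
  assumes "\<psi> \<in> rsym_Z mat_scale (**) sM l r 1" "\<phi> \<in> lie_Z mat_scale (**) k"
  shows "cup sM \<psi> \<phi> \<in> rsym_Z mat_scale (**) sM l r (Suc k)"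
proof -
  obtain v where v: "v \<in> invariants" "\<psi> = derivation v" using assms(1) rsym_Z1 by blast
  have \<phi>: "\<phi> \<in> MA 0 mat_scale (*) k" "\<And>xs. length xs = Suc k \<Longrightarrow> lieD (\<lambda>_ _. 0) br xs \<phi> = 0"
    using assms(2) unfolding lie_Z_iff[OF vector_space_mat_scale] by blast+
  have "\<forall>xs. length xs = Suc k \<longrightarrow> D xs (\<lambda>ys. sV (\<phi> ys) v) = 0"
    unfolding D_cup[OF v(1)] by (intro allI impI) (simp only: \<phi>(2) V.scale_zero_left)
  with cup_MA[OF \<phi>(1)] show ?thesis
    unfolding rsym_Z_iff v(2) cup_derivation by blast
qed

lemma cup_in_B:
  assumes "\<psi> \<in> rsym_Z mat_scale (**) sM l r 1" "\<phi> \<in> lie_B mat_scale (**) k" "k > 0"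
  shows "cup sM \<psi> \<phi> \<in> rsym_B mat_scale (**) sM l r (Suc k)"
proof -
  obtain v where v: "v \<in> invariants" "\<psi> = derivation v" using assms(1) rsym_Z1 by blast
  obtain k' where k: "k = Suc k'" using assms(3) by (cases k) auto
  obtain \<theta> where \<theta>: "\<theta> \<in> lie_C mat_scale k'" "\<phi> = lie_d (**) k' \<theta>"
    using assms(2) by (auto simp: lie_B_def k)
  \<comment> \<open>The minus sign compensates the one in \<open>lie_d_eq_lieD\<close>.\<close>
  let ?F = "\<lambda>ys. - sV (\<theta> ys) v"
  have "?F \<in> C k'" using \<theta>(1) by (intro VC.MA_minus cup_MA) (simp add: lie_C_def)
  moreover have "(\<lambda>xs. sV (\<phi> xs) v) = (\<lambda>xs. if length xs = Suc k' then D xs ?F else 0)"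
  proof
    fix xs
    have DF: "D xs ?F = - sV (lieD (\<lambda>_ _. 0) br xs \<theta>) v"
      by (simp only: lieD_linear(2)[of act, OF act_simps(7)] D_cup[OF v(1)])
    show "sV (\<phi> xs) v = (if length xs = Suc k' then D xs ?F else 0)"
      unfolding \<theta>(2) lie_d_eq_lieD[OF vector_space_mat_scale \<theta>(1)] DF
      by (cases "length xs = Suc k'")
        (simp_all only: simp_thms if_True if_False V.scale_minus_left V.scale_zero_left)
  qed
  ultimately show ?thesis unfolding k rsym_B_iff v(2) cup_derivation
    by (intro bexI[of _ ?F] arg_cong[of _ _ of_lie_cochain])
qed

lemma sum_cup: "(\<Sum>b\<in>I. cup sM (derivation b) (\<phi> b)) = of_lie_cochain (\<lambda>ys. \<Sum>b\<in>I. sV (\<phi> b ys) b)"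
  by (simp add: fun_eq_iff sum_fun_app[of _ I] cup_derivation of_lie_cochain_def ev_simps split: list.split)

end

section \<open>Decomposition of classes along a basis of the invariants\<close>

locale gl_bimodule_semisimple = gl_bimodule sM B l r
  for sM :: "'k::field_char_0 \<Rightarrow> 'm::ab_group_add \<Rightarrow> 'm" and B
    and l :: "'k^'n^'n \<Rightarrow> 'm \<Rightarrow> 'm" and r :: "'m \<Rightarrow> 'k^'n^'n \<Rightarrow> 'm" +
  assumes central_semisimple: "central (central v) = 0 \<Longrightarrow> central v = 0"
begin

text \<open>A basis of the invariants splits \<pi> into functionals \<open>\<kappa> b\<close> that
  vanish on the image of the action. They are equivariant maps to the trivial module, so they carry
  V-valued cocycles to scalar ones.\<close>

theorem invariant_coordinates:
  obtains I \<kappa> \<alpha> \<beta> where "finite I" "I \<subseteq> invariants"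
    "\<And>b. Vector_Spaces.linear sV (*) (\<kappa> b)"
    "\<And>b v x. \<kappa> b (act v x) = 0"
    "\<And>v. v \<in> invariants \<Longrightarrow> v = (\<Sum>b\<in>I. sV (\<kappa> b v) b)"
    "\<And>b b'. b \<in> I \<Longrightarrow> b' \<in> I \<Longrightarrow> \<kappa> b b' = (if b = b' then 1 else 0)"
    "Vector_Spaces.linear sV sV \<alpha>" "Vector_Spaces.linear sV sV \<beta>"
    "\<And>v x. \<alpha> (act v x) = act (\<alpha> v) x" "\<And>v x. \<beta> (act v x) = act (\<beta> v) x"
    "\<And>v. v = (\<Sum>b\<in>I. sV (\<kappa> b v) b) + central (\<alpha> v) + casimir (\<beta> v)"
proof -
  obtain \<pi> \<alpha> \<beta> where lin: "Vector_Spaces.linear sV sV \<pi>" "Vector_Spaces.linear sV sV \<alpha>"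
      "Vector_Spaces.linear sV sV \<beta>"
    and \<pi>: "\<And>i j v. \<pi> (op i j v) = 0" "\<And>i j v. op i j (\<pi> v) = 0"
    and comm: "\<And>i j v. \<alpha> (op i j v) = op i j (\<alpha> v)" "\<And>i j v. \<beta> (op i j v) = op i j (\<beta> v)"
    and split: "\<And>v. v = \<pi> v + central (\<alpha> v) + casimir (\<beta> v)"
    and fixed: "\<And>v. (\<And>i j. op i j v = 0) \<Longrightarrow> \<pi> v = v"
    using invariant_projection[OF central_semisimple] by blast
  have act_op: "act v x = - (\<Sum>i\<in>UNIV. \<Sum>j\<in>UNIV. sV (x $ i $ j) (op i j v))" for v x
  proof -
    have "act v x = act v (\<Sum>i\<in>UNIV. \<Sum>j\<in>UNIV. mat_scale (x $ i $ j) (unit_mat i j))"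
      by (simp only: sum_unit_mat)
    then show ?thesis by (simp add: act_simps op_def sum_negf)
  qed
  have inv: "v \<in> invariants \<longleftrightarrow> (\<forall>i j. op i j v = 0)" for v
  proof
    assume "v \<in> invariants"
    then show "\<forall>i j. op i j v = 0" by (simp add: invariants_def op_def)
  next
    assume "\<forall>i j. op i j v = 0"
    then show "v \<in> invariants" by (simp add: invariants_def act_op)
  qed
  obtain I where I: "I \<subseteq> invariants" "V.independent I" "invariants \<subseteq> V.span I"
    by (rule V.maximal_independent_subset)
  have fin: "finite I" using I(2) by (rule V.finiteI_independent)
  have \<pi>inv: "\<pi> v \<in> V.span I" for v using \<pi>(2) inv I(3) by blast
  define \<kappa> where "\<kappa> b v = V.representation I (\<pi> v) b" for b v
  have sum: "(\<Sum>b\<in>I. sV (\<kappa> b v) b) = \<pi> v" for v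
    unfolding \<kappa>_def by (rule V.sum_representation_eq[OF I(2) \<pi>inv fin order_refl])
  show ?thesis
  proof (rule that[OF fin I(1), of \<kappa> \<alpha> \<beta>])
    show "Vector_Spaces.linear sV (*) (\<kappa> b)" for b
      by (intro linearI_vs V.vector_space_axioms vector_space_times)
        (simp_all add: \<kappa>_def linearD[OF lin(1)] V.representation_add[OF I(2) \<pi>inv \<pi>inv]
          V.representation_scale[OF I(2) \<pi>inv])
    show "\<kappa> b (act v x) = 0" for b v x
      by (simp add: \<kappa>_def act_op linearD[OF lin(1)] \<pi> V.representation_zero)
    show "v = (\<Sum>b\<in>I. sV (\<kappa> b v) b)" if "v \<in> invariants" for v
      using that inv fixed unfolding sum by metis
    show "\<kappa> b b' = (if b = b' then 1 else 0)" if "b \<in> I" "b' \<in> I" for b b'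
    proof -
      have "\<pi> b' = b'" using that I(1) inv fixed by blast
      then show ?thesis using V.representation_basis[OF I(2) that(2)] by (auto simp: \<kappa>_def)
    qed
    show "\<alpha> (act v x) = act (\<alpha> v) x" "\<beta> (act v x) = act (\<beta> v) x" for v x
      unfolding act_op by (simp_all add: linearD[OF lin(2)] linearD[OF lin(3)] comm)
    show "v = (\<Sum>b\<in>I. sV (\<kappa> b v) b) + central (\<alpha> v) + casimir (\<beta> v)" for v
      unfolding sum by (rule split)
  qed (rule lin)+
qed

text \<open>The cocycles \<open>\<phi> b\<close> are the coordinates \<open>\<kappa> b\<close> of
  the curried cocycle F; what remains is \<open>central\<close> of \<alpha> F plus
  \<open>casimir\<close> of \<beta> F, exact by the homotopies. For uniqueness,
  \<open>\<kappa> b\<close> carries a primitive of the sum to a primitive of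
  \<open>\<phi> b\<close>, up to sign.\<close>

theorem cup_basis:
  assumes k: "k > 0"
  obtains I where "finite I" "I \<subseteq> invariants"
    "\<And>v. v \<in> invariants \<Longrightarrow> \<exists>c. v = (\<Sum>b\<in>I. sV (c b) b)"
    "\<And>\<omega>. \<omega> \<in> rsym_Z mat_scale (**) sM l r (Suc k) \<Longrightarrow> \<exists>\<phi>. (\<forall>b\<in>I. \<phi> b \<in> lie_Z mat_scale (**) k) \<and>
      \<omega> - (\<Sum>b\<in>I. cup sM (derivation b) (\<phi> b)) \<in> rsym_B mat_scale (**) sM l r (Suc k)"
    "\<And>\<phi>. (\<And>b. b \<in> I \<Longrightarrow> \<phi> b \<in> lie_Z mat_scale (**) k) \<Longrightarrow>
      (\<Sum>b\<in>I. cup sM (derivation b) (\<phi> b)) \<in> rsym_B mat_scale (**) sM l r (Suc k) \<Longrightarrow>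
      \<forall>b\<in>I. \<phi> b \<in> lie_B mat_scale (**) k"
proof -
  obtain k' where k': "k = Suc k'" using k by (cases k) auto
  obtain I \<kappa> \<alpha> \<beta> where I: "finite I" "I \<subseteq> invariants"
    and \<kappa>: "\<And>b. Vector_Spaces.linear sV (*) (\<kappa> b)" "\<And>b v x. \<kappa> b (act v x) = 0"
      "\<And>v. v \<in> invariants \<Longrightarrow> v = (\<Sum>b\<in>I. sV (\<kappa> b v) b)"
      "\<And>b b'. b \<in> I \<Longrightarrow> b' \<in> I \<Longrightarrow> \<kappa> b b' = (if b = b' then 1 else 0)"
    and lin: "Vector_Spaces.linear sV sV \<alpha>" "Vector_Spaces.linear sV sV \<beta>"
    and comm: "\<And>v x. \<alpha> (act v x) = act (\<alpha> v) x" "\<And>v x. \<beta> (act v x) = act (\<beta> v) x"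
    and split: "\<And>v. v = (\<Sum>b\<in>I. sV (\<kappa> b v) b) + central (\<alpha> v) + casimir (\<beta> v)"
    using invariant_coordinates by blast
  have \<kappa>D: "\<kappa> b (D xs F) = lieD (\<lambda>_ _. 0) br xs (\<lambda>ys. \<kappa> b (F ys))" for b xs F
    by (rule lieD_commute[of "\<kappa> b" act "\<lambda>_ _. 0"]) (simp_all only: linearD(1)[OF \<kappa>(1)] \<kappa>(2))
  show ?thesis
  proof (rule that[OF I])
    show "\<exists>c. v = (\<Sum>b\<in>I. sV (c b) b)" if "v \<in> invariants" for v
      by (rule exI[of _ "\<lambda>b. \<kappa> b v"]) (rule \<kappa>(3)[OF that])
  next
    fix \<omega> assume "\<omega> \<in> rsym_Z mat_scale (**) sM l r (Suc k)"
    then obtain F where F: "\<omega> = of_lie_cochain F" "F \<in> C k" "\<And>xs. length xs = Suc k \<Longrightarrow> D xs F = 0"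
      unfolding rsym_Z_iff by blast
    define \<phi> where "\<phi> b xs = \<kappa> b (F xs)" for b xs
    have "\<phi> b \<in> lie_Z mat_scale (**) k" for b
      unfolding lie_Z_iff[OF vector_space_mat_scale]
    proof (intro conjI allI impI)
      show "\<phi> b \<in> MA 0 mat_scale (*) k"
        unfolding \<phi>_def[abs_def] by (rule MA_compose[OF F(2) vector_space_mat_scale \<kappa>(1)])
      show "lieD (\<lambda>_ _. 0) br xs (\<phi> b) = 0" if "length xs = Suc k" for xs
        unfolding \<phi>_def[abs_def] \<kappa>D[symmetric] F(3)[OF that] by (rule linearD(3)[OF \<kappa>(1)])
    qed
    moreover have "\<omega> - (\<Sum>b\<in>I. cup sM (derivation b) (\<phi> b)) \<in> rsym_B mat_scale (**) sM l r (Suc k)"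
    proof -
      let ?G = "\<lambda>ys. \<alpha> (F ys)" and ?H = "\<lambda>ys. \<beta> (F ys)"
      have G: "?G \<in> C k" and H: "?H \<in> C k"
        using F(2) by (rule MA_compose[OF _ vector_space_mat_scale lin(1)]
          MA_compose[OF _ vector_space_mat_scale lin(2)])+
      have "D xs ?G = \<alpha> (D xs F)" "D xs ?H = \<beta> (D xs F)" for xs
        using lieD_commute[of \<alpha> act act] lieD_commute[of \<beta> act act]
        by (simp_all only: linearD(1)[OF lin(1)] linearD(1)[OF lin(2)] comm)
      then have DG: "D xs ?G = 0" and DH: "D xs ?H = 0" if "length xs = Suc k" for xs
        by (simp_all only: F(3)[OF that] linearD(3)[OF lin(1)] linearD(3)[OF lin(2)])
      \<comment> \<open>The primitives supplied by \<open>central_exact\<close> and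
        \<open>casimir_exact\<close>, of degree k' = k - 1.\<close>
      let ?h1 = "\<lambda>ys. - ?G (mat 1 # ys)" and ?h2 = "casimir_contraction ?H"
      let ?h = "\<lambda>ys. ?h1 ys + ?h2 ys"
      have h: "?h \<in> C k'"
        using VC.MA_contract[of ?G 0 k' "mat 1"] G H casimir_contraction_MA[of ?H k'] unfolding k'
        by (intro VC.MA_add VC.MA_minus) simp_all
      have "F xs - (\<Sum>b\<in>I. sV (\<phi> b xs) b) = (if length xs = k then D xs ?h else 0)" for xs
      proof (cases "length xs = k")
        case True
        have c1: "central (?G xs) = D xs ?h1"
        proof (rule central_exact)
          show "?G \<in> C (length xs)" using G True by simp
          show "D (mat 1 # xs) ?G = 0" by (rule DG) (simp only: list.size True)
        qed
        have c2: "casimir (?H xs) = D xs ?h2"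
        proof (rule casimir_exact)
          show "?H \<in> C (length xs)" using H True by simp
          show "D (x # xs) ?H = 0" for x by (rule DH) (simp only: list.size True)
        qed
        have c3: "D xs ?h = D xs ?h1 + D xs ?h2"
          by (rule lieD_linear(1)) (rule act_simps(7))
        have c4: "F xs - (\<Sum>b\<in>I. sV (\<phi> b xs) b) = central (?G xs) + casimir (?H xs)"
        proof -
          have "F xs = (\<Sum>b\<in>I. sV (\<phi> b xs) b) + (central (?G xs) + casimir (?H xs))"
            using split[of "F xs"] unfolding \<phi>_def by (simp only: add.assoc)
          from trans[OF this add.commute] show ?thesis by (rule iffD2[OF diff_eq_eq])
        qed
        show ?thesis unfolding if_P[OF True] c3 c4 c1 c2 ..
      next
        case False
        then have "F xs = 0" by (rule VC.MA_D(1)[OF F(2)])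
        moreover have "\<phi> b xs = 0" for b
          unfolding \<phi>_def \<open>F xs = 0\<close> by (rule linearD(3)[OF \<kappa>(1)])
        ultimately show ?thesis using False by simp
      qed
      then have F_eq: "(\<lambda>xs. F xs - (\<Sum>b\<in>I. sV (\<phi> b xs) b)) = (\<lambda>xs. if length xs = k then D xs ?h else 0)"
        by (rule ext)
      have "\<omega> - (\<Sum>b\<in>I. cup sM (derivation b) (\<phi> b)) = of_lie_cochain (\<lambda>xs. F xs - (\<Sum>b\<in>I. sV (\<phi> b xs) b))"
        unfolding F(1) sum_cup by (rule of_lie_cochain_diff[symmetric])
      from this[unfolded F_eq] show ?thesis unfolding k' rsym_B_iff by (rule bexI[OF _ h])
    qed
    ultimately show "\<exists>\<phi>. (\<forall>b\<in>I. \<phi> b \<in> lie_Z mat_scale (**) k) \<and>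
      \<omega> - (\<Sum>b\<in>I. cup sM (derivation b) (\<phi> b)) \<in> rsym_B mat_scale (**) sM l r (Suc k)" by blast
  next
    fix \<phi> assume \<phi>: "\<And>b. b \<in> I \<Longrightarrow> \<phi> b \<in> lie_Z mat_scale (**) k"
      and "(\<Sum>b\<in>I. cup sM (derivation b) (\<phi> b)) \<in> rsym_B mat_scale (**) sM l r (Suc k)"
    then obtain F where F: "F \<in> C k'"
      and "of_lie_cochain (\<lambda>ys. \<Sum>b\<in>I. sV (\<phi> b ys) b) = of_lie_cochain (\<lambda>xs. if length xs = k then D xs F else 0)"
      unfolding sum_cup k' rsym_B_iff by blast
    then have eq: "(\<Sum>b\<in>I. sV (\<phi> b ys) b) = (if length ys = k then D ys F else 0)" for ys
      unfolding of_lie_cochain_eq_iff by meson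
    show "\<forall>b\<in>I. \<phi> b \<in> lie_B mat_scale (**) k"
    proof
      fix b assume b: "b \<in> I"
      have coord: "\<kappa> b (\<Sum>b\<in>I. sV (\<phi> b ys) b) = \<phi> b ys" for ys
      proof -
        have "\<kappa> b (\<Sum>b\<in>I. sV (\<phi> b ys) b) = (\<Sum>b'\<in>I. \<phi> b' ys * \<kappa> b b')"
          by (simp only: linearD[OF \<kappa>(1)])
        also have "\<dots> = (\<Sum>b'\<in>I. if b' = b then \<phi> b ys else 0)"
          by (intro sum.cong) (auto simp: \<kappa>(4)[OF b])
        finally show ?thesis using b I(1) by simp
      qed
      let ?\<theta> = "\<lambda>ys. - \<kappa> b (F ys)"
      interpret K: cochains mat_scale "(*) :: 'k \<Rightarrow> 'k \<Rightarrow> 'k"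
        by (intro cochains.intro vector_space_mat_scale vector_space_times)
      have \<theta>: "?\<theta> \<in> lie_C mat_scale k'"
        unfolding lie_C_def by (intro K.MA_minus MA_compose[OF F vector_space_mat_scale \<kappa>(1)])
      have lie_minus: "lieD (\<lambda>_ _. 0) br ys ?\<theta> = - lieD (\<lambda>_ _. 0) br ys (\<lambda>ys. \<kappa> b (F ys))" for ys
        by (rule lieD_linear(2)) simp
      have "\<phi> b = lie_d (**) k' ?\<theta>"
      proof
        fix ys
        have "\<phi> b ys = (if length ys = k then \<kappa> b (D ys F) else 0)"
          unfolding coord[of ys, symmetric] eq by (cases "length ys = k") (simp_all only: simp_thms if_True if_False linearD(3)[OF \<kappa>(1)])
        then show "\<phi> b ys = lie_d (**) k' ?\<theta> ys"
          unfolding lie_d_eq_lieD[OF vector_space_mat_scale \<theta>] \<kappa>D lie_minus by (simp only: k' minus_minus)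
      qed
      from this \<theta> show "\<phi> b \<in> lie_B mat_scale (**) k" unfolding lie_B_def k' nat.case by (rule image_eqI)
    qed
  qed
qed

end

section \<open>Cosets and linear maps out of free spaces\<close>

lemma coset_eq_iff:
  assumes "vector_space s" "module.subspace s T"
  shows "x +o T = y +o T \<longleftrightarrow> x - y \<in> T"
proof -
  interpret vector_space s by fact
  note T = subspace_0[OF assms(2)] subspace_add[OF assms(2)] subspace_diff[OF assms(2)]
  show ?thesis
  proof
    assume "x +o T = y +o T"
    moreover have "x + 0 \<in> x +o T" using T(1) by (rule set_plus_intro2)
    ultimately show "x - y \<in> T" by (auto simp: elt_set_plus_def)
  next
    assume d: "x - y \<in> T"
    have "x + t \<in> y +o T" if "t \<in> T" for t
      using T(2)[OF d that] set_plus_intro2[of "x - y + t" T y] by simp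
    moreover have "y + t \<in> x +o T" if "t \<in> T" for t
      using T(3)[OF that d] set_plus_intro2[of "t - (x - y)" T x] by (simp add: add.commute)
    ultimately show "x +o T = y +o T" by (auto simp: elt_set_plus_def)
  qed
qed

lemma subspace_free_space: "module.subspace (pw_scale (*)) (free_space X :: ('x \<Rightarrow> 'k::field) set)"
proof -
  interpret P: vector_space "pw_scale (*) :: 'k \<Rightarrow> ('x \<Rightarrow> 'k) \<Rightarrow> _"
    by (rule vector_space_pw_scale[OF vector_space_times])
  show ?thesis unfolding P.subspace_def
  proof (intro conjI ballI allI)
    show "(0 :: 'x \<Rightarrow> 'k) \<in> free_space X" by (simp add: free_space_def)
    fix f g :: "'x \<Rightarrow> 'k" and c assume f: "f \<in> free_space X"
    have "{x. pw_scale (*) c f x \<noteq> 0} \<subseteq> {x. f x \<noteq> 0}" by (auto simp: pw_scale_def)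
    with f show "pw_scale (*) c f \<in> free_space X" by (auto simp: free_space_def intro: finite_subset)
    assume g: "g \<in> free_space X"
    have "{x. (f + g) x \<noteq> 0} \<subseteq> {x. f x \<noteq> 0} \<union> {x. g x \<noteq> 0}" by auto
    with f g show "f + g \<in> free_space X"
      unfolding free_space_def by (blast intro: finite_subset finite_UnI)
  qed
qed

lemma free_gen_in_free_space: "x \<in> X \<Longrightarrow> free_gen x \<in> free_space X"
  by (simp add: free_space_def free_gen_def)

lemma free_space_decompose:
  assumes "f \<in> free_space X"
  shows "f = (\<Sum>x | f x \<noteq> 0. pw_scale (*) (f x) (free_gen x))"
proof
  fix y
  have "(\<Sum>x | f x \<noteq> 0. pw_scale (*) (f x) (free_gen x)) y = (\<Sum>x | f x \<noteq> 0. if x = y then f y else 0)"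
    unfolding sum_fun_app by (intro sum.cong) (auto simp: pw_scale_def free_gen_def)
  also have "\<dots> = f y"
    using assms by (auto simp: free_space_def)
  finally show "f y = (\<Sum>x | f x \<noteq> 0. pw_scale (*) (f x) (free_gen x)) y" by simp
qed

definition linear_extension ::
    "('k::field \<Rightarrow> 'z::ab_group_add \<Rightarrow> 'z) \<Rightarrow> ('x \<Rightarrow> 'z) \<Rightarrow> ('x \<Rightarrow> 'k) \<Rightarrow> 'z" where
  "linear_extension s g f = (\<Sum>x | f x \<noteq> 0. s (f x) (g x))"

context vector_space
begin

lemma linear_extension_superset:
  assumes "finite A" "{x. f x \<noteq> 0} \<subseteq> A"
  shows "linear_extension scale g f = (\<Sum>x\<in>A. scale (f x) (g x))"
  unfolding linear_extension_def using assms by (intro sum.mono_neutral_left) auto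

lemma linear_extension_add:
  assumes "f \<in> free_space X" "h \<in> free_space X"
  shows "linear_extension scale g (f + h) = linear_extension scale g f + linear_extension scale g h"
proof -
  let ?A = "{x. f x \<noteq> 0} \<union> {x. h x \<noteq> 0}"
  have A: "finite ?A" using assms by (simp add: free_space_def)
  have "linear_extension scale g f' = (\<Sum>x\<in>?A. scale (f' x) (g x))" if "f' \<in> {f, h, f + h}" for f'
    using that by (intro linear_extension_superset A) auto
  then show ?thesis by (simp add: scale_left_distrib sum.distrib)
qed

lemma linear_extension_scale:
  assumes "f \<in> free_space X"
  shows "linear_extension scale g (pw_scale (*) c f) = scale c (linear_extension scale g f)"
proof -
  let ?A = "{x. f x \<noteq> 0}"
  have A: "finite ?A" using assms by (simp add: free_space_def)
  have 1: "linear_extension scale g f = (\<Sum>x\<in>?A. scale (f x) (g x))"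
    by (rule linear_extension_superset[OF A]) simp
  have "linear_extension scale g (pw_scale (*) c f) = (\<Sum>x\<in>?A. scale (pw_scale (*) c f x) (g x))"
    by (rule linear_extension_superset[OF A]) (auto simp: pw_scale_def)
  also have "\<dots> = (\<Sum>x\<in>?A. scale c (scale (f x) (g x)))"
    by (simp add: pw_scale_def)
  finally show ?thesis unfolding 1 scale_sum_right .
qed

lemma linear_extension_free_gen: "linear_extension scale g (free_gen x) = g x"
proof -
  have "linear_extension scale g (free_gen x) = (\<Sum>y\<in>{x}. scale (free_gen x y) (g y))"
    by (rule linear_extension_superset) (auto simp: free_gen_def)
  then show ?thesis by (simp add: free_gen_def)
qed

end

section \<open>Isomorphisms from a tensor product\<close>

text \<open>If \<open>(e i)\<close> spans \<open>U\<close>, then modulo the relations every element of the free space is a sum of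
  \<open>e i \<otimes> w i\<close>; so a pairing induces an isomorphism as soon as each class in \<open>Z / B\<close> has a
  representative \<open>\<Sum> \<beta> (e i) (x i)\<close> in which the classes of the \<open>x i\<close> are unique.\<close>

locale tensor_pairing =
  U: vector_space sU + S: vector_space sS + Z: vector_space sZ
  for sU :: "'k::field \<Rightarrow> 'u::ab_group_add \<Rightarrow> 'u" and sS :: "'k \<Rightarrow> 's::ab_group_add \<Rightarrow> 's"
    and sZ :: "'k \<Rightarrow> 'z::ab_group_add \<Rightarrow> 'z" +
  fixes U :: "'u set" and S T :: "'s set" and Z B :: "'z set"
    and \<beta> :: "'u \<Rightarrow> 's \<Rightarrow> 'z" and I :: "'i set" and e :: "'i \<Rightarrow> 'u"
  assumes subspaces: "U.subspace U" "S.subspace S" "S.subspace T" "Z.subspace Z" "Z.subspace B"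
    and bilinear: "bilinear_map sU sS sZ \<beta>"
    and pair_Z: "u \<in> U \<Longrightarrow> x \<in> S \<Longrightarrow> \<beta> u x \<in> Z"
    and pair_B: "u \<in> U \<Longrightarrow> x \<in> T \<Longrightarrow> \<beta> u x \<in> B"
    and fin: "finite I" and e: "i \<in> I \<Longrightarrow> e i \<in> U"
    and spanning: "u \<in> U \<Longrightarrow> \<exists>c. u = (\<Sum>i\<in>I. sU (c i) (e i))"
    and represents: "\<And>z. z \<in> Z \<Longrightarrow> \<exists>x. (\<forall>i\<in>I. x i \<in> S) \<and> z - (\<Sum>i\<in>I. \<beta> (e i) (x i)) \<in> B"
    and detects: "\<And>x. \<forall>i\<in>I. x i \<in> S \<Longrightarrow> (\<Sum>i\<in>I. \<beta> (e i) (x i)) \<in> B \<Longrightarrow> \<forall>i\<in>I. x i \<in> T"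
begin

abbreviation "W \<equiv> quotient_space S T"
abbreviation "sW \<equiv> quotient_scale sS T"
abbreviation "F \<equiv> free_space (U \<times> W) :: ('u \<times> 's set \<Rightarrow> 'k) set"
abbreviation "R \<equiv> tensor_relations sU U sW W"
abbreviation "sF \<equiv> pw_scale (*) :: 'k \<Rightarrow> ('u \<times> 's set \<Rightarrow> 'k) \<Rightarrow> _"
abbreviation gen :: "'u \<Rightarrow> 's set \<Rightarrow> 'u \<times> 's set \<Rightarrow> 'k" where "gen u w \<equiv> free_gen (u, w)"

sublocale F: vector_space sF
  by (rule vector_space_pw_scale[OF vector_space_times])

lemma \<beta>: "Vector_Spaces.linear sS sZ (\<beta> u)" "Vector_Spaces.linear sU sZ (\<lambda>u. \<beta> u x)"
  using bilinear by (auto simp: bilinear_map_def)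

lemmas \<beta>_simps = linearD[OF \<beta>(1)] linearD[OF \<beta>(2)]

lemma W_add: "(x +o T) + (y +o T) = (x + y) +o T"
  by (rule quotient_space_add[OF S.vector_space_axioms subspaces(3)])

lemma W_scale: "sW c (x +o T) = sS c x +o T"
  by (rule quotient_space_scale[OF S.vector_space_axioms subspaces(3)])

lemma W_closed: "w \<in> W \<Longrightarrow> w' \<in> W \<Longrightarrow> w + w' \<in> W" "w \<in> W \<Longrightarrow> sW c w \<in> W"
  using subspaces(2)
  by (auto simp: quotient_space_def W_add W_scale intro!: imageI S.subspace_add S.subspace_scale)

lemma W_0: "0 +o T \<in> W"
  unfolding quotient_space_def by (rule imageI) (rule S.subspace_0[OF subspaces(2)])

lemma W_eq: "x +o T = y +o T \<longleftrightarrow> x - y \<in> T"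
  by (rule coset_eq_iff[OF S.vector_space_axioms subspaces(3)])

text \<open>Representatives are chosen without any compatibility. By \<open>rep_diff\<close> the
  choice is linear modulo T, and \<open>pair_B\<close> sends the defect into B.\<close>

definition rep :: "'s set \<Rightarrow> 's" where "rep w = (SOME x. x \<in> S \<and> w = x +o T)"

lemma rep: "w \<in> W \<Longrightarrow> rep w \<in> S" "w \<in> W \<Longrightarrow> rep w +o T = w"
proof -
  assume "w \<in> W"
  then have "\<exists>x. x \<in> S \<and> w = x +o T" by (auto simp: quotient_space_def)
  then have "rep w \<in> S \<and> w = rep w +o T" unfolding rep_def by (rule someI_ex)
  then show "rep w \<in> S" "rep w +o T = w" by simp_all
qed

lemma rep_diff:
  "w \<in> W \<Longrightarrow> w' \<in> W \<Longrightarrow> rep (w + w') - (rep w + rep w') \<in> T"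
  "w \<in> W \<Longrightarrow> rep (sW c w) - sS c (rep w) \<in> T"
  "x \<in> S \<Longrightarrow> rep (x +o T) - x \<in> T"
proof -
  show "rep (w + w') - (rep w + rep w') \<in> T" if "w \<in> W" "w' \<in> W"
    using that W_closed(1)[OF that] by (simp add: W_eq[symmetric] W_add[symmetric] rep)
  show "rep (sW c w) - sS c (rep w) \<in> T" if "w \<in> W"
    using that W_closed(2)[OF that] by (simp add: W_eq[symmetric] W_scale[symmetric] rep)
  show "rep (x +o T) - x \<in> T" if "x \<in> S"
    using that by (simp add: W_eq[symmetric] rep quotient_space_def)
qed

definition ext :: "('u \<times> 's set \<Rightarrow> 'k) \<Rightarrow> 'z" where
  "ext = linear_extension sZ (\<lambda>(u, w). \<beta> u (rep w))"

lemma ext_add: "f \<in> F \<Longrightarrow> h \<in> F \<Longrightarrow> ext (f + h) = ext f + ext h"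
  unfolding ext_def by (rule Z.linear_extension_add)

lemma ext_scale: "f \<in> F \<Longrightarrow> ext (sF c f) = sZ c (ext f)"
  unfolding ext_def by (rule Z.linear_extension_scale)

lemma ext_gen: "ext (gen u w) = \<beta> u (rep w)"
  by (simp add: ext_def Z.linear_extension_free_gen)

lemma subspace_F: "F.subspace F" by (rule subspace_free_space)

lemma gen_F: "u \<in> U \<Longrightarrow> w \<in> W \<Longrightarrow> gen u w \<in> F"
  by (simp add: free_gen_in_free_space)

lemma ext_diff: "f \<in> F \<Longrightarrow> h \<in> F \<Longrightarrow> ext (f - h) = ext f - ext h"
  using ext_add[of "f - h" h] F.subspace_diff[OF subspace_F, of f h] by (simp add: eq_diff_eq)

lemma ext_sum: "(\<And>i. i \<in> A \<Longrightarrow> f i \<in> F) \<Longrightarrow> ext (\<Sum>i\<in>A. f i) = (\<Sum>i\<in>A. ext (f i))"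
proof (induct A rule: infinite_finite_induct)
  case (insert i A)
  have "(\<Sum>i\<in>A. f i) \<in> F" using insert by (intro F.subspace_sum[OF subspace_F]) auto
  then have "ext (f i + (\<Sum>i\<in>A. f i)) = ext (f i) + ext (\<Sum>i\<in>A. f i)"
    using insert by (intro ext_add) auto
  also have "ext (\<Sum>i\<in>A. f i) = (\<Sum>i\<in>A. ext (f i))" using insert by auto
  finally show ?case by (simp only: sum.insert[OF insert(1,2)])
qed (simp_all add: ext_def linear_extension_def)

lemma subspace_R: "F.subspace R"
  unfolding tensor_relations_def by (rule F.subspace_span)

lemma R_gens:
  assumes "u \<in> U" "w \<in> W"
  shows "u' \<in> U \<Longrightarrow> gen (u + u') w - gen u w - gen u' w \<in> R"
    and "w' \<in> W \<Longrightarrow> gen u (w + w') - gen u w - gen u w' \<in> R"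
    and "gen (sU c u) w - sF c (gen u w) \<in> R"
    and "gen u (sW c w) - sF c (gen u w) \<in> R"
  unfolding tensor_relations_def by (rule F.span_base; use assms in blast)+

text \<open>Relations in the first factor go to 0 exactly, those in the second only into B, because
  \<open>rep\<close> is linear only modulo T.\<close>

lemma ext_R: "f \<in> R \<Longrightarrow> ext f \<in> B"
proof -
  let ?N = "{f \<in> F. ext f \<in> B}"
  have sub: "F.subspace ?N"
    using subspace_F subspaces(5) unfolding F.subspace_def Z.subspace_def
    by (auto simp: ext_add ext_scale) (simp add: ext_def linear_extension_def)
  have B0: "0 \<in> B" by (rule Z.subspace_0[OF subspaces(5)])
  note Fs = F.subspace_diff[OF subspace_F] F.subspace_scale[OF subspace_F] gen_F
  note Us = U.subspace_add[OF subspaces(1)] U.subspace_scale[OF subspaces(1)]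
  have "gen (u + u') w - gen u w - gen u' w \<in> ?N" if "u \<in> U" "u' \<in> U" "w \<in> W" for u u' w
    using that B0 by (simp add: Fs Us W_closed ext_diff ext_gen \<beta>_simps)
  moreover have "gen u (w + w') - gen u w - gen u w' \<in> ?N" if "u \<in> U" "w \<in> W" "w' \<in> W" for u w w'
  proof -
    have "\<beta> u (rep (w + w')) - \<beta> u (rep w) - \<beta> u (rep w') \<in> B"
      using pair_B[OF that(1) rep_diff(1)[OF that(2,3)]] by (simp add: \<beta>_simps diff_diff_eq)
    then show ?thesis using that by (simp add: Fs Us W_closed ext_diff ext_gen)
  qed
  moreover have "gen (sU c u) w - sF c (gen u w) \<in> ?N" if "u \<in> U" "w \<in> W" for c u w
    using that B0 by (simp add: Fs Us W_closed ext_diff ext_scale ext_gen \<beta>_simps)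
  moreover have "gen u (sW c w) - sF c (gen u w) \<in> ?N" if "u \<in> U" "w \<in> W" for c u w
    using that pair_B[OF that(1) rep_diff(2)[OF that(2)]]
    by (simp add: Fs Us W_closed ext_diff ext_scale ext_gen \<beta>_simps)
  ultimately have "R \<subseteq> ?N"
    unfolding tensor_relations_def by (intro F.span_minimal sub) blast
  then show "f \<in> R \<Longrightarrow> ext f \<in> B" by auto
qed

lemma gen_0: "u \<in> U \<Longrightarrow> gen u (0 +o T) \<in> R"
proof -
  assume "u \<in> U"
  from this W_0 have "gen u (sW 0 (0 +o T)) - sF 0 (gen u (0 +o T)) \<in> R" by (rule R_gens(4))
  then show ?thesis by (simp add: W_scale del: set_zero_plus)
qed

lemma telescope:
  "a - b - c + (c - d) = a - (b + d)" "a - b + (c - d) - (x - b - d) = a + c - x" "a - b - (x - b) = a - x"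
  for a b c d x :: "'x::ab_group_add"
  by simp_all

lemma gen_sum:
  assumes "finite A" "\<And>i. i \<in> A \<Longrightarrow> e' i \<in> U" "w \<in> W"
  shows "gen (\<Sum>i\<in>A. e' i) w - (\<Sum>i\<in>A. gen (e' i) w) \<in> R"
  using assms(1,2)
proof induct
  case empty
  have "gen (sU 0 0) w - sF 0 (gen 0 w) \<in> R"
    using R_gens(3)[OF U.subspace_0[OF subspaces(1)] assms(3)] .
  then show ?case by simp
next
  case (insert i A)
  have "(\<Sum>i\<in>A. e' i) \<in> U" using insert by (intro U.subspace_sum[OF subspaces(1)]) auto
  then have "gen (e' i + (\<Sum>i\<in>A. e' i)) w - gen (e' i) w - gen (\<Sum>i\<in>A. e' i) w \<in> R"
    using insert assms(3) by (intro R_gens(1)) auto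
  moreover have "gen (\<Sum>i\<in>A. e' i) w - (\<Sum>i\<in>A. gen (e' i) w) \<in> R"
    using insert(3,4) by blast
  ultimately have "gen (e' i + (\<Sum>i\<in>A. e' i)) w - gen (e' i) w - gen (\<Sum>i\<in>A. e' i) w
      + (gen (\<Sum>i\<in>A. e' i) w - (\<Sum>i\<in>A. gen (e' i) w)) \<in> R"
    by (rule F.subspace_add[OF subspace_R])
  then show ?case by (simp only: sum.insert[OF insert(1,2)] telescope)
qed

text \<open>The property is closed under sums and multiples, so generators suffice. For u = \<Sum>
  c_i e_i the scalars move across the tensor sign: u \<otimes> w is \<Sum> e_i \<otimes> c_i w
  modulo the relations.\<close>

lemma normal_form:
  assumes "f \<in> F"
  shows "\<exists>w. (\<forall>i\<in>I. w i \<in> W) \<and> f - (\<Sum>i\<in>I. gen (e i) (w i)) \<in> R"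
proof -
  let ?P = "\<lambda>f. \<exists>w. (\<forall>i\<in>I. w i \<in> W) \<and> f - (\<Sum>i\<in>I. gen (e i) (w i)) \<in> R"
  have 0: "?P 0"
  proof (intro exI[of _ "\<lambda>_. 0 +o T"] conjI ballI)
    show "0 +o T \<in> W" by (rule W_0)
    have "(\<Sum>i\<in>I. gen (e i) (0 +o T)) \<in> R"
      by (intro F.subspace_sum[OF subspace_R] gen_0 e)
    then show "0 - (\<Sum>i\<in>I. gen (e i) (0 +o T)) \<in> R"
      using F.subspace_neg[OF subspace_R] by (simp del: set_zero_plus)
  qed
  have add: "?P (f + h)" if "?P f" "?P h" for f h
  proof -
    from that obtain v w where v: "\<forall>i\<in>I. v i \<in> W" "f - (\<Sum>i\<in>I. gen (e i) (v i)) \<in> R"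
      and w: "\<forall>i\<in>I. w i \<in> W" "h - (\<Sum>i\<in>I. gen (e i) (w i)) \<in> R" by blast
    have "(\<Sum>i\<in>I. gen (e i) (v i + w i) - gen (e i) (v i) - gen (e i) (w i)) \<in> R"
      using v w by (intro F.subspace_sum[OF subspace_R] R_gens(2) e) auto
    from F.subspace_diff[OF subspace_R F.subspace_add[OF subspace_R v(2) w(2)] this]
    have "f + h - (\<Sum>i\<in>I. gen (e i) (v i + w i)) \<in> R"
      by (simp only: sum_subtractf telescope)
    with v w show ?thesis by (intro exI[of _ "\<lambda>i. v i + w i"]) (simp add: W_closed)
  qed
  have scale: "?P (sF c f)" if "?P f" for c f
  proof -
    from that obtain v where v: "\<forall>i\<in>I. v i \<in> W" "f - (\<Sum>i\<in>I. gen (e i) (v i)) \<in> R" by blast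
    have "(\<Sum>i\<in>I. gen (e i) (sW c (v i)) - sF c (gen (e i) (v i))) \<in> R"
      using v by (intro F.subspace_sum[OF subspace_R] R_gens(4) e) auto
    from F.subspace_diff[OF subspace_R F.subspace_scale[OF subspace_R v(2), of c] this]
    have "sF c f - (\<Sum>i\<in>I. gen (e i) (sW c (v i))) \<in> R"
      by (simp only: sum_subtractf F.scale_right_diff_distrib F.scale_sum_right telescope)
    with v show ?thesis by (intro exI[of _ "\<lambda>i. sW c (v i)"]) (simp add: W_closed)
  qed
  have gen: "?P (gen u w)" if u: "u \<in> U" and w: "w \<in> W" for u w
  proof -
    obtain c where c: "u = (\<Sum>i\<in>I. sU (c i) (e i))" using spanning[OF u] by blast
    have "gen u w - (\<Sum>i\<in>I. gen (sU (c i) (e i)) w) \<in> R"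
      unfolding c using w e by (intro gen_sum fin U.subspace_scale[OF subspaces(1)]) auto
    moreover have "(\<Sum>i\<in>I. gen (sU (c i) (e i)) w - sF (c i) (gen (e i) w)) \<in> R"
      using w by (intro F.subspace_sum[OF subspace_R] R_gens(3) e) auto
    ultimately have "gen u w - (\<Sum>i\<in>I. gen (sU (c i) (e i)) w)
        + (\<Sum>i\<in>I. gen (sU (c i) (e i)) w - sF (c i) (gen (e i) w)) \<in> R"
      by (rule F.subspace_add[OF subspace_R])
    moreover have "(\<Sum>i\<in>I. gen (e i) (sW (c i) w) - sF (c i) (gen (e i) w)) \<in> R"
      using w by (intro F.subspace_sum[OF subspace_R] R_gens(4) e) auto
    ultimately have "gen u w - (\<Sum>i\<in>I. gen (sU (c i) (e i)) w)
        + (\<Sum>i\<in>I. gen (sU (c i) (e i)) w - sF (c i) (gen (e i) w))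
        - (\<Sum>i\<in>I. gen (e i) (sW (c i) w) - sF (c i) (gen (e i) w)) \<in> R"
      by (rule F.subspace_diff[OF subspace_R])
    then have "gen u w - (\<Sum>i\<in>I. gen (e i) (sW (c i) w)) \<in> R"
      by (simp add: sum_subtractf)
    with w show ?thesis by (intro exI[of _ "\<lambda>i. sW (c i) w"]) (simp add: W_closed)
  qed
  have "?P (\<Sum>x\<in>A. sF (f x) (free_gen x))" if "finite A" "A \<subseteq> U \<times> W" for A
    using that
  proof induct
    case (insert x A)
    obtain u w where x: "x = (u, w)" "u \<in> U" "w \<in> W" using insert(4) by auto
    have "?P (free_gen x)" unfolding x(1) by (rule gen) (rule x)+
    moreover have "?P (\<Sum>x\<in>A. sF (f x) (free_gen x))" using insert(3,4) by blast
    ultimately show ?case unfolding sum.insert[OF insert(1,2)] by (intro add scale)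
  qed (use 0 in simp)
  from this[of "{x. f x \<noteq> 0}"] show ?thesis
    using assms free_space_decompose[OF assms] by (simp add: free_space_def)
qed

lemma ext_Z: "f \<in> F \<Longrightarrow> ext f \<in> Z"
  unfolding ext_def linear_extension_def
  by (intro Z.subspace_sum[OF subspaces(4)] Z.subspace_scale[OF subspaces(4)])
    (auto simp: free_space_def intro!: pair_Z rep)

text \<open>This yields injectivity. On the normal form of f, \<open>ext\<close> is \<Sum> \<beta>
  (e i) (rep (w i)); \<open>detects\<close> puts each representative in T, so every
  \<open>w i\<close> is the zero coset and \<open>gen_0\<close> applies.\<close>

lemma ext_in_B: "f \<in> F \<Longrightarrow> ext f \<in> B \<Longrightarrow> f \<in> R"
proof -
  assume f: "f \<in> F" "ext f \<in> B"
  obtain w where w: "\<And>i. i \<in> I \<Longrightarrow> w i \<in> W" and R: "f - (\<Sum>i\<in>I. gen (e i) (w i)) \<in> R" (is "f - ?s \<in> R")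
    using normal_form[OF f(1)] by blast
  have gF: "gen (e i) (w i) \<in> F" if "i \<in> I" for i using w e that by (intro gen_F)
  have sF: "?s \<in> F" using gF by (intro F.subspace_sum[OF subspace_F])
  have "ext f - ext (f - ?s) \<in> B" using f(2) ext_R[OF R] by (rule Z.subspace_diff[OF subspaces(5)])
  moreover have "ext f - ext (f - ?s) = (\<Sum>i\<in>I. \<beta> (e i) (rep (w i)))"
    using f(1) sF gF by (simp add: ext_diff ext_sum ext_gen)
  ultimately have "\<forall>i\<in>I. rep (w i) \<in> T"
    using w rep by (intro detects) auto
  then have "w i = 0 +o T" if "i \<in> I" for i
    using rep(2)[OF w[OF that]] W_eq[of "rep (w i)" 0] that by simp
  then have "?s \<in> R" using e gen_0 by (intro F.subspace_sum[OF subspace_R]) simp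
  from F.subspace_add[OF subspace_R R this] show "f \<in> R" by simp
qed

theorem tensor_iso:
  "\<exists>\<Phi>. linear_iso_on (tensor_scale sU U sW W) (tensor_product sU U sW W)
      (quotient_scale sZ B) (quotient_space Z B) \<Phi> \<and>
    (\<forall>u\<in>U. \<forall>x\<in>S. \<Phi> (pure_tensor sU U sW W u (x +o T)) = \<beta> u x +o B)"
proof -
  \<comment> \<open>Another choice of f changes \<open>ext f\<close> by an element of B, by
    \<open>ext_R\<close>.\<close>
  define \<Phi> where "\<Phi> C = ext (SOME f. f \<in> F \<and> C = f +o R) +o B" for C
  note R_eq = coset_eq_iff[OF F.vector_space_axioms subspace_R]
  note B_eq = coset_eq_iff[OF Z.vector_space_axioms subspaces(5)]
  have \<Phi>: "\<Phi> (f +o R) = ext f +o B" if f: "f \<in> F" for f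
  proof -
    define h where "h = (SOME h. h \<in> F \<and> f +o R = h +o R)"
    have h: "h \<in> F \<and> f +o R = h +o R" unfolding h_def by (rule someI[of _ f]) (simp add: f)
    then have "h - f \<in> R" using R_eq by blast
    then have "ext h - ext f \<in> B" using ext_R[of "h - f"] h f by (simp add: ext_diff)
    then show ?thesis unfolding \<Phi>_def h_def[symmetric] B_eq .
  qed
  have "bij_betw \<Phi> (tensor_product sU U sW W) (quotient_space Z B)"
  proof (rule bij_betw_imageI)
    show "inj_on \<Phi> (tensor_product sU U sW W)"
    proof (rule inj_onI)
      fix C D assume "C \<in> tensor_product sU U sW W" "D \<in> tensor_product sU U sW W" and eq: "\<Phi> C = \<Phi> D"
      then obtain f h where f: "f \<in> F" "C = f +o R" and h: "h \<in> F" "D = h +o R"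
        by (auto simp: tensor_product_def quotient_space_def[of F])
      from eq have "ext (f - h) \<in> B" using f h by (simp add: \<Phi> B_eq ext_diff)
      then show "C = D" unfolding f(2) h(2) R_eq
        using F.subspace_diff[OF subspace_F f(1) h(1)] by (intro ext_in_B)
    qed
    show "\<Phi> ` tensor_product sU U sW W = quotient_space Z B"
    proof
      show "\<Phi> ` tensor_product sU U sW W \<subseteq> quotient_space Z B"
        by (auto simp: tensor_product_def quotient_space_def[of F] quotient_space_def[of Z] \<Phi> ext_Z)
      show "quotient_space Z B \<subseteq> \<Phi> ` tensor_product sU U sW W"
      proof
        fix D assume "D \<in> quotient_space Z B"
        then obtain z where z: "z \<in> Z" "D = z +o B" by (auto simp: quotient_space_def)
        obtain x where x: "\<And>i. i \<in> I \<Longrightarrow> x i \<in> S" "z - (\<Sum>i\<in>I. \<beta> (e i) (x i)) \<in> B"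
          using represents[OF z(1)] by blast
        let ?f = "\<Sum>i\<in>I. gen (e i) (x i +o T)"
        have gF: "gen (e i) (x i +o T) \<in> F" if "i \<in> I" for i
          using x(1)[OF that] e[OF that] by (intro gen_F) (auto simp: quotient_space_def)
        then have fF: "?f \<in> F" by (intro F.subspace_sum[OF subspace_F])
        have "(\<Sum>i\<in>I. \<beta> (e i) (rep (x i +o T) - x i)) \<in> B"
          using x(1) by (intro Z.subspace_sum[OF subspaces(5)] pair_B e rep_diff(3))
        then have "ext ?f - (\<Sum>i\<in>I. \<beta> (e i) (x i)) \<in> B"
          using gF by (simp add: ext_sum ext_gen \<beta>_simps sum_subtractf)
        from Z.subspace_diff[OF subspaces(5) this x(2)] have "ext ?f - z \<in> B" by simp
        then have "D = \<Phi> (?f +o R)" unfolding \<Phi>[OF fF] z(2) using B_eq by blast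
        then show "D \<in> \<Phi> ` tensor_product sU U sW W"
          using fF by (auto simp: tensor_product_def quotient_space_def[of F])
      qed
    qed
  qed
  moreover have "\<Phi> (C + D) = \<Phi> C + \<Phi> D"
    if CD: "C \<in> tensor_product sU U sW W" "D \<in> tensor_product sU U sW W" for C D
  proof -
    from CD obtain f h where f: "f \<in> F" "C = f +o R" and h: "h \<in> F" "D = h +o R"
      by (auto simp: tensor_product_def quotient_space_def[of F])
    then show ?thesis
      by (simp add: quotient_space_add[OF F.vector_space_axioms subspace_R]
        quotient_space_add[OF Z.vector_space_axioms subspaces(5)] \<Phi> ext_add
        F.subspace_add[OF subspace_F])
  qed
  moreover have "\<Phi> (tensor_scale sU U sW W c C) = quotient_scale sZ B c (\<Phi> C)"
    if C: "C \<in> tensor_product sU U sW W" for c C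
  proof -
    from C obtain f where f: "f \<in> F" "C = f +o R"
      by (auto simp: tensor_product_def quotient_space_def[of F])
    then show ?thesis
      by (simp add: tensor_scale_def quotient_space_scale[OF F.vector_space_axioms subspace_R]
        quotient_space_scale[OF Z.vector_space_axioms subspaces(5)] \<Phi> ext_scale
        F.subspace_scale[OF subspace_F])
  qed
  moreover have "\<Phi> (pure_tensor sU U sW W u (x +o T)) = \<beta> u x +o B" if u: "u \<in> U" and x: "x \<in> S" for u x
  proof -
    have "x +o T \<in> W" using x by (auto simp: quotient_space_def)
    then have "\<Phi> (pure_tensor sU U sW W u (x +o T)) = \<beta> u (rep (x +o T)) +o B"
      using u by (simp add: pure_tensor_def \<Phi> gen_F ext_gen)
    moreover have "\<beta> u (rep (x +o T)) - \<beta> u x \<in> B"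
      using pair_B[OF u rep_diff(3)[OF x]] by (simp add: \<beta>_simps)
    ultimately show ?thesis using B_eq by simp
  qed
  ultimately show ?thesis unfolding linear_iso_on_def by blast
qed

end

section \<open>The cup product isomorphism\<close>

lemma subspace_kernel:
  assumes "Vector_Spaces.linear s t f" "module.subspace s S"
  shows "module.subspace s {x \<in> S. f x = 0}"
proof -
  interpret f: Vector_Spaces.linear s t f by fact
  show ?thesis using assms(2) by (auto simp: f.vs1.subspace_def f.add f.scale f.zero)
qed

lemma linear_module_hom: "Vector_Spaces.linear s t f \<Longrightarrow> module_hom s t f"
  by (simp add: Vector_Spaces.linear_def)

lemma lie_d_linear:
  fixes mul :: "'a::ab_group_add \<Rightarrow> 'a \<Rightarrow> 'a"
  shows "Vector_Spaces.linear (pw_scale (*)) (pw_scale (*)) (lie_d mul k :: ('a list \<Rightarrow> 'k::field) \<Rightarrow> _)"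
proof (rule linearI_vs)
  show "vector_space (pw_scale (*) :: 'k \<Rightarrow> ('a list \<Rightarrow> 'k) \<Rightarrow> _)"
    by (rule vector_space_pw_scale[OF vector_space_times])
  then show "vector_space (pw_scale (*) :: 'k \<Rightarrow> ('a list \<Rightarrow> 'k) \<Rightarrow> _)" .
  fix \<phi> \<theta> :: "'a list \<Rightarrow> 'k" and c
  show "lie_d mul k (\<phi> + \<theta>) = lie_d mul k \<phi> + lie_d mul k \<theta>"
    by (simp add: fun_eq_iff lie_d_def distrib_left sum.distrib)
  show "lie_d mul k (pw_scale (*) c \<phi>) = pw_scale (*) c (lie_d mul k \<phi>)"
    by (simp add: fun_eq_iff lie_d_def pw_scale_def sum_distrib_left mult.left_commute)
qed

lemma rsym_d_linear:
  fixes sM :: "'k::field \<Rightarrow> 'm::ab_group_add \<Rightarrow> 'm" and mul :: "'a::ab_group_add \<Rightarrow> 'a \<Rightarrow> 'a"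
  assumes "vector_space sM" and l: "\<And>a. Vector_Spaces.linear sM sM (l a)"
    and r: "\<And>a. Vector_Spaces.linear sM sM (\<lambda>m. r m a)"
  shows "Vector_Spaces.linear (pw_scale sM) (pw_scale sM) (rsym_d mul sM l r k)"
proof -
  interpret vector_space sM by fact
  note simps = linearD(1,2)[OF l] linearD(1,2)[OF r]
  show ?thesis
  proof (rule linearI_vs)
    show "vector_space (pw_scale sM :: 'k \<Rightarrow> ('a list \<Rightarrow> 'm) \<Rightarrow> _)"
      by (rule vector_space_pw_scale[OF assms(1)])
    then show "vector_space (pw_scale sM :: 'k \<Rightarrow> ('a list \<Rightarrow> 'm) \<Rightarrow> _)" .
    fix \<phi> \<theta> :: "'a list \<Rightarrow> 'm" and c
    show "rsym_d mul sM l r k (\<phi> + \<theta>) = rsym_d mul sM l r k \<phi> + rsym_d mul sM l r k \<theta>"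
    proof
      show "rsym_d mul sM l r k (\<phi> + \<theta>) xs = (rsym_d mul sM l r k \<phi> + rsym_d mul sM l r k \<theta>) xs" for xs
        by (simp add: rsym_d_def simps scale_right_distrib scale_right_diff_distrib
          sum.distrib sum_subtractf sum_negf algebra_simps)
    qed
    show "rsym_d mul sM l r k (pw_scale sM c \<phi>) = pw_scale sM c (rsym_d mul sM l r k \<phi>)"
    proof
      show "rsym_d mul sM l r k (pw_scale sM c \<phi>) xs = pw_scale sM c (rsym_d mul sM l r k \<phi>) xs" for xs
        by (simp add: rsym_d_def pw_scale_def simps scale_right_distrib scale_right_diff_distrib
          scale_sum_right mult.commute)
    qed
  qed
qed

lemma bilinear_cup:
  fixes sM :: "'k::field \<Rightarrow> 'm::ab_group_add \<Rightarrow> 'm"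
  assumes "vector_space sM"
  shows "bilinear_map (pw_scale sM) (pw_scale (*)) (pw_scale sM)
    (cup sM :: ('a list \<Rightarrow> 'm) \<Rightarrow> ('a list \<Rightarrow> 'k) \<Rightarrow> _)"
proof -
  interpret vector_space sM by fact
  show ?thesis
    unfolding bilinear_map_def
    by (intro conjI allI linearI_vs vector_space_pw_scale vector_space_times assms)
      (simp_all add: fun_eq_iff cup_def pw_scale_def scale_left_distrib scale_right_distrib mult.commute
        split: list.split)
qed

context gl_bimodule
begin

lemma derivation_linear: "Vector_Spaces.linear sV (pw_scale sM) derivation"
proof (rule linearI_vs)
  show "vector_space sV" by (rule V.vector_space_axioms)
  show "vector_space (pw_scale sM :: 'k \<Rightarrow> (('k^'n^'n) list \<Rightarrow> 'm) \<Rightarrow> _)"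
    by (rule vector_space_pw_scale[OF vector_space_axioms])
  have d: "derivation v xs = (case xs of [] \<Rightarrow> 0 | a # as \<Rightarrow> if as = [] then ev v a else 0)" for v xs
    by (simp add: derivation_def of_lie_cochain_def ev_simps split: list.split)
  show "derivation (x + y) = derivation x + derivation y" for x y
    by (rule ext) (simp add: d ev_simps split: list.split)
  show "derivation (sV c x) = pw_scale sM c (derivation x)" for c x
    by (rule ext) (simp add: d pw_scale_def[of sM c "derivation x"] ev_simps split: list.split)
qed

end

theorem theorem5p9:
  fixes sM :: "'k::field_char_0 \<Rightarrow> 'm::ab_group_add \<Rightarrow> 'm"
    and B :: "'m set"
    and l :: "'k^'n^'n \<Rightarrow> 'm \<Rightarrow> 'm"
    and r :: "'m \<Rightarrow> 'k^'n^'n \<Rightarrow> 'm"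
    and k :: nat
  assumes "finite_dimensional_vector_space sM B"
    and "rsym_module mat_scale (**) sM l r"
    and "tensor_module sM (lie_action l r)"
    and "k > 0"
  shows "\<exists>\<Phi>.
    linear_iso_on
      (tensor_scale (pw_scale sM) (rsym_Z mat_scale (**) sM l r 1)
         (lie_H_scale mat_scale (**) k) (lie_H mat_scale (**) k))
      (tensor_product (pw_scale sM) (rsym_Z mat_scale (**) sM l r 1)
         (lie_H_scale mat_scale (**) k) (lie_H mat_scale (**) k))
      (rsym_H_scale mat_scale (**) sM l r (k + 1))
      (rsym_H mat_scale (**) sM l r (k + 1))
      \<Phi> \<and>
    (\<forall>\<psi> \<in> rsym_Z mat_scale (**) sM l r 1. \<forall>\<phi> \<in> lie_Z mat_scale (**) k.
       \<Phi> (pure_tensor (pw_scale sM) (rsym_Z mat_scale (**) sM l r 1)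
             (lie_H_scale mat_scale (**) k) (lie_H mat_scale (**) k)
             \<psi> (lie_class mat_scale (**) k \<phi>))
       = rsym_class mat_scale (**) sM l r (k + 1) (cup sM \<psi> \<phi>))"
proof -
  interpret gl_bimodule sM B l r
    by (intro gl_bimodule.intro gl_bimodule_axioms.intro assms)
  \<comment> \<open>Here the tensor module hypothesis enters: it yields the eigenvectors of
    \<open>T\<close> that \<open>center_semisimple\<close> asks for.\<close>
  have "T = lie_action l r (mat 1)" by (auto simp: T_def lie_action_def)
  then have "m \<in> span {u. \<exists>c. T u = sM c u}" for m
    using tensor_module_eigen_span[OF vector_space_axioms assms(3)] by simp
  then interpret gl_bimodule_semisimple sM B l r
    by unfold_locales (rule center_semisimple)
  obtain I where I: "finite I" "I \<subseteq> invariants"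
    "\<And>v. v \<in> invariants \<Longrightarrow> \<exists>c. v = (\<Sum>b\<in>I. sV (c b) b)"
    "\<And>\<omega>. \<omega> \<in> rsym_Z mat_scale (**) sM l r (Suc k) \<Longrightarrow> \<exists>\<phi>. (\<forall>b\<in>I. \<phi> b \<in> lie_Z mat_scale (**) k) \<and>
      \<omega> - (\<Sum>b\<in>I. cup sM (derivation b) (\<phi> b)) \<in> rsym_B mat_scale (**) sM l r (Suc k)"
    "\<And>\<phi>. (\<And>b. b \<in> I \<Longrightarrow> \<phi> b \<in> lie_Z mat_scale (**) k) \<Longrightarrow>
      (\<Sum>b\<in>I. cup sM (derivation b) (\<phi> b)) \<in> rsym_B mat_scale (**) sM l r (Suc k) \<Longrightarrow>
      \<forall>b\<in>I. \<phi> b \<in> lie_B mat_scale (**) k"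
    using cup_basis[OF assms(4)] by blast
  have vsM: "vector_space (pw_scale sM :: 'k \<Rightarrow> (('k^'n^'n) list \<Rightarrow> 'm) \<Rightarrow> _)"
    by (rule vector_space_pw_scale[OF vector_space_axioms])
  have vsK: "vector_space (pw_scale (*) :: 'k \<Rightarrow> (('k^'n^'n) list \<Rightarrow> 'k) \<Rightarrow> _)"
    by (rule vector_space_pw_scale[OF vector_space_times])
  interpret K: cochains mat_scale "(*) :: 'k \<Rightarrow> 'k \<Rightarrow> 'k"
    by (intro cochains.intro vector_space_mat_scale vector_space_times)
  note d = rsym_d_linear[OF vector_space_axioms l_linear r_linear_left]
  have C: "module.subspace (pw_scale sM) (rsym_C mat_scale (**) sM r (Suc j))" for j
    by (simp add: rsym_C_def MC.subspace_MA)
  have lC: "module.subspace (pw_scale (*)) (lie_C mat_scale j :: (('k^'n^'n) list \<Rightarrow> 'k) set)" for j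
    unfolding lie_C_def by (rule K.subspace_MA)
  obtain k' where k': "k = Suc k'" using assms(4) by (cases k) auto
  interpret TP: tensor_pairing "pw_scale sM" "pw_scale (*)" "pw_scale sM" "rsym_Z mat_scale (**) sM l r 1"
    "lie_Z mat_scale (**) k" "lie_B mat_scale (**) k"
    "rsym_Z mat_scale (**) sM l r (Suc k)" "rsym_B mat_scale (**) sM l r (Suc k)"
    "cup sM" I derivation
  proof (intro tensor_pairing.intro tensor_pairing_axioms.intro vsM vsK)
    show "module.subspace (pw_scale sM) (rsym_Z mat_scale (**) sM l r 1)"
      unfolding rsym_Z_def One_nat_def by (rule subspace_kernel[OF d C])
    show "module.subspace (pw_scale sM) (rsym_Z mat_scale (**) sM l r (Suc k))"
      unfolding rsym_Z_def by (rule subspace_kernel[OF d C])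
    show "module.subspace (pw_scale sM) (rsym_B mat_scale (**) sM l r (Suc k))"
      unfolding rsym_B_def nat.case k' by (rule module_hom.subspace_image[OF linear_module_hom[OF d] C])
    show "module.subspace (pw_scale (*)) (lie_Z mat_scale (**) k :: (('k^'n^'n) list \<Rightarrow> 'k) set)"
      unfolding lie_Z_def by (rule subspace_kernel[OF lie_d_linear lC])
    show "module.subspace (pw_scale (*)) (lie_B mat_scale (**) k :: (('k^'n^'n) list \<Rightarrow> 'k) set)"
      unfolding lie_B_def k' nat.case by (rule module_hom.subspace_image[OF linear_module_hom[OF lie_d_linear] lC])
    show "bilinear_map (pw_scale sM) (pw_scale (*)) (pw_scale sM) (cup sM)"
      by (rule bilinear_cup[OF vector_space_axioms])
    show "cup sM \<psi> \<phi> \<in> rsym_Z mat_scale (**) sM l r (Suc k)"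
      if "\<psi> \<in> rsym_Z mat_scale (**) sM l r 1" "\<phi> \<in> lie_Z mat_scale (**) k" for \<psi> \<phi>
      using that by (rule cup_in_Z)
    show "cup sM \<psi> \<phi> \<in> rsym_B mat_scale (**) sM l r (Suc k)"
      if "\<psi> \<in> rsym_Z mat_scale (**) sM l r 1" "\<phi> \<in> lie_B mat_scale (**) k" for \<psi> \<phi>
      using that assms(4) by (rule cup_in_B)
    show "finite I" by (rule I)
    show "derivation b \<in> rsym_Z mat_scale (**) sM l r 1" if "b \<in> I" for b
      using that I(2) unfolding rsym_Z1 by blast
    show "\<exists>c. \<psi> = (\<Sum>b\<in>I. pw_scale sM (c b) (derivation b))"
      if \<psi>: "\<psi> \<in> rsym_Z mat_scale (**) sM l r 1" for \<psi>
    proof -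
      obtain v where v: "v \<in> invariants" "\<psi> = derivation v" using \<psi> unfolding rsym_Z1 by blast
      obtain c where "v = (\<Sum>b\<in>I. sV (c b) b)" using I(3)[OF v(1)] by blast
      then have "\<psi> = (\<Sum>b\<in>I. pw_scale sM (c b) (derivation b))"
        unfolding v(2) by (simp only: linearD[OF derivation_linear])
      then show ?thesis by (intro exI[of _ c])
    qed
    show "\<exists>x. (\<forall>b\<in>I. x b \<in> lie_Z mat_scale (**) k) \<and>
        z - (\<Sum>b\<in>I. cup sM (derivation b) (x b)) \<in> rsym_B mat_scale (**) sM l r (Suc k)"
      if "z \<in> rsym_Z mat_scale (**) sM l r (Suc k)" for z
      using that by (rule I(4))
    show "\<forall>b\<in>I. x b \<in> lie_B mat_scale (**) k"
      if "\<forall>b\<in>I. x b \<in> lie_Z mat_scale (**) k"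
        "(\<Sum>b\<in>I. cup sM (derivation b) (x b)) \<in> rsym_B mat_scale (**) sM l r (Suc k)" for x
      by (rule I(5)[OF bspec[OF that(1)] that(2)])
  qed
  show ?thesis
    using TP.tensor_iso
    unfolding lie_H_def lie_H_scale_def lie_class_def rsym_H_def rsym_H_scale_def rsym_class_def
      Suc_eq_plus1[symmetric] .
qed

end
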